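(* Let $Q$ be a Dynkin quiver of type $\mathbb{A}$, say of type $\mathbb{A}_{n+2}$ with $n\ge 0$. Then the set $\mathrm{mar}(Q)$ of (isomorphism classes of) maximal almost rigid representations of $Q$, partially ordered by the covering relation below, is isomorphic as a poset to the Cambrian lattice coming from $Q$. Covering relation on $\mathrm{mar}(Q)$: $T_1$ is covered by $T_2$ if there exist indecomposable summands $M_i$ of $T_i$ ($i=1,2$) such that $T_1/M_1\cong T_2/M_2$ and there is a non-split short exact sequence $0\to M_1\to E\oplus E'\to M_2\to 0$ with $E,E'$ indecomposable summands of $T_1/M_1$.
   Context: $\Bbbk$ is an algebraically closed field. A Dynkin quiver $Q$ of type $\mathbb{A}_{n+2}$ has vertices $1,\dots,n+2$ and, for each $1\le i\le n+1$, exactly one arrow between $i$ and $i+1$, in either direction. Representations are finite-dimensional over $\Bbbk$. Almost rigid: $T$ is almost rigid if it has no repeated indecomposable summands and for each pair $A,B$ of indecomposable summands of $T$, either $\mathrm{Ext}^1(A,B)=0$, or $\mathrm{Ext}^1(A,B)\cong\Bbbk$ is generated by a short exact sequence $0\to B\to E\to A\to 0$ with $E$ indecomposable. $T$ is maximal almost rigid if it is almost rigid and $T\oplus M$ is not almost rigid for every nonzero $M$. For a direct summand $M$ of $T$, $T/M$ denotes the complementary direct summand. The partial order on $\mathrm{mar}(Q)$ is the reflexive-transitive closure of the covering relation. Polygon $P(Q)$: put $\overline{[n+1]}=\{i\in[n+1] : i\to (i+1)\text{ in }Q\}$ and $\underline{[n+1]}=\{i\in[n+1]: i\leftarrow (i+1)\text{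 in }Q\}$, where $[n+1]=\{1,\dots,n+1\}$. $P(Q)$ is a convex $(n+3)$-gon in the plane with vertices labeled $0,1,\dots,n+2$ placed from left to right in this order, with $0$ and $n+2$ on a common horizontal line $L$, the vertices in $\overline{[n+1]}$ above $L$ and those in $\underline{[n+1]}$ below $L$. A triangulation of $P(Q)$ is a maximal set of pairwise noncrossing line segments between vertices (including boundary edges). Cambrian lattice coming from $Q$: the set of triangulations of $P(Q)$ with the partial order induced by the covering relation: $\mathcal{T}_1$ is covered by $\mathcal{T}_2$ if there exist two diagonals $\gamma_1\ne\gamma_2$ with $\gamma_1\in\mathcal{T}_1$, $\gamma_2\in\mathcal{T}_2$, $\mathcal{T}_1\setminus\{\gamma_1\}=\mathcal{T}_2\setminus\{\gamma_2\}$ and the slope of $\gamma_1$ is smaller than the slope of $\gamma_2$. *)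

theory Defs
  imports
    "HOL-Analysis.Line_Segment"
    "Jordan_Normal_Form.Matrix_Kernel"
    "Graph_Theory.Digraph"
begin

section \<open>Quiver representations\<close>

text \<open>
  A quiver is a \<open>pre_digraph\<close> (parallel arrows are allowed). A finite-dimensional representation
  over the field \<open>'k\<close> has the coordinate space \<open>'k^(vdim V v)\<close> at each vertex \<open>v\<close> and a matrix
  acting on column vectors at each arrow. Values outside \<open>verts Q\<close> and \<open>arcs Q\<close> carry no meaning,
  and no definition below depends on them.
\<close>

record ('v, 'a, 'k) qrep =
  vdim :: "'v \<Rightarrow> nat"
  amap :: "'a \<Rightarrow> 'k mat"

type_synonym ('v, 'k) matfam = "'v \<Rightarrow> 'k mat"

definition is_rep :: "('v, 'a) pre_digraph \<Rightarrow> ('v, 'a, 'k::field) qrep \<Rightarrow> bool" where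
  "is_rep Q V \<longleftrightarrow>
     (\<forall>a\<in>arcs Q. amap V a \<in> carrier_mat (vdim V (head Q a)) (vdim V (tail Q a)))"

definition rep_hom ::
    "('v, 'a) pre_digraph \<Rightarrow> ('v, 'a, 'k::field) qrep \<Rightarrow> ('v, 'a, 'k) qrep \<Rightarrow> ('v, 'k) matfam \<Rightarrow> bool"
  where
  "rep_hom Q V W f \<longleftrightarrow>
     (\<forall>v\<in>verts Q. f v \<in> carrier_mat (vdim W v) (vdim V v)) \<and>
     (\<forall>a\<in>arcs Q. f (head Q a) * amap V a = amap W a * f (tail Q a))"

definition id_fam :: "('v, 'a, 'k::field) qrep \<Rightarrow> ('v, 'k) matfam" where
  "id_fam V = (\<lambda>v. 1\<^sub>m (vdim V v))"

definition rep_iso ::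
    "('v, 'a) pre_digraph \<Rightarrow> ('v, 'a, 'k::field) qrep \<Rightarrow> ('v, 'a, 'k) qrep \<Rightarrow> bool" where
  "rep_iso Q V W \<longleftrightarrow>
     (\<exists>f g. rep_hom Q V W f \<and> rep_hom Q W V g \<and>
        (\<forall>v\<in>verts Q. g v * f v = id_fam V v \<and> f v * g v = id_fam W v))"

definition dsum_mat :: "'k::field mat \<Rightarrow> 'k mat \<Rightarrow> 'k mat" where
  "dsum_mat A B = four_block_mat A (0\<^sub>m (dim_row A) (dim_col B)) (0\<^sub>m (dim_row B) (dim_col A)) B"

definition dsum :: "('v, 'a, 'k::field) qrep \<Rightarrow> ('v, 'a, 'k) qrep \<Rightarrow> ('v, 'a, 'k) qrep" where
  "dsum V W = \<lparr>vdim = (\<lambda>v. vdim V v + vdim W v), amap = (\<lambda>a. dsum_mat (amap V a) (amap W a))\<rparr>"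

definition zero_rep :: "('v, 'a) pre_digraph \<Rightarrow> ('v, 'a, 'k::field) qrep \<Rightarrow> bool" where
  "zero_rep Q V \<longleftrightarrow> (\<forall>v\<in>verts Q. vdim V v = 0)"

definition indecomposable :: "('v, 'a) pre_digraph \<Rightarrow> ('v, 'a, 'k::field) qrep \<Rightarrow> bool" where
  "indecomposable Q V \<longleftrightarrow> is_rep Q V \<and> \<not> zero_rep Q V \<and>
     (\<forall>A B. is_rep Q A \<longrightarrow> is_rep Q B \<longrightarrow> rep_iso Q V (dsum A B) \<longrightarrow> zero_rep Q A \<or> zero_rep Q B)"

text \<open>\<open>M\<close> is, up to isomorphism, a direct summand of \<open>T\<close>, with complementary summand \<open>C = T/M\<close>.\<close>

definition complement ::
    "('v, 'a) pre_digraph \<Rightarrow> ('v, 'a, 'k::field) qrep \<Rightarrow> ('v, 'a, 'k) qrep \<Rightarrow> ('v, 'a, 'k) qrep \<Rightarrow> bool"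
  where
  "complement Q T M C \<longleftrightarrow> is_rep Q M \<and> is_rep Q C \<and> rep_iso Q T (dsum M C)"

definition indec_summand ::
    "('v, 'a) pre_digraph \<Rightarrow> ('v, 'a, 'k::field) qrep \<Rightarrow> ('v, 'a, 'k) qrep \<Rightarrow> bool" where
  "indec_summand Q T M \<longleftrightarrow> indecomposable Q M \<and> (\<exists>C. complement Q T M C)"


section \<open>Short exact sequences and Yoneda extensions\<close>

definition short_exact ::
    "('v, 'a) pre_digraph \<Rightarrow> ('v, 'a, 'k::field) qrep \<Rightarrow> ('v, 'a, 'k) qrep \<Rightarrow> ('v, 'a, 'k) qrep \<Rightarrow>
     ('v, 'k) matfam \<Rightarrow> ('v, 'k) matfam \<Rightarrow> bool" where
  "short_exact Q B E A f g \<longleftrightarrow> rep_hom Q B E f \<and> rep_hom Q E A g \<and>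
     (\<forall>v\<in>verts Q.
        inj_on (\<lambda>x. f v *\<^sub>v x) (carrier_vec (vdim B v)) \<and>
        (\<lambda>x. f v *\<^sub>v x) ` carrier_vec (vdim B v) = mat_kernel (g v) \<and>
        (\<lambda>x. g v *\<^sub>v x) ` carrier_vec (vdim E v) = carrier_vec (vdim A v))"

definition splits ::
    "('v, 'a) pre_digraph \<Rightarrow> ('v, 'a, 'k::field) qrep \<Rightarrow> ('v, 'a, 'k) qrep \<Rightarrow> ('v, 'k) matfam \<Rightarrow> bool"
  where
  "splits Q E A g \<longleftrightarrow> (\<exists>s. rep_hom Q A E s \<and> (\<forall>v\<in>verts Q. g v * s v = id_fam A v))"

text \<open>The triple \<open>(E, f, g)\<close> stands for the sequence \<open>0 \<rightarrow> B \<rightarrow> E \<rightarrow> A \<rightarrow> 0\<close> with maps \<open>f\<close> and \<open>g\<close>.\<close>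

type_synonym ('v, 'a, 'k) extn = "('v, 'a, 'k) qrep \<times> ('v, 'k) matfam \<times> ('v, 'k) matfam"

definition extensions ::
    "('v, 'a) pre_digraph \<Rightarrow> ('v, 'a, 'k::field) qrep \<Rightarrow> ('v, 'a, 'k) qrep \<Rightarrow> ('v, 'a, 'k) extn set" where
  "extensions Q A B = {(E, f, g). is_rep Q E \<and> short_exact Q B E A f g}"

text \<open>\<open>(\<beta>, h, \<alpha>)\<close> is a morphism of sequences for some middle map \<open>h\<close>.\<close>

definition extn_mor ::
    "('v, 'a) pre_digraph \<Rightarrow> ('v, 'k::field) matfam \<Rightarrow> ('v, 'k) matfam \<Rightarrow>
     ('v, 'a, 'k) extn \<Rightarrow> ('v, 'a, 'k) extn \<Rightarrow> bool" where
  "extn_mor Q \<beta> \<alpha> = (\<lambda>(E, f, g) (E', f', g').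
     \<exists>h. rep_hom Q E E' h \<and> (\<forall>v\<in>verts Q. h v * f v = f' v * \<beta> v \<and> g' v * h v = \<alpha> v * g v))"

definition extn_equiv ::
    "('v, 'a) pre_digraph \<Rightarrow> ('v, 'a, 'k::field) qrep \<Rightarrow> ('v, 'a, 'k) qrep \<Rightarrow>
     (('v, 'a, 'k) extn \<times> ('v, 'a, 'k) extn) set" where
  "extn_equiv Q A B = {(\<xi>, \<eta>). \<xi> \<in> extensions Q A B \<and> \<eta> \<in> extensions Q A B \<and>
     extn_mor Q (id_fam B) (id_fam A) \<xi> \<eta>}"

definition Ext1 ::
    "('v, 'a) pre_digraph \<Rightarrow> ('v, 'a, 'k::field) qrep \<Rightarrow> ('v, 'a, 'k) qrep \<Rightarrow> ('v, 'a, 'k) extn set set" where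
  "Ext1 Q A B = extensions Q A B // extn_equiv Q A B"

text \<open>
  The vector space structure of \<open>Ext1\<close>. A morphism \<open>(\<beta>, h, id)\<close> exhibits its target as the pushout
  \<open>\<beta> \<xi>\<close> of its source, and a morphism \<open>(id, h, \<alpha>)\<close> exhibits its source as the pullback \<open>\<eta> \<alpha>\<close>
  of its target; both are unique up to equivalence. The scalar \<open>c\<close> acts by pushout along \<open>c id\<close>,
  and the Baer sum of \<open>\<xi>\<close> and \<open>\<eta>\<close> is \<open>\<nabla> (\<xi> \<oplus> \<eta>) \<Delta>\<close>.
\<close>

definition ext_smult ::
    "('v, 'a) pre_digraph \<Rightarrow> ('v, 'a, 'k::field) qrep \<Rightarrow> ('v, 'a, 'k) qrep \<Rightarrow>
     'k \<Rightarrow> ('v, 'a, 'k) extn set \<Rightarrow> ('v, 'a, 'k) extn set" where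
  "ext_smult Q A B c X = {\<eta> \<in> extensions Q A B.
     \<exists>\<xi>\<in>X. extn_mor Q (\<lambda>v. c \<cdot>\<^sub>m id_fam B v) (id_fam A) \<xi> \<eta>}"

definition diagonal_fam :: "('v, 'a, 'k::field) qrep \<Rightarrow> ('v, 'k) matfam" where
  "diagonal_fam V = (\<lambda>v. let d = vdim V v in
     four_block_mat (1\<^sub>m d) (0\<^sub>m d 0) (1\<^sub>m d) (0\<^sub>m d 0))"

definition codiagonal_fam :: "('v, 'a, 'k::field) qrep \<Rightarrow> ('v, 'k) matfam" where
  "codiagonal_fam V = (\<lambda>v. let d = vdim V v in
     four_block_mat (1\<^sub>m d) (1\<^sub>m d) (0\<^sub>m 0 d) (0\<^sub>m 0 d))"

definition extn_dsum :: "('v, 'a, 'k::field) extn \<Rightarrow> ('v, 'a, 'k) extn \<Rightarrow> ('v, 'a, 'k) extn" where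
  "extn_dsum = (\<lambda>(E, f, g) (E', f', g').
     (dsum E E', \<lambda>v. dsum_mat (f v) (f' v), \<lambda>v. dsum_mat (g v) (g' v)))"

definition baer_sum ::
    "('v, 'a) pre_digraph \<Rightarrow> ('v, 'a, 'k::field) qrep \<Rightarrow> ('v, 'a, 'k) qrep \<Rightarrow>
     ('v, 'a, 'k) extn set \<Rightarrow> ('v, 'a, 'k) extn set \<Rightarrow> ('v, 'a, 'k) extn set" where
  "baer_sum Q A B X Y = {\<theta> \<in> extensions Q A B.
     \<exists>\<xi>\<in>X. \<exists>\<eta>\<in>Y. \<exists>\<zeta>\<in>extensions Q (dsum A A) B.
       extn_mor Q (codiagonal_fam B) (id_fam (dsum A A)) (extn_dsum \<xi> \<eta>) \<zeta> \<and>
       extn_mor Q (id_fam B) (diagonal_fam A) \<theta> \<zeta>}"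

text \<open>\<open>Ext1 Q A B\<close> is isomorphic to the ground field, with the class of \<open>\<xi>\<close> as a generator.\<close>

definition Ext1_line_generated_by ::
    "('v, 'a) pre_digraph \<Rightarrow> ('v, 'a, 'k::field) qrep \<Rightarrow> ('v, 'a, 'k) qrep \<Rightarrow>
     ('v, 'a, 'k) extn \<Rightarrow> bool" where
  "Ext1_line_generated_by Q A B \<xi> \<longleftrightarrow> \<xi> \<in> extensions Q A B \<and>
     (\<exists>\<phi>. bij_betw \<phi> (UNIV :: 'k set) (Ext1 Q A B) \<and>
        (\<forall>c d. \<phi> (c + d) = baer_sum Q A B (\<phi> c) (\<phi> d)) \<and>
        (\<forall>c d. \<phi> (c * d) = ext_smult Q A B c (\<phi> d)) \<and>
        \<phi> 1 = extn_equiv Q A B `` {\<xi>})"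


section \<open>Maximal almost rigid representations\<close>

text \<open>A vector space is zero iff it has a single element.\<close>

definition almost_rigid :: "('v, 'a) pre_digraph \<Rightarrow> ('v, 'a, 'k::field) qrep \<Rightarrow> bool" where
  "almost_rigid Q T \<longleftrightarrow> is_rep Q T \<and>
     (\<nexists>M C. indecomposable Q M \<and> is_rep Q C \<and> rep_iso Q T (dsum (dsum M M) C)) \<and>
     (\<forall>A B. indec_summand Q T A \<longrightarrow> indec_summand Q T B \<longrightarrow>
        is_singleton (Ext1 Q A B) \<or>
        (\<exists>E f g. indecomposable Q E \<and> Ext1_line_generated_by Q A B (E, f, g)))"

definition maximal_almost_rigid :: "('v, 'a) pre_digraph \<Rightarrow> ('v, 'a, 'k::field) qrep \<Rightarrow> bool" where
  "maximal_almost_rigid Q T \<longleftrightarrow> almost_rigid Q T \<and>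
     (\<forall>M. is_rep Q M \<longrightarrow> \<not> zero_rep Q M \<longrightarrow> \<not> almost_rigid Q (dsum T M))"

definition mar :: "('v, 'a) pre_digraph \<Rightarrow> ('v, 'a, 'k::field) qrep set set" where
  "mar Q = {T. maximal_almost_rigid Q T} // {(T, T'). is_rep Q T \<and> is_rep Q T' \<and> rep_iso Q T T'}"

definition mar_covers ::
    "('v, 'a) pre_digraph \<Rightarrow> ('v, 'a, 'k::field) qrep \<Rightarrow> ('v, 'a, 'k) qrep \<Rightarrow> bool" where
  "mar_covers Q T\<^sub>1 T\<^sub>2 \<longleftrightarrow>
     (\<exists>M\<^sub>1 M\<^sub>2 C\<^sub>1 C\<^sub>2 E E' f g.
        indecomposable Q M\<^sub>1 \<and> complement Q T\<^sub>1 M\<^sub>1 C\<^sub>1 \<and>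
        indecomposable Q M\<^sub>2 \<and> complement Q T\<^sub>2 M\<^sub>2 C\<^sub>2 \<and>
        rep_iso Q C\<^sub>1 C\<^sub>2 \<and>
        indec_summand Q C\<^sub>1 E \<and> indec_summand Q C\<^sub>1 E' \<and>
        short_exact Q M\<^sub>1 (dsum E E') M\<^sub>2 f g \<and> \<not> splits Q (dsum E E') M\<^sub>2 g)"

definition mar_cover_rel ::
    "('v, 'a) pre_digraph \<Rightarrow> (('v, 'a, 'k::field) qrep set \<times> ('v, 'a, 'k) qrep set) set" where
  "mar_cover_rel Q = {(X, Y). X \<in> mar Q \<and> Y \<in> mar Q \<and> (\<exists>T\<^sub>1\<in>X. \<exists>T\<^sub>2\<in>Y. mar_covers Q T\<^sub>1 T\<^sub>2)}"

definition mar_order ::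
    "('v, 'a) pre_digraph \<Rightarrow> (('v, 'a, 'k::field) qrep set \<times> ('v, 'a, 'k) qrep set) set" where
  "mar_order Q = (mar_cover_rel Q)\<^sup>* \<inter> mar Q \<times> mar Q"


section \<open>Quivers of type A and the Cambrian poset\<close>

definition dynkin_A :: "nat \<Rightarrow> (nat, 'a) pre_digraph \<Rightarrow> bool" where
  "dynkin_A m Q \<longleftrightarrow> wf_digraph Q \<and> verts Q = {1..m} \<and>
     (\<forall>a\<in>arcs Q. \<exists>i\<in>{1..<m}. {tail Q a, head Q a} = {i, i + 1}) \<and>
     (\<forall>i\<in>{1..<m}. \<exists>!a. a \<in> arcs Q \<and> {tail Q a, head Q a} = {i, i + 1})"

definition upper_set :: "nat \<Rightarrow> (nat, 'a) pre_digraph \<Rightarrow> nat set" where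
  "upper_set n Q = {i \<in> {1..n + 1}. \<exists>a\<in>arcs Q. tail Q a = i \<and> head Q a = i + 1}"

definition lower_set :: "nat \<Rightarrow> (nat, 'a) pre_digraph \<Rightarrow> nat set" where
  "lower_set n Q = {i \<in> {1..n + 1}. \<exists>a\<in>arcs Q. tail Q a = i + 1 \<and> head Q a = i}"

text \<open>
  \<open>p i\<close> is the vertex of \<open>P(Q)\<close> labelled \<open>i\<close>. The last clause says that the points are the
  (distinct) vertices of their convex hull.
\<close>

definition is_polygon :: "nat \<Rightarrow> (nat, 'a) pre_digraph \<Rightarrow> (nat \<Rightarrow> real \<times> real) \<Rightarrow> bool" where
  "is_polygon n Q p \<longleftrightarrow>
     (\<forall>i j. i < j \<and> j \<le> n + 2 \<longrightarrow> fst (p i) < fst (p j)) \<and>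
     snd (p (n + 2)) = snd (p 0) \<and>
     (\<forall>i\<in>upper_set n Q. snd (p i) > snd (p 0)) \<and>
     (\<forall>i\<in>lower_set n Q. snd (p i) < snd (p 0)) \<and>
     (\<forall>i\<le>n + 2. p i \<notin> convex hull (p ` ({..n + 2} - {i})))"

text \<open>The pair \<open>(i, j)\<close> with \<open>i < j\<close> encodes the segment between the vertices labelled \<open>i\<close> and \<open>j\<close>.\<close>

definition segments :: "nat \<Rightarrow> (nat \<times> nat) set" where
  "segments n = {(i, j). i < j \<and> j \<le> n + 2}"

definition crossing :: "(nat \<Rightarrow> real \<times> real) \<Rightarrow> nat \<times> nat \<Rightarrow> nat \<times> nat \<Rightarrow> bool" where
  "crossing p = (\<lambda>(i, j) (k, l).
     (i, j) \<noteq> (k, l) \<and> open_segment (p i) (p j) \<inter> open_segment (p k) (p l) \<noteq> {})"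

definition noncrossing_set :: "nat \<Rightarrow> (nat \<Rightarrow> real \<times> real) \<Rightarrow> (nat \<times> nat) set \<Rightarrow> bool" where
  "noncrossing_set n p S \<longleftrightarrow> S \<subseteq> segments n \<and> (\<forall>s\<in>S. \<forall>t\<in>S. \<not> crossing p s t)"

definition triangulations :: "nat \<Rightarrow> (nat \<Rightarrow> real \<times> real) \<Rightarrow> (nat \<times> nat) set set" where
  "triangulations n p =
     {S. noncrossing_set n p S \<and> (\<forall>S'. noncrossing_set n p S' \<longrightarrow> S \<subseteq> S' \<longrightarrow> S' = S)}"

definition slope :: "(nat \<Rightarrow> real \<times> real) \<Rightarrow> nat \<times> nat \<Rightarrow> real" where
  "slope p = (\<lambda>(i, j). (snd (p j) - snd (p i)) / (fst (p j) - fst (p i)))"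

definition cambrian_cover_rel ::
    "nat \<Rightarrow> (nat \<Rightarrow> real \<times> real) \<Rightarrow> ((nat \<times> nat) set \<times> (nat \<times> nat) set) set" where
  "cambrian_cover_rel n p = {(S\<^sub>1, S\<^sub>2). S\<^sub>1 \<in> triangulations n p \<and> S\<^sub>2 \<in> triangulations n p \<and>
     (\<exists>\<gamma>\<^sub>1\<in>S\<^sub>1. \<exists>\<gamma>\<^sub>2\<in>S\<^sub>2. \<gamma>\<^sub>1 \<noteq> \<gamma>\<^sub>2 \<and> S\<^sub>1 - {\<gamma>\<^sub>1} = S\<^sub>2 - {\<gamma>\<^sub>2} \<and> slope p \<gamma>\<^sub>1 < slope p \<gamma>\<^sub>2)}"

definition cambrian_order ::
    "nat \<Rightarrow> (nat \<Rightarrow> real \<times> real) \<Rightarrow> ((nat \<times> nat) set \<times> (nat \<times> nat) set) set" where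
  "cambrian_order n p = (cambrian_cover_rel n p)\<^sup>* \<inter> triangulations n p \<times> triangulations n p"

end

(*
  Segments (i, j), i < j, between vertices of the polygon index the interval representations
  M[i+1..j], which are the indecomposable ones: induction on the vertices splits an interval off
  any nonzero representation, and the multiplicities are recovered from retractions onto intervals.

  Let s and t be segments whose intervals share a vertex. There is a nonsplit extension of M(s) by
  M(t) if and only if s and t cross and s has the larger slope; the resulting exact sequence has as
  middle term the direct sum of the intervals of two opposite sides of the quadrilateral with
  diagonals s and t, so it is not of the kind that almost rigidity allows. If the intervals share
  no vertex, then Ext is zero or a line generated by an extension with an interval in the middle. So
  T is almost rigid if and only if it is multiplicity free and its segments do not cross, and the
  maximal almost rigid representations correspond to the triangulations.

  A triangulation contains the sides of the quadrilateral of an exchanged pair of diagonals, so the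
  covers of mar(Q) are the flips that increase the slope. The sum of the slopes of all segments
  increases along covers, whence antisymmetry.
*)
theory Submission
  imports Defs "HOL-Library.Function_Algebras"
begin

text \<open>All matrix families lie in one ring of functions on the vertices, so direct sums,
  retracts and exact sequences become ring identities in which domains and codomains are
  idempotents. Over a field a sequence is exact if and only if it splits at each vertex; the failure
  of such a splitting to commute with the arrows, a cocycle, carries all the information on the
  extension. No quotient by coboundaries has to be formed: for intervals with a common vertex only
  the vanishing of Ext is at stake, and for intervals without one the coboundaries are zero, so that
  cocycles classify extensions. The relation \<open>cross\<close> is directed because Ext is not
  symmetric. Convexity of the polygon enters only through the position of a vertex relative to a
  chord passing above or below it; from there on, crossing is a matter of the signs of an affine
  function at two abscissas. That no member of a triangulation crosses a side of the quadrilateral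
  is checked on the cyclic order of the labels, without geometry.\<close>

section \<open>Finitely supported matrices\<close>

text \<open>Padding matrices by zeros to infinite size turns them into elements of one (non-unital)
  ring, in which no dimensions have to be tracked; the identity matrix of size \<open>d\<close> becomes an
  idempotent.\<close>

typedef (overloaded) 'k fmat =
  "{A :: nat \<Rightarrow> nat \<Rightarrow> 'k::zero. \<exists>N. \<forall>i j. N \<le> i \<or> N \<le> j \<longrightarrow> A i j = 0}"
  morphisms ent Abs_fmat
  by (rule exI[of _ "\<lambda>_ _. 0"]) simp

setup_lifting type_definition_fmat

lemma fmat_eqI: "(\<And>i j. ent A i j = ent B i j) \<Longrightarrow> A = B"
  by (metis ent_inject ext)

lemma fmat_eq_iff: "A = B \<longleftrightarrow> (\<forall>i j. ent A i j = ent B i j)"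
  by (metis fmat_eqI)

lemma ent_bounded: "\<exists>N. \<forall>i j. N \<le> i \<or> N \<le> j \<longrightarrow> ent A i j = 0"
  using ent[of A] by simp

instantiation fmat :: (field) ring
begin

lift_definition zero_fmat :: "'a fmat" is "\<lambda>_ _. 0"
  by simp

lift_definition plus_fmat :: "'a fmat \<Rightarrow> 'a fmat \<Rightarrow> 'a fmat" is "\<lambda>A B i j. A i j + B i j"
proof -
  fix A B :: "nat \<Rightarrow> nat \<Rightarrow> 'a"
  assume "\<exists>N. \<forall>i j. N \<le> i \<or> N \<le> j \<longrightarrow> A i j = 0" "\<exists>N. \<forall>i j. N \<le> i \<or> N \<le> j \<longrightarrow> B i j = 0"
  then obtain M N where "\<forall>i j. M \<le> i \<or> M \<le> j \<longrightarrow> A i j = 0" "\<forall>i j. N \<le> i \<or> N \<le> j \<longrightarrow> B i j = 0"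
    by blast
  then show "\<exists>N. \<forall>i j. N \<le> i \<or> N \<le> j \<longrightarrow> A i j + B i j = 0"
    by (intro exI[of _ "max M N"]) auto
qed

lift_definition uminus_fmat :: "'a fmat \<Rightarrow> 'a fmat" is "\<lambda>A i j. - A i j"
  by auto

definition minus_fmat :: "'a fmat \<Rightarrow> 'a fmat \<Rightarrow> 'a fmat" where
  "minus_fmat A B = A + - B"

text \<open>Summing over the support of a row gives a finite sum without choosing a bound. Since the
  support changes with the row, \<open>ent_times_bounded\<close> later replaces it by a fixed range,
  to which the usual laws of sums apply.\<close>

lift_definition times_fmat :: "'a fmat \<Rightarrow> 'a fmat \<Rightarrow> 'a fmat" is
  "\<lambda>A B i j. \<Sum>k | A i k \<noteq> 0. A i k * B k j"
proof -
  fix A B :: "nat \<Rightarrow> nat \<Rightarrow> 'a"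
  assume "\<exists>N. \<forall>i j. N \<le> i \<or> N \<le> j \<longrightarrow> A i j = 0" "\<exists>N. \<forall>i j. N \<le> i \<or> N \<le> j \<longrightarrow> B i j = 0"
  then obtain M N where "\<forall>i j. M \<le> i \<or> M \<le> j \<longrightarrow> A i j = 0" "\<forall>i j. N \<le> i \<or> N \<le> j \<longrightarrow> B i j = 0"
    by blast
  then show "\<exists>N. \<forall>i j. N \<le> i \<or> N \<le> j \<longrightarrow> (\<Sum>k | A i k \<noteq> 0. A i k * B k j) = 0"
    by (intro exI[of _ "max M N"]) auto
qed

lemma ent_times_bounded:
  assumes "\<And>k. N \<le> k \<Longrightarrow> ent A i k = 0"
  shows "ent (A * B) i j = (\<Sum>k<N. ent A i k * ent B k j)"
  unfolding times_fmat.rep_eq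
  by (rule sum.mono_neutral_left) (use assms in \<open>auto simp: not_less[symmetric]\<close>)

instance
proof
  fix A B C :: "'a fmat"
  obtain M N where M: "\<And>i j. M \<le> i \<or> M \<le> j \<Longrightarrow> ent A i j = 0"
    and N: "\<And>i j. N \<le> i \<or> N \<le> j \<Longrightarrow> ent B i j = 0"
    using ent_bounded[of A] ent_bounded[of B] by blast
  have AX: "ent (A * X) i j = (\<Sum>k<M. ent A i k * ent X k j)" for X i j
    by (rule ent_times_bounded) (use M in auto)
  have BX: "ent (B * X) i j = (\<Sum>k<N. ent B i k * ent X k j)" for X i j
    by (rule ent_times_bounded) (use N in auto)
  have ABX: "ent (A * B * X) i j = (\<Sum>k<N. ent (A * B) i k * ent X k j)" for X i j
    by (rule ent_times_bounded) (use N in \<open>auto simp: AX\<close>)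
  show "A * B * C = A * (B * C)"
    by (rule fmat_eqI)
      (simp add: ABX AX BX sum_distrib_left sum_distrib_right mult.assoc, rule sum.swap)
  show "A + B + C = A + (B + C)" "A + B = B + A" "0 + A = A" "- A + A = 0" "A - B = A + - B"
    unfolding minus_fmat_def
    by (simp_all add: fmat_eq_iff plus_fmat.rep_eq zero_fmat.rep_eq uminus_fmat.rep_eq add.assoc add.commute)
  obtain L where L: "\<And>i j. L \<le> i \<or> L \<le> j \<Longrightarrow> ent A i j = 0"
      "\<And>i j. L \<le> i \<or> L \<le> j \<Longrightarrow> ent B i j = 0"
    using M N by (metis le_trans linear)
  have "ent (X * C) i j = (\<Sum>k<L. ent X i k * ent C k j)"
    if "X \<in> {A, B, A + B}" for X i j
    by (rule ent_times_bounded) (use that L in \<open>auto simp: plus_fmat.rep_eq\<close>)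
  then show "(A + B) * C = A * C + B * C"
    by (simp add: fmat_eq_iff plus_fmat.rep_eq distrib_right sum.distrib)
  show "A * (B + C) = A * B + A * C"
    by (simp add: fmat_eq_iff plus_fmat.rep_eq AX distrib_left sum.distrib)
qed

end

lemma ent_zero [simp]: "ent 0 i j = 0"
  by (simp add: zero_fmat.rep_eq)

lemma ent_add [simp]: "ent (A + B) i j = ent A i j + ent B i j"
  by (simp add: plus_fmat.rep_eq)

lemma ent_uminus [simp]: "ent (- A) i j = - ent A i j"
  by (simp add: uminus_fmat.rep_eq)

lemma ent_diff [simp]: "ent (A - B) i j = ent A i j - ent B i j"
  unfolding minus_fmat_def by (simp only: ent_add ent_uminus) simp

lift_definition idm :: "nat \<Rightarrow> 'k::field fmat" is "\<lambda>d i j. if i = j \<and> i < d then 1 else 0"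
  by (metis leD)

lift_definition sm :: "'k::field \<Rightarrow> 'k fmat \<Rightarrow> 'k fmat" is "\<lambda>c A i j. c * A i j"
  by auto

text \<open>The inclusion of the last e of d + e coordinates; \<open>shift_up\<close> is the
  projection onto them. Together with \<open>idm d\<close> they are the structure maps of a direct
  sum.\<close>

lift_definition shift_down :: "nat \<Rightarrow> nat \<Rightarrow> 'k::field fmat" is
  "\<lambda>d e i j. if i = d + j \<and> j < e then 1 else 0"
  by (rule_tac x = "nat1 + nat2" in exI) auto

lift_definition shift_up :: "nat \<Rightarrow> nat \<Rightarrow> 'k::field fmat" is
  "\<lambda>d e i j. if j = d + i \<and> i < e then 1 else 0"
  by (rule_tac x = "nat1 + nat2" in exI) auto

lift_definition fm_of :: "'k::field mat \<Rightarrow> 'k fmat" is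
  "\<lambda>A i j. if i < dim_row A \<and> j < dim_col A then A $$ (i, j) else 0"
  by (rule_tac x = "dim_row mat + dim_col mat" in exI) auto

definition mat_of :: "nat \<Rightarrow> nat \<Rightarrow> 'k::field fmat \<Rightarrow> 'k mat" where
  "mat_of r c A = mat r c (\<lambda>(i, j). ent A i j)"

text \<open>Having r rows and c columns is stated by equations with idempotents, so that shapes are
  tracked by rewriting and not by carrier sets.\<close>

definition fcar :: "nat \<Rightarrow> nat \<Rightarrow> 'k::field fmat \<Rightarrow> bool" where
  "fcar r c A \<longleftrightarrow> idm r * A = A \<and> A * idm c = A"

lemma ent_idm: "ent (idm d) i j = (if i = j \<and> i < d then 1 else 0)"
  by (simp add: idm.rep_eq)

lemma ent_sm [simp]: "ent (sm c A) i j = c * ent A i j"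
  by (simp add: sm.rep_eq)

lemma ent_shift_down: "ent (shift_down d e) i j = (if i = d + j \<and> j < e then 1 else 0)"
  by (simp add: shift_down.rep_eq)

lemma ent_shift_up: "ent (shift_up d e) i j = (if j = d + i \<and> i < e then 1 else 0)"
  by (simp add: shift_up.rep_eq)

lemma ent_fm_of: "ent (fm_of A) i j = (if i < dim_row A \<and> j < dim_col A then A $$ (i, j) else 0)"
  by (simp add: fm_of.rep_eq)

lemma ent_idm_mult [simp]: "ent (idm d * A) i j = (if i < d then ent A i j else 0)"
proof -
  have "ent (idm d * A) i j = (\<Sum>k<d. ent (idm d) i k * ent A k j)"
    by (rule ent_times_bounded) (auto simp: ent_idm)
  also have "\<dots> = (\<Sum>k<d. if k = i then ent A k j else 0)"
    by (rule sum.cong) (auto simp: ent_idm)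
  finally show ?thesis by simp
qed

lemma ent_mult_idm [simp]: "ent (A * idm d) i j = (if j < d then ent A i j else 0)"
proof -
  obtain N where N: "\<And>i j. N \<le> i \<or> N \<le> j \<Longrightarrow> ent A i j = 0"
    using ent_bounded by blast
  have "ent (A * idm d) i j = (\<Sum>k<N. ent A i k * ent (idm d) k j)"
    by (rule ent_times_bounded) (use N in auto)
  also have "\<dots> = (\<Sum>k<N. if k = j then if j < d then ent A i k else 0 else 0)"
    by (rule sum.cong) (auto simp: ent_idm)
  finally show ?thesis using N[of i j] by (auto simp: not_less)
qed

lemma fcar_ent_iff: "fcar r c A \<longleftrightarrow> (\<forall>i j. r \<le> i \<or> c \<le> j \<longrightarrow> ent A i j = 0)"
  unfolding fcar_def fmat_eq_iff by (auto simp: not_less)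

lemma ent_shift_down_mult [simp]:
  "ent (shift_down d e * A) i j = (if d \<le> i \<and> i < d + e then ent A (i - d) j else 0)"
proof -
  have "ent (shift_down d e * A) i j = (\<Sum>k<e. ent (shift_down d e) i k * ent A k j)"
    by (rule ent_times_bounded) (auto simp: ent_shift_down)
  also have "\<dots> = (\<Sum>k<e. if k = i - d then if d \<le> i then ent A k j else 0 else 0)"
    by (rule sum.cong) (auto simp: ent_shift_down)
  finally show ?thesis by auto
qed

lemma ent_mult_shift_up [simp]:
  "ent (A * shift_up d e) i j = (if d \<le> j \<and> j < d + e then ent A i (j - d) else 0)"
proof -
  obtain N where N: "\<And>i j. N \<le> i \<or> N \<le> j \<Longrightarrow> ent A i j = 0"
    using ent_bounded by blast
  have "ent (A * shift_up d e) i j = (\<Sum>k<N. ent A i k * ent (shift_up d e) k j)"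
    by (rule ent_times_bounded) (use N in auto)
  also have "\<dots> = (\<Sum>k<N. if k = j - d then if d \<le> j \<and> j < d + e then ent A i k else 0 else 0)"
    by (rule sum.cong) (auto simp: ent_shift_up)
  finally show ?thesis using N[of i "j - d"] by (auto simp: not_less)
qed

lemma ent_shift_up_mult [simp]:
  "ent (shift_up d e * A) i j = (if i < e then ent A (d + i) j else 0)"
proof -
  have "ent (shift_up d e * A) i j = (\<Sum>k<d + e. ent (shift_up d e) i k * ent A k j)"
    by (rule ent_times_bounded) (auto simp: ent_shift_up)
  also have "\<dots> = (\<Sum>k<d + e. if k = d + i then if i < e then ent A k j else 0 else 0)"
    by (rule sum.cong) (auto simp: ent_shift_up)
  finally show ?thesis by auto
qed

lemma sm_mult_left: "sm c A * B = sm c (A * B)"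
proof (rule fmat_eqI)
  fix i j
  obtain N where N: "\<And>i j. N \<le> i \<or> N \<le> j \<Longrightarrow> ent A i j = 0"
    using ent_bounded by blast
  have "ent (sm c A * B) i j = (\<Sum>k<N. ent (sm c A) i k * ent B k j)"
    by (rule ent_times_bounded) (use N in auto)
  moreover have "ent (A * B) i j = (\<Sum>k<N. ent A i k * ent B k j)"
    by (rule ent_times_bounded) (use N in auto)
  ultimately show "ent (sm c A * B) i j = ent (sm c (A * B)) i j"
    by (simp add: sum_distrib_left mult.assoc)
qed

lemma sm_mult_right: "A * sm c B = sm c (A * B)"
proof (rule fmat_eqI)
  fix i j
  obtain N where N: "\<And>i j. N \<le> i \<or> N \<le> j \<Longrightarrow> ent A i j = 0"
    using ent_bounded by blast
  have "ent (A * X) i j = (\<Sum>k<N. ent A i k * ent X k j)" for X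
    by (rule ent_times_bounded) (use N in auto)
  then show "ent (A * sm c B) i j = ent (sm c (A * B)) i j"
    by (simp add: sum_distrib_left mult_ac)
qed

lemma sm_simps [simp]: "sm 0 A = 0" "sm 1 A = A" "sm c 0 = 0" "sm c (sm d A) = sm (c * d) A"
  by (simp_all add: fmat_eq_iff mult.assoc)

lemma sm_add_left: "sm (c + d) A = sm c A + sm d A"
  by (simp add: fmat_eq_iff distrib_right)

lemma sm_eq_0_iff: "sm c A = 0 \<longleftrightarrow> c = 0 \<or> A = 0"
  by (auto simp: fmat_eq_iff)

lemma idm_0 [simp]: "idm 0 = 0"
  by (simp add: fmat_eq_iff ent_idm)

lemma idm_mult_idm: "idm d * idm e = idm (min d e)"
  by (simp add: fmat_eq_iff ent_idm)

lemma idm_idem [simp]: "idm d * idm d = idm d" "idm d * (idm d * A) = idm d * A"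
  by (simp_all add: idm_mult_idm flip: mult.assoc)

lemma idm_neq_0 [simp]: "idm d = 0 \<longleftrightarrow> d = 0" "0 = idm d \<longleftrightarrow> d = 0"
proof -
  have "ent (idm d) 0 0 = 0 \<Longrightarrow> d = 0" by (simp add: ent_idm split: if_splits)
  then show "idm d = 0 \<longleftrightarrow> d = 0" by (metis ent_zero idm_0)
  then show "0 = idm d \<longleftrightarrow> d = 0" by metis
qed

lemma fcar_idm: "fcar d d (idm d)"
  by (simp add: fcar_def)

lemma fcar_mult: "fcar r m A \<Longrightarrow> fcar m c B \<Longrightarrow> fcar r c (A * B)"
  unfolding fcar_def by (simp add: mult.assoc) (simp flip: mult.assoc)

lemma fcar_0 [simp]: "fcar r c 0"
  by (simp add: fcar_def)

lemma fcar_trivial: "fcar r c A \<Longrightarrow> r = 0 \<or> c = 0 \<Longrightarrow> A = 0"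
  by (auto simp: fcar_def)

lemma fcar_1_eq: "fcar 1 1 A \<Longrightarrow> A = sm (ent A 0 0) (idm 1)"
  by (auto simp: fmat_eq_iff fcar_ent_iff ent_idm) (metis One_nat_def less_one not_le)

lemma fcar_fm_of: "A \<in> carrier_mat r c \<Longrightarrow> fcar r c (fm_of A)"
  by (auto simp: fcar_ent_iff ent_fm_of)

lemma mat_of_carrier [simp]: "mat_of r c A \<in> carrier_mat r c"
  by (simp add: mat_of_def)

lemma dim_mat_of [simp]: "dim_row (mat_of r c A) = r" "dim_col (mat_of r c A) = c"
  by (simp_all add: mat_of_def)

lemma fm_of_mat_of: "fcar r c A \<Longrightarrow> fm_of (mat_of r c A) = A"
  by (auto simp: fmat_eq_iff fcar_ent_iff ent_fm_of mat_of_def not_less)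

lemma mat_of_fm_of: "A \<in> carrier_mat r c \<Longrightarrow> mat_of r c (fm_of A) = A"
  by (auto simp: mat_of_def ent_fm_of)

lemma fm_of_mult: "dim_col A = dim_row B \<Longrightarrow> fm_of (A * B) = fm_of A * fm_of B"
proof (rule fmat_eqI)
  fix i j assume AB: "dim_col A = dim_row B"
  have "ent (fm_of A * fm_of B) i j = (\<Sum>k<dim_col A. ent (fm_of A) i k * ent (fm_of B) k j)"
    by (rule ent_times_bounded) (simp add: ent_fm_of)
  then show "ent (fm_of (A * B)) i j = ent (fm_of A * fm_of B) i j"
    using AB by (auto simp: ent_fm_of scalar_prod_def lessThan_atLeast0)
qed

lemma fm_of_one [simp]: "fm_of (1\<^sub>m d) = idm d"
  by (auto simp: fmat_eq_iff ent_fm_of ent_idm)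

lemma fm_of_smult [simp]: "fm_of (c \<cdot>\<^sub>m A) = sm c (fm_of A)"
  by (auto simp: fmat_eq_iff ent_fm_of)

lemma fm_of_inject: "A \<in> carrier_mat r c \<Longrightarrow> B \<in> carrier_mat r c \<Longrightarrow> fm_of A = fm_of B \<longleftrightarrow> A = B"
  by (metis mat_of_fm_of)

lemma fm_of_dsum_mat:
  assumes "A \<in> carrier_mat r c" "B \<in> carrier_mat r' c'"
  shows "fm_of (dsum_mat A B) = fm_of A + shift_down r r' * fm_of B * shift_up c c'"
  using assms unfolding dsum_mat_def by (auto simp: fmat_eq_iff ent_fm_of)

lemma shift_simps:
  "shift_up d e * shift_down d e = idm e"
  "idm d * shift_down d e = 0"
  "shift_up d e * idm d = 0"
  "idm d + shift_down d e * shift_up d e = idm (d + e)"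
  "fcar (d + e) e (shift_down d e)" "fcar e (d + e) (shift_up d e)"
  by (auto simp: fmat_eq_iff fcar_ent_iff ent_shift_down ent_shift_up ent_idm)

lemma fcar_idm_add: "fcar (d + e) d (idm d)" "fcar d (d + e) (idm d)"
  by (simp_all add: fcar_def idm_mult_idm)

text \<open>If d were smaller than e, both matrices could be padded to size e. A left inverse of a
  square matrix is also a right inverse, so \<open>x * y = idm e\<close>; but the rows of
  \<open>x * y\<close> from d on are zero.\<close>

lemma left_inverse_dim_le:
  fixes x y :: "'k::field fmat"
  assumes "fcar d e x" "fcar e d y" "y * x = idm e"
  shows "e \<le> d"
proof (rule ccontr)
  assume "\<not> e \<le> d"
  then have xy: "fcar e e x" "fcar e e y"
    using assms by (auto simp: fcar_ent_iff)
  let ?X = "mat_of e e x" and ?Y = "mat_of e e y"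
  have "fm_of (?Y * ?X) = fm_of (1\<^sub>m e)"
    using xy assms(3) by (simp add: fm_of_mult fm_of_mat_of)
  then have "?Y * ?X = 1\<^sub>m e"
    using fm_of_inject[of "?Y * ?X" e e "1\<^sub>m e"] mult_carrier_mat[OF mat_of_carrier mat_of_carrier, of e e y e x]
    by simp
  then have "?X * ?Y = 1\<^sub>m e"
    by (rule mat_mult_left_right_inverse[OF mat_of_carrier mat_of_carrier])
  moreover have "fm_of (?X * ?Y) = x * y"
    using xy by (simp add: fm_of_mult fm_of_mat_of)
  ultimately have "x * y = idm e" by simp
  moreover have "idm d * (x * y) = x * y"
    using assms(1) by (simp add: fcar_def flip: mult.assoc)
  ultimately have "ent (idm d * idm e) d d = ent (idm e :: 'k fmat) d d" by simp
  with \<open>\<not> e \<le> d\<close> show False by (simp add: ent_idm)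
qed

section \<open>Representations in the ring of matrix families\<close>

text \<open>The values of a \<open>matfam\<close> outside the vertices carry no meaning. Setting
  them to zero makes agreement on the vertices the same as equality of functions, whose sum and
  product are taken pointwise.\<close>

definition fam :: "('v, 'a) pre_digraph \<Rightarrow> ('v, 'k::field) matfam \<Rightarrow> 'v \<Rightarrow> 'k fmat" where
  "fam Q f = (\<lambda>v. if v \<in> verts Q then fm_of (f v) else 0)"

definition unfam ::
    "('v, 'a, 'k::field) qrep \<Rightarrow> ('v, 'a, 'k) qrep \<Rightarrow> ('v \<Rightarrow> 'k fmat) \<Rightarrow> ('v, 'k) matfam" where
  "unfam V W F = (\<lambda>v. mat_of (vdim W v) (vdim V v) (F v))"

definition idf :: "('v, 'a) pre_digraph \<Rightarrow> ('v, 'a, 'k::field) qrep \<Rightarrow> 'v \<Rightarrow> 'k fmat" where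
  "idf Q V = (\<lambda>v. if v \<in> verts Q then idm (vdim V v) else 0)"

definition mm :: "('v, 'a, 'k::field) qrep \<Rightarrow> 'a \<Rightarrow> 'k fmat" where
  "mm V a = fm_of (amap V a)"

text \<open>The families of linear maps from V to W, with no condition on the arrows. They are
  needed beside the morphisms, because the vertexwise splittings of an exact sequence are in general
  not morphisms.\<close>

definition fsup ::
    "('v, 'a) pre_digraph \<Rightarrow> ('v, 'a, 'k::field) qrep \<Rightarrow> ('v, 'a, 'k) qrep \<Rightarrow> ('v \<Rightarrow> 'k fmat) \<Rightarrow> bool"
  where "fsup Q V W F \<longleftrightarrow> idf Q W * F = F \<and> F * idf Q V = F"

definition fhom ::
    "('v, 'a) pre_digraph \<Rightarrow> ('v, 'a, 'k::field) qrep \<Rightarrow> ('v, 'a, 'k) qrep \<Rightarrow> ('v \<Rightarrow> 'k fmat) \<Rightarrow> bool"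
  where "fhom Q V W F \<longleftrightarrow> fsup Q V W F \<and>
    (\<forall>a\<in>arcs Q. F (head Q a) * mm V a = mm W a * F (tail Q a))"

lemma fsup_iff:
  "fsup Q V W F \<longleftrightarrow> (\<forall>v. if v \<in> verts Q then fcar (vdim W v) (vdim V v) (F v) else F v = 0)"
  by (auto simp: fsup_def fun_eq_iff idf_def fcar_def split: if_splits)

lemma fsup_left: "fsup Q V W F \<Longrightarrow> idf Q W * F = F"
  and fsup_right: "fsup Q V W F \<Longrightarrow> F * idf Q V = F"
  by (simp_all add: fsup_def)

lemma fsup_mult: "fsup Q V W F \<Longrightarrow> fsup Q U V G \<Longrightarrow> fsup Q U W (F * G)"
  unfolding fsup_def by (simp add: mult.assoc) (simp flip: mult.assoc)

lemma fsup_add: "fsup Q V W F \<Longrightarrow> fsup Q V W G \<Longrightarrow> fsup Q V W (F + G)"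
  by (simp add: fsup_def distrib_left distrib_right)

lemma fsup_diff: "fsup Q V W F \<Longrightarrow> fsup Q V W G \<Longrightarrow> fsup Q V W (F - G)"
  by (simp add: fsup_def left_diff_distrib right_diff_distrib)

lemma fsup_0: "fsup Q V W 0"
  by (simp add: fsup_def)

lemma idf_idem [simp]: "idf Q V * idf Q V = idf Q V"
  by (auto simp: idf_def fun_eq_iff)

lemma fsup_idf: "fsup Q V V (idf Q V)"
  by (simp add: fsup_def)

lemma fhom_fsup: "fhom Q V W F \<Longrightarrow> fsup Q V W F"
  by (simp add: fhom_def)

lemmas fhom_left = fsup_left[OF fhom_fsup]
lemmas fhom_right = fsup_right[OF fhom_fsup]

lemma fhom_mult: "fhom Q V W F \<Longrightarrow> fhom Q U V G \<Longrightarrow> fhom Q U W (F * G)"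
proof -
  assume F: "fhom Q V W F" and G: "fhom Q U V G"
  have "F (head Q a) * (mm V a * X) = mm W a * (F (tail Q a) * X)" if "a \<in> arcs Q" for a X
    using F that by (simp add: fhom_def flip: mult.assoc)
  with F G show ?thesis
    unfolding fhom_def using fsup_mult[of Q V W F U G] by (simp add: mult.assoc)
qed

lemma fhom_add: "fhom Q V W F \<Longrightarrow> fhom Q V W G \<Longrightarrow> fhom Q V W (F + G)"
  by (simp add: fhom_def fsup_add distrib_left distrib_right)

lemma fhom_diff: "fhom Q V W F \<Longrightarrow> fhom Q V W G \<Longrightarrow> fhom Q V W (F - G)"
  by (simp add: fhom_def fsup_diff left_diff_distrib right_diff_distrib)

lemma fhom_0: "fhom Q V W 0"
  by (simp add: fhom_def fsup_0)

lemma fhom_sum: "(\<And>i. i \<in> I \<Longrightarrow> fhom Q V W (F i)) \<Longrightarrow> fhom Q V W (\<Sum>i\<in>I. F i)"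
  by (induction I rule: infinite_finite_induct) (auto intro: fhom_0 fhom_add)

lemma fcar_mm: "is_rep Q V \<Longrightarrow> a \<in> arcs Q \<Longrightarrow> fcar (vdim V (head Q a)) (vdim V (tail Q a)) (mm V a)"
  by (simp add: is_rep_def mm_def fcar_fm_of)

lemma idf_mm:
  assumes "wf_digraph Q" "is_rep Q V" "a \<in> arcs Q"
  shows "idf Q V (head Q a) * mm V a = mm V a" "mm V a * idf Q V (tail Q a) = mm V a"
  using assms fcar_mm[of Q V a] by (auto simp: idf_def wf_digraph_def fcar_def)

lemma fhom_idf: "wf_digraph Q \<Longrightarrow> is_rep Q V \<Longrightarrow> fhom Q V V (idf Q V)"
  by (simp add: fhom_def fsup_idf idf_mm)

subsection \<open>Translation of the matrix notions\<close>

lemma fam_mult: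
  "(\<And>v. v \<in> verts Q \<Longrightarrow> dim_col (g v) = dim_row (f v)) \<Longrightarrow> fam Q (\<lambda>v. g v * f v) = fam Q g * fam Q f"
  by (auto simp: fam_def fun_eq_iff fm_of_mult)

lemma fam_eq_iff:
  "(\<And>v. v \<in> verts Q \<Longrightarrow> f v \<in> carrier_mat (r v) (c v) \<and> g v \<in> carrier_mat (r v) (c v)) \<Longrightarrow>
    fam Q f = fam Q g \<longleftrightarrow> (\<forall>v\<in>verts Q. f v = g v)"
  unfolding fam_def fun_eq_iff by (metis fm_of_inject)

lemma fam_id_fam [simp]: "fam Q (id_fam V) = idf Q V"
  by (auto simp: fam_def id_fam_def idf_def)

lemma fam_unfam: "fsup Q V W F \<Longrightarrow> fam Q (unfam V W F) = F"
  by (auto simp: fsup_iff fam_def unfam_def fun_eq_iff fm_of_mat_of split: if_splits)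

lemma unfam_carrier: "unfam V W F v \<in> carrier_mat (vdim W v) (vdim V v)"
  by (simp add: unfam_def)

lemma fsup_fam:
  "(\<And>v. v \<in> verts Q \<Longrightarrow> f v \<in> carrier_mat (vdim W v) (vdim V v)) \<Longrightarrow> fsup Q V W (fam Q f)"
  by (simp add: fsup_iff fam_def fcar_fm_of)

lemma rep_homD: "rep_hom Q V W f \<Longrightarrow> v \<in> verts Q \<Longrightarrow> f v \<in> carrier_mat (vdim W v) (vdim V v)"
  by (simp add: rep_hom_def)

lemma rep_hom_iff:
  assumes Q: "wf_digraph Q" and V: "is_rep Q V" and W: "is_rep Q W"
    and f: "\<And>v. v \<in> verts Q \<Longrightarrow> f v \<in> carrier_mat (vdim W v) (vdim V v)"
  shows "rep_hom Q V W f \<longleftrightarrow> fhom Q V W (fam Q f)"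
proof -
  have "f (head Q a) * amap V a = amap W a * f (tail Q a) \<longleftrightarrow>
      fam Q f (head Q a) * mm V a = mm W a * fam Q f (tail Q a)" if a: "a \<in> arcs Q" for a
  proof -
    have t: "tail Q a \<in> verts Q" and h: "head Q a \<in> verts Q"
      using Q a by (auto simp: wf_digraph_def)
    have Va: "amap V a \<in> carrier_mat (vdim V (head Q a)) (vdim V (tail Q a))"
      and Wa: "amap W a \<in> carrier_mat (vdim W (head Q a)) (vdim W (tail Q a))"
      using V W a by (auto simp: is_rep_def)
    have "fam Q f (head Q a) * mm V a = fm_of (f (head Q a) * amap V a)"
      "mm W a * fam Q f (tail Q a) = fm_of (amap W a * f (tail Q a))"
      using f[OF t] f[OF h] Va Wa t h by (auto simp: fam_def mm_def fm_of_mult)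
    moreover have "f (head Q a) * amap V a \<in> carrier_mat (vdim W (head Q a)) (vdim V (tail Q a))"
      "amap W a * f (tail Q a) \<in> carrier_mat (vdim W (head Q a)) (vdim V (tail Q a))"
      using f[OF t] f[OF h] Va Wa by auto
    ultimately show ?thesis by (metis fm_of_inject)
  qed
  then show ?thesis
    using f fsup_fam[of Q f W V] by (auto simp: rep_hom_def fhom_def)
qed

lemma fhom_fam:
  "wf_digraph Q \<Longrightarrow> is_rep Q V \<Longrightarrow> is_rep Q W \<Longrightarrow> rep_hom Q V W f \<Longrightarrow> fhom Q V W (fam Q f)"
  by (metis rep_homD rep_hom_iff)

lemma rep_hom_unfam:
  "wf_digraph Q \<Longrightarrow> is_rep Q V \<Longrightarrow> is_rep Q W \<Longrightarrow> fhom Q V W F \<Longrightarrow> rep_hom Q V W (unfam V W F)"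
  by (metis rep_hom_iff unfam_carrier fam_unfam fhom_fsup)

lemma fam_prod_eq_iff:
  assumes "\<And>v. v \<in> verts Q \<Longrightarrow> g v \<in> carrier_mat (r v) (m v) \<and> f v \<in> carrier_mat (m v) (c v)
      \<and> h v \<in> carrier_mat (r v) (c v)"
  shows "fam Q g * fam Q f = fam Q h \<longleftrightarrow> (\<forall>v\<in>verts Q. g v * f v = h v)"
proof -
  have "fam Q g * fam Q f = fam Q (\<lambda>v. g v * f v)"
    by (rule fam_mult[symmetric]) (metis assms carrier_matD)
  moreover have "fam Q (\<lambda>v. g v * f v) = fam Q h \<longleftrightarrow> (\<forall>v\<in>verts Q. g v * f v = h v)"
    by (rule fam_eq_iff[where r = r and c = c]) (meson assms mult_carrier_mat)
  ultimately show ?thesis by simp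
qed

lemma fam_prod_eq_prod_iff:
  assumes "\<And>v. v \<in> verts Q \<Longrightarrow> g v \<in> carrier_mat (r v) (m v) \<and> f v \<in> carrier_mat (m v) (c v)
      \<and> g' v \<in> carrier_mat (r v) (m' v) \<and> f' v \<in> carrier_mat (m' v) (c v)"
  shows "fam Q g * fam Q f = fam Q g' * fam Q f' \<longleftrightarrow> (\<forall>v\<in>verts Q. g v * f v = g' v * f' v)"
proof -
  have "fam Q g' * fam Q f' = fam Q (\<lambda>v. g' v * f' v)"
    by (rule fam_mult[symmetric]) (metis assms carrier_matD)
  moreover have "fam Q g * fam Q f = fam Q (\<lambda>v. g' v * f' v) \<longleftrightarrow> (\<forall>v\<in>verts Q. g v * f v = g' v * f' v)"
    by (rule fam_prod_eq_iff[where r = r and m = m and c = c]) (meson assms mult_carrier_mat)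
  ultimately show ?thesis by simp
qed

definition fiso :: "('v, 'a) pre_digraph \<Rightarrow> ('v, 'a, 'k::field) qrep \<Rightarrow> ('v, 'a, 'k) qrep \<Rightarrow> bool" where
  "fiso Q V W \<longleftrightarrow> (\<exists>F G. fhom Q V W F \<and> fhom Q W V G \<and> G * F = idf Q V \<and> F * G = idf Q W)"

lemma id_fam_carrier: "id_fam V v \<in> carrier_mat (vdim V v) (vdim V v)"
  by (simp add: id_fam_def)

lemma rep_iso_iff:
  assumes Q: "wf_digraph Q" and V: "is_rep Q V" and W: "is_rep Q W"
  shows "rep_iso Q V W \<longleftrightarrow> fiso Q V W"
proof
  assume "rep_iso Q V W"
  then obtain f g where f: "rep_hom Q V W f" and g: "rep_hom Q W V g"
    and fg: "\<forall>v\<in>verts Q. g v * f v = id_fam V v \<and> f v * g v = id_fam W v"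
    by (auto simp: rep_iso_def)
  have "fam Q g * fam Q f = fam Q (id_fam V)"
    using f g fg id_fam_carrier
    by (subst fam_prod_eq_iff[where r = "vdim V" and m = "vdim W" and c = "vdim V"]) (auto dest: rep_homD)
  moreover have "fam Q f * fam Q g = fam Q (id_fam W)"
    using f g fg id_fam_carrier
    by (subst fam_prod_eq_iff[where r = "vdim W" and m = "vdim V" and c = "vdim W"]) (auto dest: rep_homD)
  ultimately show "fiso Q V W"
    using fhom_fam[OF Q V W f] fhom_fam[OF Q W V g] by (auto simp: fiso_def)
next
  assume "fiso Q V W"
  then obtain F G where F: "fhom Q V W F" and G: "fhom Q W V G"
    and FG: "G * F = idf Q V" "F * G = idf Q W"
    by (auto simp: fiso_def)
  let ?f = "unfam V W F" and ?g = "unfam W V G"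
  have [simp]: "fam Q ?f = F" "fam Q ?g = G"
    using F G by (auto intro: fam_unfam fhom_fsup)
  have "\<forall>v\<in>verts Q. ?g v * ?f v = id_fam V v"
    by (subst fam_prod_eq_iff[symmetric, where r = "vdim V" and m = "vdim W" and c = "vdim V"])
      (use FG in \<open>auto intro: unfam_carrier id_fam_carrier\<close>)
  moreover have "\<forall>v\<in>verts Q. ?f v * ?g v = id_fam W v"
    by (subst fam_prod_eq_iff[symmetric, where r = "vdim W" and m = "vdim V" and c = "vdim W"])
      (use FG in \<open>auto intro: unfam_carrier id_fam_carrier\<close>)
  ultimately show "rep_iso Q V W"
    using rep_hom_unfam[OF Q V W F] rep_hom_unfam[OF Q W V G] by (auto simp: rep_iso_def)
qed

lemma fiso_refl: "wf_digraph Q \<Longrightarrow> is_rep Q V \<Longrightarrow> fiso Q V V"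
  unfolding fiso_def by (metis fhom_idf idf_idem)

lemma fiso_sym: "fiso Q V W \<Longrightarrow> fiso Q W V"
  unfolding fiso_def by blast

lemma fiso_trans:
  assumes "fiso Q U V" "fiso Q V W" shows "fiso Q U W"
proof -
  obtain F G F' G' where F: "fhom Q U V F" "fhom Q V U G" "G * F = idf Q U" "F * G = idf Q V"
    and F': "fhom Q V W F'" "fhom Q W V G'" "G' * F' = idf Q V" "F' * G' = idf Q W"
    using assms unfolding fiso_def by blast
  have "G * G' * (F' * F) = G * (G' * F') * F" "F' * F * (G * G') = F' * (F * G) * G'"
    by (simp_all add: mult.assoc)
  then have "G * G' * (F' * F) = idf Q U" "F' * F * (G * G') = idf Q W"
    using F F' by (simp_all add: fhom_right)
  then show ?thesis
    unfolding fiso_def using F F' fhom_mult by blast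
qed

text \<open>Exactness in the form of a contracting homotopy: R retracts F and S is a section of G at
  each vertex, but only F and G commute with the arrows. Over a field every exact sequence admits
  such R and S.\<close>

definition fexact ::
    "('v, 'a) pre_digraph \<Rightarrow> ('v, 'a, 'k::field) qrep \<Rightarrow> ('v, 'a, 'k) qrep \<Rightarrow> ('v, 'a, 'k) qrep \<Rightarrow>
     ('v \<Rightarrow> 'k fmat) \<Rightarrow> ('v \<Rightarrow> 'k fmat) \<Rightarrow> ('v \<Rightarrow> 'k fmat) \<Rightarrow> ('v \<Rightarrow> 'k fmat) \<Rightarrow> bool" where
  "fexact Q B E A F G R S \<longleftrightarrow> fhom Q B E F \<and> fhom Q E A G \<and> fsup Q E B R \<and> fsup Q A E S \<and>
     R * F = idf Q B \<and> G * S = idf Q A \<and> F * R + S * G = idf Q E"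

text \<open>Multiplying \<open>F * R + S * G = idf Q E\<close> by G on the left and by F on the
  right gives \<open>G * F = G * F + G * F\<close>; in the same way for R and S.\<close>

lemma fexact_zero:
  assumes "fexact Q B E A F G R S" shows "G * F = 0" "R * S = 0"
proof -
  have "G * F = G * (F * R + S * G) * F" "R * S = R * (F * R + S * G) * S"
    using assms by (auto simp: fexact_def fhom_right fsup_right)
  moreover have "G * (F * R + S * G) * F = G * F * (R * F) + (G * S) * (G * F)"
    "R * (F * R + S * G) * S = (R * F) * (R * S) + R * S * (G * S)"
    by (simp_all add: algebra_simps)
  moreover have "G * F * (R * F) = G * F" "(G * S) * (G * F) = G * F"
    "(R * F) * (R * S) = R * S" "R * S * (G * S) = R * S"
    using assms by (auto simp: fexact_def mult.assoc fhom_right fsup_right)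
      (auto simp: fhom_left fsup_left simp flip: mult.assoc)
  ultimately show "G * F = 0" "R * S = 0" by simp_all
qed

lemma mat_equation_solvable:
  fixes f :: "'k::field mat"
  assumes f: "f \<in> carrier_mat e b" and C: "C \<in> carrier_mat e c"
    and *: "\<And>j. j < c \<Longrightarrow> \<exists>x\<in>carrier_vec b. f *\<^sub>v x = col C j"
  shows "\<exists>X\<in>carrier_mat b c. f * X = C"
proof -
  obtain x where x: "\<And>j. j < c \<Longrightarrow> x j \<in> carrier_vec b" "\<And>j. j < c \<Longrightarrow> f *\<^sub>v x j = col C j"
    using * by metis
  define X where "X = mat_of_cols b (map x [0..<c])"
  have X: "X \<in> carrier_mat b c"
    unfolding X_def by (rule carrier_matI) simp_all
  have "col X j = x j" if "j < c" for j
    using that x(1)[OF that] unfolding X_def by simp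
  then have "col (f * X) j = col C j" if "j < c" for j
    using that x(2)[OF that] col_mult2[OF f X that] by simp
  then have "f * X = C"
    using f C X by (intro mat_col_eqI) (simp_all del: col_mult2)
  with X show ?thesis by blast
qed

lemma pointwise_splitting:
  fixes f g :: "'k::field mat"
  assumes f: "f \<in> carrier_mat e b" and g: "g \<in> carrier_mat a e"
    and inj: "inj_on (\<lambda>x. f *\<^sub>v x) (carrier_vec b)"
    and ker: "(\<lambda>x. f *\<^sub>v x) ` carrier_vec b = mat_kernel g"
    and surj: "(\<lambda>x. g *\<^sub>v x) ` carrier_vec e = carrier_vec a"
  shows "\<exists>r\<in>carrier_mat b e. \<exists>s\<in>carrier_mat e a. r * f = 1\<^sub>m b \<and> g * s = 1\<^sub>m a \<and> f * r + s * g = 1\<^sub>m e"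
proof -
  have "\<exists>s\<in>carrier_mat e a. g * s = 1\<^sub>m a"
    by (rule mat_equation_solvable[OF g]) (auto, metis (no_types) surj imageE unit_vec_carrier)
  then obtain s where s: "s \<in> carrier_mat e a" and gs: "g * s = 1\<^sub>m a" by blast
  have sg: "s * g \<in> carrier_mat e e" using s g by simp
  \<comment> \<open>\<open>s * g\<close> is a projection along the kernel of g, so the columns of D
    lie in that kernel, which is the image of f. This yields r with \<open>f * r = D\<close>; since
    \<open>D * f = f\<close>, cancelling the injective f gives \<open>r * f = 1\<close>.\<close>
  define D where "D = 1\<^sub>m e - s * g"
  have D: "D \<in> carrier_mat e e" unfolding D_def using sg by (rule minus_carrier_mat)
  have "g * D = g * 1\<^sub>m e - g * (s * g)"
    unfolding D_def by (rule mult_minus_distrib_mat[OF g]) (use sg in auto)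
  also have "g * (s * g) = g * s * g"
    using g s by (metis assoc_mult_mat)
  finally have gD: "g * D = 0\<^sub>m a e"
    using right_mult_one_mat[OF g] left_mult_one_mat[OF g] minus_r_inv_mat[OF g] by (simp only: gs)
  have "\<exists>r\<in>carrier_mat b e. f * r = D"
  proof (rule mat_equation_solvable[OF f D])
    fix j assume j: "j < e"
    have "g *\<^sub>v col D j = 0\<^sub>v a"
      using col_mult2[OF g D j] gD col_zero[OF j] by metis
    then have "col D j \<in> mat_kernel g"
      using col_carrier_vec[OF j D] by (intro mat_kernelI[OF g])
    then show "\<exists>x\<in>carrier_vec b. f *\<^sub>v x = col D j"
      unfolding ker[symmetric] by (metis imageE)
  qed
  then obtain r where r: "r \<in> carrier_mat b e" and fr: "f * r = D" by blast
  have colf: "col f j = f *\<^sub>v unit_vec b j" if "j < b" for j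
    using col_mult2[OF f one_carrier_mat that] right_mult_one_mat[OF f] col_one[OF that] by metis
  have gf0: "g * f = 0\<^sub>m a b"
  proof (rule mat_col_eqI)
    fix j assume "j < dim_col (0\<^sub>m a b :: 'k mat)"
    then have j: "j < b" by simp
    have "col f j \<in> mat_kernel g"
      unfolding colf[OF j] using ker unit_vec_carrier by blast
    then have "g *\<^sub>v col f j = 0\<^sub>v a" using mat_kernelD[OF g] by blast
    then show "col (g * f) j = col (0\<^sub>m a b) j"
      using col_mult2[OF g f j] col_zero[OF j] by metis
  qed (use f g in auto)
  have rf: "r * f \<in> carrier_mat b b" using f r by simp
  have "f * (r * f) = D * f"
    using f r fr by (metis assoc_mult_mat)
  also have "\<dots> = 1\<^sub>m e * f - s * g * f"
    unfolding D_def by (rule minus_mult_distrib_mat) (use sg f in auto)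
  also have "s * g * f = 0\<^sub>m e b"
    using assoc_mult_mat[OF s g f] gf0 right_mult_zero_mat[OF s] by metis
  finally have frf: "f * (r * f) = f - 0\<^sub>m e b"
    using left_mult_one_mat[OF f] by metis
  also have "\<dots> = f * 1\<^sub>m b"
    using f by (intro eq_matI) simp_all
  finally have frf: "f * (r * f) = f * 1\<^sub>m b" .
  have "r * f = 1\<^sub>m b"
  proof (rule mat_col_eqI)
    fix j assume "j < dim_col (1\<^sub>m b :: 'k mat)"
    then have j: "j < b" by simp
    have "f *\<^sub>v col (r * f) j = f *\<^sub>v col (1\<^sub>m b) j"
      using frf col_mult2[OF f rf j] col_mult2[OF f one_carrier_mat j] by metis
    then show "col (r * f) j = col (1\<^sub>m b) j"
      by (rule inj_onD[OF inj]) (use j rf col_carrier_vec one_carrier_mat in blast)+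
  qed (use f r in auto)
  moreover have "1\<^sub>m e - X + X = 1\<^sub>m e" if "X \<in> carrier_mat e e" for X :: "'k mat"
    using that by (intro eq_matI) auto
  then have "f * r + s * g = 1\<^sub>m e"
    unfolding fr D_def using sg by blast
  ultimately show ?thesis using r s gs by blast
qed

lemma splitting_pointwise:
  fixes f g :: "'k::field mat"
  assumes f: "f \<in> carrier_mat e b" and g: "g \<in> carrier_mat a e"
    and r: "r \<in> carrier_mat b e" and s: "s \<in> carrier_mat e a"
    and rf: "r * f = 1\<^sub>m b" and gs: "g * s = 1\<^sub>m a" and frsg: "f * r + s * g = 1\<^sub>m e" and gf: "g * f = 0\<^sub>m a b"
  shows "inj_on (\<lambda>x. f *\<^sub>v x) (carrier_vec b)"
    and "(\<lambda>x. f *\<^sub>v x) ` carrier_vec b = mat_kernel g"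
    and "(\<lambda>x. g *\<^sub>v x) ` carrier_vec e = carrier_vec a"
proof -
  have 1: "r *\<^sub>v (f *\<^sub>v x) = x" if "x \<in> carrier_vec b" for x
    using that f r rf by (metis assoc_mult_mat_vec one_mult_mat_vec)
  show "inj_on (\<lambda>x. f *\<^sub>v x) (carrier_vec b)"
    by (rule inj_on_inverseI[of _ "\<lambda>x. r *\<^sub>v x"]) (simp add: 1)
  have 2: "g *\<^sub>v (s *\<^sub>v x) = x" if "x \<in> carrier_vec a" for x
    using that g s gs by (metis assoc_mult_mat_vec one_mult_mat_vec)
  have "x \<in> (\<lambda>x. g *\<^sub>v x) ` carrier_vec e" if "x \<in> carrier_vec a" for x
    using 2[OF that, symmetric] mult_mat_vec_carrier[OF s that] by (rule image_eqI)
  then show "(\<lambda>x. g *\<^sub>v x) ` carrier_vec e = carrier_vec a"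
    using mult_mat_vec_carrier[OF g] by blast
  have "f *\<^sub>v x \<in> mat_kernel g" if "x \<in> carrier_vec b" for x
  proof (rule mat_kernelI[OF g])
    have "g *\<^sub>v (f *\<^sub>v x) = (g * f) *\<^sub>v x"
      using assoc_mult_mat_vec[OF g f that] by (rule sym)
    then show "g *\<^sub>v (f *\<^sub>v x) = 0\<^sub>v a"
      using that unfolding gf by (simp, intro eq_vecI) auto
  qed (use f that in auto)
  moreover have "x \<in> (\<lambda>x. f *\<^sub>v x) ` carrier_vec b" if "x \<in> mat_kernel g" for x
  proof
    have x: "x \<in> carrier_vec e" and gx: "g *\<^sub>v x = 0\<^sub>v a"
      using mat_kernelD[OF g that] by auto
    have "x = (f * r + s * g) *\<^sub>v x" using x frsg by simp
    also have "\<dots> = (f * r) *\<^sub>v x + (s * g) *\<^sub>v x"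
      by (rule add_mult_distrib_mat_vec) (use f r s g x in auto)
    also have "\<dots> = f *\<^sub>v (r *\<^sub>v x) + s *\<^sub>v (g *\<^sub>v x)"
      by (simp only: assoc_mult_mat_vec[OF f r x] assoc_mult_mat_vec[OF s g x])
    also have "s *\<^sub>v (g *\<^sub>v x) = 0\<^sub>v e" using gx s by auto
    finally show "x = f *\<^sub>v (r *\<^sub>v x)" using f r x by simp
    show "r *\<^sub>v x \<in> carrier_vec b" using r x by simp
  qed
  ultimately show "(\<lambda>x. f *\<^sub>v x) ` carrier_vec b = mat_kernel g" by blast
qed

lemma short_exactD:
  assumes Q: "wf_digraph Q" and reps: "is_rep Q B" "is_rep Q E" "is_rep Q A"
    and se: "short_exact Q B E A f g"
  shows "\<exists>R S. fexact Q B E A (fam Q f) (fam Q g) R S"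
proof -
  have f: "rep_hom Q B E f" and g: "rep_hom Q E A g"
    using se by (auto simp: short_exact_def)
  have "\<forall>v\<in>verts Q. \<exists>r s. r \<in> carrier_mat (vdim B v) (vdim E v) \<and> s \<in> carrier_mat (vdim E v) (vdim A v) \<and>
     r * f v = 1\<^sub>m (vdim B v) \<and> g v * s = 1\<^sub>m (vdim A v) \<and> f v * r + s * g v = 1\<^sub>m (vdim E v)"
    using pointwise_splitting[OF rep_homD[OF f] rep_homD[OF g]] se
    unfolding short_exact_def by meson
  then obtain r s where r: "\<And>v. v \<in> verts Q \<Longrightarrow> r v \<in> carrier_mat (vdim B v) (vdim E v)"
    and s: "\<And>v. v \<in> verts Q \<Longrightarrow> s v \<in> carrier_mat (vdim E v) (vdim A v)"
    and eqs: "\<And>v. v \<in> verts Q \<Longrightarrow> r v * f v = 1\<^sub>m (vdim B v)" "\<And>v. v \<in> verts Q \<Longrightarrow> g v * s v = 1\<^sub>m (vdim A v)"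
      "\<And>v. v \<in> verts Q \<Longrightarrow> f v * r v + s v * g v = 1\<^sub>m (vdim E v)"
    by metis
  note d = rep_homD[OF f] rep_homD[OF g] r s
  have "fm_of (r v) * fm_of (f v) = idm (vdim B v)" "fm_of (g v) * fm_of (s v) = idm (vdim A v)"
    if v: "v \<in> verts Q" for v
    using d[OF v] eqs(1,2)[OF v] by (metis carrier_matD fm_of_mult fm_of_one)+
  then have "fam Q r * fam Q f = idf Q B" "fam Q g * fam Q s = idf Q A"
    by (auto simp: fam_def fun_eq_iff idf_def)
  moreover have "fam Q f * fam Q r + fam Q s * fam Q g = idf Q E"
  proof
    fix v
    have "fm_of (f v) * fm_of (r v) + fm_of (s v) * fm_of (g v) = idm (vdim E v)" if v: "v \<in> verts Q"
    proof -
      have "fm_of (f v * r v + s v * g v) = fm_of (f v * r v) + fm_of (s v * g v)"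
        using d[OF v] by (auto simp: fmat_eq_iff ent_fm_of)
      then show ?thesis
        using d[OF v] eqs(3)[OF v] by (simp add: fm_of_mult)
    qed
    then show "(fam Q f * fam Q r + fam Q s * fam Q g) v = idf Q E v"
      by (simp add: fam_def idf_def)
  qed
  ultimately have "fexact Q B E A (fam Q f) (fam Q g) (fam Q r) (fam Q s)"
    unfolding fexact_def using fhom_fam Q reps f g r s fsup_fam by metis
  then show ?thesis by blast
qed

lemma short_exact_unfam:
  assumes Q: "wf_digraph Q" and reps: "is_rep Q B" "is_rep Q E" "is_rep Q A"
    and ex: "fexact Q B E A F G R S"
  shows "short_exact Q B E A (unfam B E F) (unfam E A G)"
proof -
  have sup: "fsup Q B E F" "fsup Q E A G" "fsup Q E B R" "fsup Q A E S"
    using ex by (auto simp: fexact_def fhom_fsup)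
  have "inj_on (\<lambda>x. unfam B E F v *\<^sub>v x) (carrier_vec (vdim B v)) \<and>
        (\<lambda>x. unfam B E F v *\<^sub>v x) ` carrier_vec (vdim B v) = mat_kernel (unfam E A G v) \<and>
        (\<lambda>x. unfam E A G v *\<^sub>v x) ` carrier_vec (vdim E v) = carrier_vec (vdim A v)" if v: "v \<in> verts Q" for v
  proof -
    let ?f = "unfam B E F v" and ?g = "unfam E A G v" and ?r = "unfam E B R v" and ?s = "unfam A E S v"
    have c: "fm_of ?f = F v" "fm_of ?g = G v" "fm_of ?r = R v" "fm_of ?s = S v"
      using fam_unfam[OF sup(1)] fam_unfam[OF sup(2)] fam_unfam[OF sup(3)] fam_unfam[OF sup(4)] v
      by (auto simp: fam_def fun_eq_iff split: if_splits)
    have *: "A1 = A2" if "A1 \<in> carrier_mat n m" "A2 \<in> carrier_mat n m" "fm_of A1 = fm_of A2" for A1 A2 :: "'c mat" and n m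
      using that fm_of_inject by blast
    have dims: "?f \<in> carrier_mat (vdim E v) (vdim B v)" "?g \<in> carrier_mat (vdim A v) (vdim E v)"
      "?r \<in> carrier_mat (vdim B v) (vdim E v)" "?s \<in> carrier_mat (vdim E v) (vdim A v)"
      by (rule unfam_carrier)+
    have "(R * F) v = idf Q B v" "(G * S) v = idf Q A v" "(F * R + S * G) v = idf Q E v" "(G * F) v = 0"
      using ex fexact_zero[OF ex] by (simp_all add: fexact_def del: times_fun_apply plus_fun_apply)
    then have eqs: "R v * F v = idm (vdim B v)" "G v * S v = idm (vdim A v)"
      "F v * R v + S v * G v = idm (vdim E v)" "G v * F v = 0"
      using v by (simp_all add: idf_def)
    have 1: "?r * ?f = 1\<^sub>m (vdim B v)" "?g * ?s = 1\<^sub>m (vdim A v)"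
      by (rule *, use dims eqs c in \<open>auto simp: fm_of_mult\<close>)+
    have 2: "?g * ?f = 0\<^sub>m (vdim A v) (vdim B v)"
    proof (rule *)
      show "fm_of (?g * ?f) = fm_of (0\<^sub>m (vdim A v) (vdim B v))"
        using dims eqs c by (auto simp: fm_of_mult) (auto simp: fmat_eq_iff ent_fm_of)
    qed (use dims in auto)
    have 3: "?f * ?r + ?s * ?g = 1\<^sub>m (vdim E v)"
    proof (rule *)
      have "fm_of (?f * ?r + ?s * ?g) = fm_of (?f * ?r) + fm_of (?s * ?g)"
        using dims by (auto simp: fmat_eq_iff ent_fm_of)
      then show "fm_of (?f * ?r + ?s * ?g) = fm_of (1\<^sub>m (vdim E v))"
        using dims eqs c by (auto simp: fm_of_mult)
    qed (use dims in auto)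
    show ?thesis
      using splitting_pointwise[OF dims 1 3 2] by blast
  qed
  then show ?thesis
    unfolding short_exact_def using rep_hom_unfam Q reps ex by (metis fexact_def)
qed

lemma splits_iff:
  assumes Q: "wf_digraph Q" and reps: "is_rep Q E" "is_rep Q A" and g: "rep_hom Q E A g"
  shows "splits Q E A g \<longleftrightarrow> (\<exists>S. fhom Q A E S \<and> fam Q g * S = idf Q A)"
proof
  assume "splits Q E A g"
  then obtain s where s: "rep_hom Q A E s" "\<forall>v\<in>verts Q. g v * s v = id_fam A v"
    by (auto simp: splits_def)
  have "fam Q g * fam Q s = fam Q (id_fam A)"
    using s rep_homD[OF g] rep_homD[OF s(1)] id_fam_carrier
    by (subst fam_prod_eq_iff[where r = "vdim A" and m = "vdim E" and c = "vdim A"]) auto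
  then show "\<exists>S. fhom Q A E S \<and> fam Q g * S = idf Q A"
    using fhom_fam[OF Q reps(2,1) s(1)] by auto
next
  assume "\<exists>S. fhom Q A E S \<and> fam Q g * S = idf Q A"
  then obtain S where S: "fhom Q A E S" "fam Q g * S = idf Q A" by blast
  have "fam Q (unfam A E S) = S" using S by (simp add: fam_unfam fhom_fsup)
  then have "\<forall>v\<in>verts Q. g v * unfam A E S v = id_fam A v"
    using S rep_homD[OF g]
    by (subst fam_prod_eq_iff[symmetric, where r = "vdim A" and m = "vdim E" and c = "vdim A"])
      (auto intro: unfam_carrier id_fam_carrier)
  then show "splits Q E A g"
    unfolding splits_def using rep_hom_unfam[OF Q reps(2,1) S(1)] by blast
qed

lemma extn_mor_iff:
  assumes Q: "wf_digraph Q" and reps: "is_rep Q E" "is_rep Q E'"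
    and f: "rep_hom Q B E f" "rep_hom Q B' E' f'" and g: "rep_hom Q E A g" "rep_hom Q E' A' g'"
    and \<beta>: "\<And>v. v \<in> verts Q \<Longrightarrow> \<beta> v \<in> carrier_mat (vdim B' v) (vdim B v)"
    and \<alpha>: "\<And>v. v \<in> verts Q \<Longrightarrow> \<alpha> v \<in> carrier_mat (vdim A' v) (vdim A v)"
  shows "extn_mor Q \<beta> \<alpha> (E, f, g) (E', f', g') \<longleftrightarrow>
    (\<exists>H. fhom Q E E' H \<and> H * fam Q f = fam Q f' * fam Q \<beta> \<and> fam Q g' * H = fam Q \<alpha> * fam Q g)"
proof -
  have eq: "(\<forall>v\<in>verts Q. h v * f v = f' v * \<beta> v \<and> g' v * h v = \<alpha> v * g v) \<longleftrightarrow>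
      fam Q h * fam Q f = fam Q f' * fam Q \<beta> \<and> fam Q g' * fam Q h = fam Q \<alpha> * fam Q g"
    if h: "\<And>v. v \<in> verts Q \<Longrightarrow> h v \<in> carrier_mat (vdim E' v) (vdim E v)" for h
    using rep_homD[OF f(1)] rep_homD[OF f(2)] rep_homD[OF g(1)] rep_homD[OF g(2)] \<beta> \<alpha> h
    by (subst fam_prod_eq_prod_iff[where r = "vdim E'" and m = "vdim E" and c = "vdim B" and m' = "vdim B'"], blast,
        subst fam_prod_eq_prod_iff[where r = "vdim A'" and m = "vdim E'" and c = "vdim E" and m' = "vdim A"])
      auto
  show ?thesis
  proof
    assume "extn_mor Q \<beta> \<alpha> (E, f, g) (E', f', g')"
    then show "\<exists>H. fhom Q E E' H \<and> H * fam Q f = fam Q f' * fam Q \<beta> \<and> fam Q g' * H = fam Q \<alpha> * fam Q g"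
      unfolding extn_mor_def prod.case
    proof (elim exE conjE)
      fix h assume h: "rep_hom Q E E' h"
        "\<forall>v\<in>verts Q. h v * f v = f' v * \<beta> v \<and> g' v * h v = \<alpha> v * g v"
      show ?thesis
        using fhom_fam[OF Q reps h(1)] eq[OF rep_homD[OF h(1)]] h(2) by blast
    qed
  next
    assume "\<exists>H. fhom Q E E' H \<and> H * fam Q f = fam Q f' * fam Q \<beta> \<and> fam Q g' * H = fam Q \<alpha> * fam Q g"
    then obtain H where H: "fhom Q E E' H" "H * fam Q f = fam Q f' * fam Q \<beta>" "fam Q g' * H = fam Q \<alpha> * fam Q g"
      by blast
    have "fam Q (unfam E E' H) = H" using H by (simp add: fam_unfam fhom_fsup)
    then have "\<forall>v\<in>verts Q. unfam E E' H v * f v = f' v * \<beta> v \<and> g' v * unfam E E' H v = \<alpha> v * g v"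
      using eq[of "unfam E E' H", OF unfam_carrier] H(2,3) by simp
    then show "extn_mor Q \<beta> \<alpha> (E, f, g) (E', f', g')"
      unfolding extn_mor_def prod.case using rep_hom_unfam[OF Q reps H(1)] by blast
  qed
qed

subsection \<open>Direct sums\<close>

text \<open>Padding by zeros identifies V with the first block of the direct sum, so its inclusion
  and its projection are one and the same idempotent. Only the second block needs shifts.\<close>

definition inl :: "('v, 'a) pre_digraph \<Rightarrow> ('v, 'a, 'k::field) qrep \<Rightarrow> ('v, 'a, 'k) qrep \<Rightarrow> 'v \<Rightarrow> 'k fmat" where
  "inl Q V W = idf Q V"

definition prl :: "('v, 'a) pre_digraph \<Rightarrow> ('v, 'a, 'k::field) qrep \<Rightarrow> ('v, 'a, 'k) qrep \<Rightarrow> 'v \<Rightarrow> 'k fmat" where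
  "prl Q V W = idf Q V"

definition inr :: "('v, 'a) pre_digraph \<Rightarrow> ('v, 'a, 'k::field) qrep \<Rightarrow> ('v, 'a, 'k) qrep \<Rightarrow> 'v \<Rightarrow> 'k fmat" where
  "inr Q V W = (\<lambda>v. if v \<in> verts Q then shift_down (vdim V v) (vdim W v) else 0)"

definition prr :: "('v, 'a) pre_digraph \<Rightarrow> ('v, 'a, 'k::field) qrep \<Rightarrow> ('v, 'a, 'k) qrep \<Rightarrow> 'v \<Rightarrow> 'k fmat" where
  "prr Q V W = (\<lambda>v. if v \<in> verts Q then shift_up (vdim V v) (vdim W v) else 0)"

lemma is_rep_dsum: "is_rep Q V \<Longrightarrow> is_rep Q W \<Longrightarrow> is_rep Q (dsum V W)"
  by (auto simp: is_rep_def dsum_def dsum_mat_def)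

lemma vdim_dsum [simp]: "vdim (dsum V W) v = vdim V v + vdim W v"
  by (simp add: dsum_def)

lemma biproduct_equations:
  "prl Q V W * inl Q V W = idf Q V" "prr Q V W * inr Q V W = idf Q W"
  "prl Q V W * inr Q V W = 0" "prr Q V W * inl Q V W = 0"
  "inl Q V W * prl Q V W + inr Q V W * prr Q V W = idf Q (dsum V W)"
  by (auto simp: fun_eq_iff inl_def prl_def inr_def prr_def idf_def shift_simps)

lemma biproduct_fsup:
  "fsup Q V (dsum V W) (inl Q V W)" "fsup Q (dsum V W) V (prl Q V W)"
  "fsup Q W (dsum V W) (inr Q V W)" "fsup Q (dsum V W) W (prr Q V W)"
  by (auto simp: fsup_iff inl_def prl_def inr_def prr_def idf_def shift_simps fcar_idm_add)

lemma mm_dsum: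
  assumes Q: "wf_digraph Q" and V: "is_rep Q V" and W: "is_rep Q W" and a: "a \<in> arcs Q"
  shows "mm (dsum V W) a = inl Q V W (head Q a) * mm V a * prl Q V W (tail Q a)
     + inr Q V W (head Q a) * mm W a * prr Q V W (tail Q a)"
proof -
  have "mm (dsum V W) a = mm V a + inr Q V W (head Q a) * mm W a * prr Q V W (tail Q a)"
    using fm_of_dsum_mat[of "amap V a" _ _ "amap W a"] V W a Q
    by (auto simp: is_rep_def mm_def dsum_def inr_def prr_def wf_digraph_def)
  then show ?thesis
    by (simp add: inl_def prl_def idf_mm[OF Q V a])
qed

lemma biproduct_fhom:
  assumes Q: "wf_digraph Q" and V: "is_rep Q V" and W: "is_rep Q W"
  shows "fhom Q V (dsum V W) (inl Q V W)" "fhom Q (dsum V W) V (prl Q V W)"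
    "fhom Q W (dsum V W) (inr Q V W)" "fhom Q (dsum V W) W (prr Q V W)"
proof -
  have e: "prl Q V W v * inl Q V W v = idf Q V v" "prr Q V W v * inr Q V W v = idf Q W v"
    "prl Q V W v * inr Q V W v = 0" "prr Q V W v * inl Q V W v = 0" for v
    using biproduct_equations[of Q V W] by (auto simp: fun_eq_iff)
  have e': "prl Q V W v * (inl Q V W v * X) = idf Q V v * X" "prr Q V W v * (inr Q V W v * X) = idf Q W v * X"
    "prl Q V W v * (inr Q V W v * X) = 0" "prr Q V W v * (inl Q V W v * X) = 0" for v X
    using e[of v] by (simp_all flip: mult.assoc)
  note i = idf_mm[OF Q V] idf_mm[OF Q W]
  have i': "idf Q V (head Q a) * (mm V a * X) = mm V a * X" "idf Q W (head Q a) * (mm W a * X) = mm W a * X"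
    if "a \<in> arcs Q" for a X
    using i that by (simp_all flip: mult.assoc)
  show "fhom Q V (dsum V W) (inl Q V W)" "fhom Q (dsum V W) V (prl Q V W)"
    "fhom Q W (dsum V W) (inr Q V W)" "fhom Q (dsum V W) W (prr Q V W)"
    using mm_dsum[OF Q V W] biproduct_fsup[where Q = Q and V = V and W = W]
    by (auto simp: fhom_def distrib_left distrib_right mult.assoc e e' i i')
qed

lemma fam_dsum_mat:
  assumes "\<And>v. v \<in> verts Q \<Longrightarrow> f v \<in> carrier_mat (vdim W v) (vdim V v)"
    "\<And>v. v \<in> verts Q \<Longrightarrow> f' v \<in> carrier_mat (vdim W' v) (vdim V' v)"
  shows "fam Q (\<lambda>v. dsum_mat (f v) (f' v)) =
    inl Q W W' * fam Q f * prl Q V V' + inr Q W W' * fam Q f' * prr Q V V'"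
proof
  fix v
  show "fam Q (\<lambda>v. dsum_mat (f v) (f' v)) v =
    (inl Q W W' * fam Q f * prl Q V V' + inr Q W W' * fam Q f' * prr Q V V') v"
  proof (cases "v \<in> verts Q")
    case True
    have "idm (vdim W v) * fm_of (f v) * idm (vdim V v) = fm_of (f v)"
      using fcar_fm_of[OF assms(1)[OF True]] by (simp add: fcar_def)
    with True show ?thesis
      by (simp add: fam_def inl_def prl_def inr_def prr_def idf_def fm_of_dsum_mat[OF assms(1,2)[OF True]])
  qed (simp add: fam_def inl_def prl_def inr_def prr_def idf_def)
qed

lemma fam_diagonal: "fam Q (diagonal_fam V) = inl Q V V + inr Q V V"
proof
  fix v
  have "fm_of (diagonal_fam V v) = idm (vdim V v) + shift_down (vdim V v) (vdim V v)"
    by (auto simp: diagonal_fam_def Let_def fmat_eq_iff ent_fm_of ent_idm ent_shift_down)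
  then show "fam Q (diagonal_fam V) v = (inl Q V V + inr Q V V) v"
    by (simp add: fam_def inl_def inr_def idf_def)
qed

lemma fam_codiagonal: "fam Q (codiagonal_fam V) = prl Q V V + prr Q V V"
proof
  fix v
  have "fm_of (codiagonal_fam V v) = idm (vdim V v) + shift_up (vdim V v) (vdim V v)"
    by (auto simp: codiagonal_fam_def Let_def fmat_eq_iff ent_fm_of ent_idm ent_shift_up)
  then show "fam Q (codiagonal_fam V) v = (prl Q V V + prr Q V V) v"
    by (simp add: fam_def prl_def prr_def idf_def)
qed

lemma diagonal_carrier: "diagonal_fam V v \<in> carrier_mat (vdim (dsum V V) v) (vdim V v)"
  "codiagonal_fam V v \<in> carrier_mat (vdim V v) (vdim (dsum V V) v)"
  by (auto simp: diagonal_fam_def codiagonal_fam_def Let_def)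

section \<open>Interval representations\<close>

text \<open>The segment \<open>(i, j)\<close> stands for the interval of vertices \<open>i + 1, \<dots>, j\<close>.\<close>

definition ivl :: "nat \<times> nat \<Rightarrow> nat set" where
  "ivl s = {fst s<..snd s}"

definition iv :: "(nat, 'a) pre_digraph \<Rightarrow> nat \<times> nat \<Rightarrow> (nat, 'a, 'k::field) qrep" where
  "iv Q s = \<lparr>vdim = (\<lambda>v. if v \<in> ivl s then 1 else 0),
     amap = (\<lambda>a. mat (if head Q a \<in> ivl s then 1 else 0) (if tail Q a \<in> ivl s then 1 else 0) (\<lambda>_. 1))\<rparr>"

definition ind :: "nat set \<Rightarrow> nat \<Rightarrow> 'k::field fmat" where
  "ind S = (\<lambda>v. if v \<in> S then idm 1 else 0)"

definition smf :: "'k::field \<Rightarrow> ('v \<Rightarrow> 'k fmat) \<Rightarrow> 'v \<Rightarrow> 'k fmat" where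
  "smf c F = (\<lambda>v. sm c (F v))"

text \<open>A direct summand given by its inclusion and projection. No complement is mentioned, so
  composing with morphisms is enough to move it between representations or to compare it with a
  decomposition.\<close>

definition retract ::
    "(nat, 'a) pre_digraph \<Rightarrow> (nat, 'a, 'k::field) qrep \<Rightarrow> nat \<times> nat \<Rightarrow>
     (nat \<Rightarrow> 'k fmat) \<Rightarrow> (nat \<Rightarrow> 'k fmat) \<Rightarrow> bool" where
  "retract Q V s x y \<longleftrightarrow> fhom Q (iv Q s) V x \<and> fhom Q V (iv Q s) y \<and> y * x = idf Q (iv Q s)"

lemma smf_mult: "smf c F * smf d G = smf (c * d) (F * G)"
  by (auto simp: smf_def fun_eq_iff sm_mult_left sm_mult_right mult.commute)

lemma ind_mult [simp]: "ind S * ind T = ind (S \<inter> T)"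
  by (auto simp: ind_def fun_eq_iff)

lemma is_rep_iv: "is_rep Q (iv Q s)"
  by (auto simp: is_rep_def iv_def)

lemma vdim_iv: "vdim (iv Q s) v = (if v \<in> ivl s then 1 else 0)"
  by (simp add: iv_def)

lemma mm_iv: "mm (iv Q s) a = (if tail Q a \<in> ivl s \<and> head Q a \<in> ivl s then idm 1 else 0)"
  by (auto simp: mm_def iv_def fmat_eq_iff ent_fm_of ent_idm)

lemma mem_segments: "s \<in> segments n \<longleftrightarrow> fst s < snd s \<and> snd s \<le> n + 2"
  by (auto simp: segments_def)

text \<open>A decomposition of \<open>V\<close> into intervals, given by the inclusions and projections of the summands.\<close>

definition has_sys ::
    "nat \<Rightarrow> (nat, 'a) pre_digraph \<Rightarrow> (nat, 'a, 'k::field) qrep \<Rightarrow> 'i set \<Rightarrow> ('i \<Rightarrow> nat \<times> nat) \<Rightarrow>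
     ('i \<Rightarrow> nat \<Rightarrow> 'k fmat) \<Rightarrow> ('i \<Rightarrow> nat \<Rightarrow> 'k fmat) \<Rightarrow> bool" where
  "has_sys n Q V K t \<iota> \<pi> \<longleftrightarrow> finite K \<and> (\<forall>i\<in>K. t i \<in> segments n) \<and>
    (\<forall>i\<in>K. retract Q V (t i) (\<iota> i) (\<pi> i)) \<and> (\<forall>i\<in>K. \<forall>j\<in>K. i \<noteq> j \<longrightarrow> \<pi> i * \<iota> j = 0) \<and>
    (\<Sum>i\<in>K. \<iota> i * \<pi> i) = idf Q V"

locale type_A =
  fixes n :: nat and Q :: "(nat, 'a) pre_digraph"
  assumes dynkin: "dynkin_A (n + 2) Q"
begin

text \<open>Used both for the quiver and for the polygon: a label between 1 and n + 1 is an upper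
  vertex exactly if \<open>up\<close> holds. It is false at 0 and n + 2 (see
  \<open>up_bounds\<close>), so these two count as lower in the cyclic order.\<close>

definition up :: "nat \<Rightarrow> bool" where
  "up i \<longleftrightarrow> (\<exists>a\<in>arcs Q. tail Q a = i \<and> head Q a = i + 1)"

lemma wf: "wf_digraph Q" and verts: "verts Q = {1..n + 2}"
  using dynkin by (auto simp: dynkin_A_def)

lemma arc_between: "1 \<le> i \<Longrightarrow> i \<le> n + 1 \<Longrightarrow> \<exists>!a. a \<in> arcs Q \<and> {tail Q a, head Q a} = {i, i + 1}"
  using dynkin by (auto simp: dynkin_A_def)

lemma arc_cases:
  assumes "a \<in> arcs Q"
  obtains i where "1 \<le> i" "i \<le> n + 1" "up i" "tail Q a = i" "head Q a = i + 1"
  | i where "1 \<le> i" "i \<le> n + 1" "\<not> up i" "tail Q a = i + 1" "head Q a = i"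
proof -
  obtain i where i: "1 \<le> i" "i \<le> n + 1" "{tail Q a, head Q a} = {i, i + 1}"
    using dynkin assms by (force simp: dynkin_A_def)
  then consider "tail Q a = i" "head Q a = i + 1" | "tail Q a = i + 1" "head Q a = i"
    by (auto simp: doubleton_eq_iff)
  then show thesis
  proof cases
    case 1
    then show thesis using that(1) i assms by (auto simp: up_def)
  next
    case 2
    have "\<not> up i"
    proof
      assume "up i"
      then obtain b where b: "b \<in> arcs Q" "tail Q b = i" "head Q b = i + 1" by (auto simp: up_def)
      then have "{tail Q b, head Q b} = {i, i + 1}" by simp
      then have "a = b" using arc_between[OF i(1,2)] assms b(1) i(3) by blast
      with b 2 show False by simp
    qed
    then show thesis using that(2) 2 i by blast
  qed
qed

lemma up_arc: "up i \<Longrightarrow> \<exists>a\<in>arcs Q. tail Q a = i \<and> head Q a = i + 1"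
  by (simp add: up_def)

lemma down_arc: "1 \<le> i \<Longrightarrow> i \<le> n + 1 \<Longrightarrow> \<not> up i \<Longrightarrow> \<exists>a\<in>arcs Q. tail Q a = i + 1 \<and> head Q a = i"
  using arc_between[of i] by (auto simp: up_def doubleton_eq_iff)

lemma arc_unique:
  assumes "a \<in> arcs Q" "b \<in> arcs Q" "tail Q a = tail Q b" "head Q a = head Q b" shows "a = b"
proof -
  obtain i where "1 \<le> i" "i \<le> n + 1" "{tail Q a, head Q a} = {i, i + 1}"
    using assms(1) by (cases rule: arc_cases) (auto simp: insert_commute)
  then show ?thesis using arc_between[of i] assms by metis
qed

lemma ivl_verts: "s \<in> segments n \<Longrightarrow> ivl s \<subseteq> verts Q"
  by (auto simp: mem_segments ivl_def verts)

lemma idf_iv: "snd s \<le> n + 2 \<Longrightarrow> idf Q (iv Q s) = ind (ivl s)"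
  by (auto simp: idf_def ind_def vdim_iv fun_eq_iff verts ivl_def)

lemma idf_iv_seg: "s \<in> segments n \<Longrightarrow> idf Q (iv Q s) = ind (ivl s)"
  by (simp add: idf_iv mem_segments)

lemma idf_iv_neq_0:
  assumes "s \<in> segments n" shows "idf Q (iv Q s) \<noteq> (0 :: nat \<Rightarrow> 'k::field fmat)"
proof
  assume "idf Q (iv Q s) = (0 :: nat \<Rightarrow> 'k fmat)"
  then have "(ind (ivl s) :: nat \<Rightarrow> 'k fmat) (snd s) = 0" using idf_iv_seg[OF assms] by (metis zero_fun_apply)
  then show False using assms by (auto simp: ind_def ivl_def mem_segments)
qed

lemma fsup_iv_entry:
  assumes "fsup Q (iv Q s) (iv Q t) F"
  shows "fcar 1 1 (F v)" "v \<notin> ivl s \<inter> ivl t \<Longrightarrow> F v = 0"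
proof -
  have "F v = 0 \<or> v \<in> ivl s \<inter> ivl t \<and> fcar 1 1 (F v)"
    using assms[unfolded fsup_iff, rule_format, of v] fcar_trivial[of "vdim (iv Q t) v" "vdim (iv Q s) v" "F v"]
    by (cases "v \<in> ivl s"; cases "v \<in> ivl t"; cases "v \<in> verts Q") (auto simp: vdim_iv)
  then show "fcar 1 1 (F v)" "v \<notin> ivl s \<inter> ivl t \<Longrightarrow> F v = 0" by auto
qed

text \<open>The condition that the identity on the common vertices commutes with the arrows. The
  left side says that the composite through the head of a is nonzero, the right side that the
  composite through its tail is.\<close>

definition overlap_hom :: "nat \<times> nat \<Rightarrow> nat \<times> nat \<Rightarrow> bool" where
  "overlap_hom s t \<longleftrightarrow> (\<forall>a\<in>arcs Q. tail Q a \<in> ivl s \<and> head Q a \<in> ivl s \<and> head Q a \<in> ivl t \<longleftrightarrow>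
     tail Q a \<in> ivl s \<and> tail Q a \<in> ivl t \<and> head Q a \<in> ivl t)"

lemma fhom_overlap:
  assumes s: "snd s \<le> n + 2" and t: "snd t \<le> n + 2" and C: "fcar 1 1 C" and st: "overlap_hom s t"
  shows "fhom Q (iv Q s) (iv Q t) (\<lambda>v. if v \<in> ivl s \<inter> ivl t then C else 0)"
proof -
  have [simp]: "idm (Suc 0) * C = C" "C * idm (Suc 0) = C" using C by (auto simp: fcar_def)
  have "v \<in> verts Q" if "v \<in> ivl s" for v
    using that s by (auto simp: ivl_def verts)
  then show ?thesis
    using C st by (auto simp: fhom_def fsup_iff vdim_iv mm_iv overlap_hom_def)
qed

lemma fhom_ind:
  assumes "snd s \<le> n + 2" "snd t \<le> n + 2" "overlap_hom s t"
  shows "fhom Q (iv Q s) (iv Q t) (ind (ivl s \<inter> ivl t))"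
  using fhom_overlap[OF assms(1,2) fcar_idm assms(3)] by (simp add: ind_def)

text \<open>Arrows inside the interval act as the identity, so commutation forces equal entries at
  neighbouring vertices, and the interval is connected. That endomorphisms are scalars takes the
  place of local endomorphism rings below.\<close>

lemma fhom_iv_scalar:
  assumes s: "s \<in> segments n" and F: "fhom Q (iv Q s) (iv Q s) F"
  shows "\<exists>c. F = smf c (idf Q (iv Q s))"
proof -
  obtain a b where ab: "s = (a, b)" "a < b" "b \<le> n + 2" using s by (cases s) (auto simp: mem_segments)
  note F1 = fsup_iv_entry[OF fhom_fsup[OF F]]
  have step: "F (Suc i) = F i" if i: "a < i" "i < b" for i
  proof -
    have "\<exists>c\<in>arcs Q. {tail Q c, head Q c} = {i, i + 1}"
      using arc_between[of i] i ab by auto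
    then obtain c where c: "c \<in> arcs Q" "{tail Q c, head Q c} = {i, i + 1}" by blast
    have in_s: "i \<in> ivl s" "i + 1 \<in> ivl s" using i ab by (auto simp: ivl_def)
    have "F (head Q c) * mm (iv Q s) c = mm (iv Q s) c * F (tail Q c)"
      using F c(1) by (simp add: fhom_def)
    moreover have m: "mm (iv Q s) c = idm 1"
      using c(2) in_s by (auto simp: mm_iv doubleton_eq_iff)
    ultimately have "F (head Q c) = F (tail Q c)"
      using F1(1)[of "head Q c"] F1(1)[of "tail Q c"] by (simp add: m fcar_def)
    with c(2) show ?thesis by (auto simp: doubleton_eq_iff)
  qed
  have const: "F (Suc a + j) = F (Suc a)" if "Suc a + j \<le> b" for j
    using that by (induction j) (auto simp: step)
  define c where "c = ent (F (Suc a)) 0 0"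
  have c: "F (Suc a) = sm c (idm 1)" unfolding c_def by (rule fcar_1_eq[OF F1(1)])
  have "F v = sm c (idf Q (iv Q s) v)" for v
  proof (cases "v \<in> ivl s")
    case True
    then have "v = Suc a + (v - Suc a)" "v \<le> b" using ab by (auto simp: ivl_def)
    with const[of "v - Suc a"] c True show ?thesis by (simp add: idf_iv_seg[OF s] ind_def)
  next
    case False
    then show ?thesis using F1(2)[of v] by (simp add: idf_iv_seg[OF s] ind_def)
  qed
  then show ?thesis by (auto simp: smf_def fun_eq_iff)
qed

lemma smf_idf_eq_0: "s \<in> segments n \<Longrightarrow> smf c (idf Q (iv Q s)) = (0 :: nat \<Rightarrow> 'k::field fmat) \<longleftrightarrow> c = 0"
  using idf_iv_neq_0[of s] by (auto simp: smf_def fun_eq_iff sm_eq_0_iff)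

text \<open>The composite is a nonzero scalar, so F and G vanish at no vertex of s and t contains s.
  If t were larger, an arrow across an end of s would make F or G vanish at that end.\<close>

lemma iv_factor:
  assumes s: "s \<in> segments n" and t: "t \<in> segments n"
    and F: "fhom Q (iv Q s) (iv Q t) F" and G: "fhom Q (iv Q t) (iv Q s) G" and GF: "G * F \<noteq> 0"
  shows "s = t"
proof -
  obtain a b c d where st: "s = (a, b)" "t = (c, d)" by fastforce
  with s t have ab: "a < b" "b \<le> n + 2" "c < d" "d \<le> n + 2" by (auto simp: mem_segments)
  obtain k where k: "G * F = smf k (idf Q (iv Q s))"
    using fhom_iv_scalar[OF s fhom_mult[OF G F]] by blast
  with GF have "k \<noteq> 0" by (auto simp: smf_def fun_eq_iff)
  have ne: "G v * F v \<noteq> 0" if "v \<in> ivl s" for v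
  proof -
    have "(G * F) v = sm k (idm 1)" using k that by (simp add: smf_def idf_iv_seg[OF s] ind_def)
    then show ?thesis using \<open>k \<noteq> 0\<close> by (simp add: sm_eq_0_iff)
  qed
  then have ne': "G v \<noteq> 0" "F v \<noteq> 0" if "v \<in> ivl s" for v
    using that by force+
  note F1 = fsup_iv_entry[OF fhom_fsup[OF F]] and G1 = fsup_iv_entry[OF fhom_fsup[OF G]]
  have sub: "v \<in> ivl t" if "v \<in> ivl s" for v
    using F1(2)[of v] ne'[OF that] by blast
  have "c \<le> a" "b \<le> d"
    using sub[of "Suc a"] sub[of b] st ab by (auto simp: ivl_def)
  \<comment> \<open>The arrow between u and v acts as zero on the interval s and as the identity on
    t. Commutation gives \<open>F = 0\<close> at its tail and \<open>G = 0\<close> at its head, and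
    v is one of the two.\<close>
  have no: False if u: "u \<in> ivl t" "u \<notin> ivl s" and v: "v \<in> ivl s"
    and e: "\<exists>e\<in>arcs Q. {tail Q e, head Q e} = {u, v}" for u v
  proof -
    obtain e where e: "e \<in> arcs Q" "{tail Q e, head Q e} = {u, v}" using e by blast
    have FG: "F (head Q e) * mm (iv Q s) e = mm (iv Q t) e * F (tail Q e)"
      "G (head Q e) * mm (iv Q t) e = mm (iv Q s) e * G (tail Q e)"
      using F G e(1) by (auto simp: fhom_def)
    have m: "mm (iv Q s) e = 0" "mm (iv Q t) e = idm 1"
      using e(2) u v sub[OF v] by (auto simp: mm_iv doubleton_eq_iff)
    have "F (tail Q e) = 0" "G (head Q e) = 0"
      using FG F1(1) G1(1) by (auto simp: m fcar_def)
    with e(2) ne'[OF v] show False by (auto simp: doubleton_eq_iff)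
  qed
  have "\<not> c < a"
  proof
    assume "c < a"
    have "\<exists>e\<in>arcs Q. {tail Q e, head Q e} = {a, Suc a}"
      using arc_between[of a] \<open>c < a\<close> ab by auto
    then show False
      using no[of a "Suc a"] \<open>c < a\<close> \<open>b \<le> d\<close> ab st by (auto simp: ivl_def)
  qed
  moreover have "\<not> b < d"
  proof
    assume "b < d"
    have "\<exists>e\<in>arcs Q. {tail Q e, head Q e} = {Suc b, b}"
      using arc_between[of b] \<open>b < d\<close> ab by (auto simp: insert_commute)
    then show False
      using no[of "Suc b" b] \<open>b < d\<close> \<open>c \<le> a\<close> ab st by (auto simp: ivl_def)
  qed
  ultimately show ?thesis using \<open>c \<le> a\<close> \<open>b \<le> d\<close> st by simp
qed

section \<open>Multiplicities of intervals, read off from retractions\<close>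

lemma sys_expand:
  assumes V: "has_sys n Q V K t \<iota> \<pi>" and x: "fhom Q U V x" and y: "fhom Q V W y"
  shows "y * x = (\<Sum>i\<in>K. (y * \<iota> i) * (\<pi> i * x))"
proof -
  have "y * x = y * (\<Sum>i\<in>K. \<iota> i * \<pi> i) * x"
    using V fhom_right[OF y] by (simp add: has_sys_def)
  then show ?thesis by (simp add: sum_distrib_left sum_distrib_right mult.assoc)
qed

lemma retract_term_zero:
  assumes V: "has_sys n Q V K t \<iota> \<pi>" and s: "s \<in> segments n"
    and x: "fhom Q (iv Q s) V x" and y: "fhom Q V (iv Q s) y" and i: "i \<in> K" "t i \<noteq> s"
  shows "(y * \<iota> i) * (\<pi> i * x) = 0"
proof (rule ccontr)
  assume ne: "(y * \<iota> i) * (\<pi> i * x) \<noteq> 0"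
  have "t i \<in> segments n" "fhom Q (iv Q (t i)) V (\<iota> i)" "fhom Q V (iv Q (t i)) (\<pi> i)"
    using V i by (auto simp: has_sys_def retract_def)
  then have "s = t i"
    using iv_factor[OF s _ fhom_mult[OF _ x] fhom_mult[OF y] ne] by blast
  with i show False by simp
qed

text \<open>Writing the identity of V as the sum of the \<open>\<iota> i * \<pi> i\<close> splits
  \<open>y * x\<close> into composites through the summands. By \<open>iv_factor\<close> those
  through a different interval vanish, so some summand must be s.\<close>

lemma retract_in_sys:
  assumes V: "has_sys n Q V K t \<iota> \<pi>" and s: "s \<in> segments n" and xy: "retract Q V s x y"
  shows "\<exists>i\<in>K. t i = s"
proof (rule ccontr)
  assume no: "\<not> ?thesis"
  have x: "fhom Q (iv Q s) V x" and y: "fhom Q V (iv Q s) y" and yx: "y * x = idf Q (iv Q s)"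
    using xy by (auto simp: retract_def)
  have "y * x = 0"
    unfolding sys_expand[OF V x y]
    by (rule sum.neutral) (use retract_term_zero[OF V s x y] no in blast)
  then show False using yx by (simp add: idf_iv_neq_0[OF s])
qed

text \<open>If only one summand were s, all composites would be products of scalars taken through
  it: \<open>p * q\<close> is nonzero by the first retract and q' is nonzero by the second, yet
  \<open>p * q'\<close> has to vanish.\<close>

lemma double_retract_in_sys:
  assumes V: "has_sys n Q V K t \<iota> \<pi>" and s: "s \<in> segments n"
    and xy: "retract Q V s x y" and xy': "retract Q V s x' y'" and yx': "y * x' = 0"
  shows "\<exists>i\<in>K. \<exists>j\<in>K. i \<noteq> j \<and> t i = s \<and> t j = s"
proof (rule ccontr)
  assume no: "\<not> ?thesis"
  obtain i where i: "i \<in> K" "t i = s" using retract_in_sys[OF V s xy] by blast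
  have single: "v * u = (v * \<iota> i) * (\<pi> i * u)"
    if u: "fhom Q (iv Q s) V u" and v: "fhom Q V (iv Q s) v" for u v
  proof -
    have fin: "finite K" using V by (simp add: has_sys_def)
    have "v * u = (\<Sum>j\<in>K. if j = i then (v * \<iota> i) * (\<pi> i * u) else 0)"
      unfolding sys_expand[OF V u v]
      by (rule sum.cong) (use retract_term_zero[OF V s u v] no i in auto)
    then show ?thesis using fin i by simp
  qed
  have h: "fhom Q (iv Q s) V x" "fhom Q V (iv Q s) y" "fhom Q (iv Q s) V x'" "fhom Q V (iv Q s) y'"
    and e: "y * x = idf Q (iv Q s)" "y' * x' = idf Q (iv Q s)"
    using xy xy' by (auto simp: retract_def)
  have hi: "fhom Q (iv Q s) V (\<iota> i)" "fhom Q V (iv Q s) (\<pi> i)"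
    using V i by (auto simp: has_sys_def retract_def)
  obtain p where p: "y * \<iota> i = smf p (idf Q (iv Q s))"
    using fhom_iv_scalar[OF s fhom_mult[OF h(2) hi(1)]] by blast
  obtain q where q: "\<pi> i * x = smf q (idf Q (iv Q s))"
    using fhom_iv_scalar[OF s fhom_mult[OF hi(2) h(1)]] by blast
  obtain q' where q': "\<pi> i * x' = smf q' (idf Q (iv Q s))"
    using fhom_iv_scalar[OF s fhom_mult[OF hi(2) h(3)]] by blast
  have "smf (p * q) (idf Q (iv Q s)) \<noteq> 0"
    using single[OF h(1,2)] e(1) by (auto simp: p q smf_mult(1) idf_iv_neq_0[OF s])
  moreover have "smf (p * q') (idf Q (iv Q s)) = 0"
    using single[OF h(3,2)] yx' by (simp add: p q' smf_mult(1))
  moreover have "q' \<noteq> 0"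
  proof
    assume "q' = 0"
    then have "\<pi> i * x' = 0" unfolding q' by (simp add: smf_def fun_eq_iff)
    then have "y' * x' = 0" using single[OF h(3,4)] by simp
    then show False using e(2) by (simp add: idf_iv_neq_0[OF s])
  qed
  ultimately show False by (simp add: smf_idf_eq_0[OF s])
qed

lemma has_sys_fiso:
  assumes V: "has_sys n Q V K t \<iota> \<pi>" and VW: "fiso Q V W"
  shows "\<exists>\<iota> \<pi>. has_sys n Q W K t \<iota> \<pi>"
proof -
  obtain F G where F: "fhom Q V W F" and G: "fhom Q W V G" and GF: "G * F = idf Q V" and FG: "F * G = idf Q W"
    using VW by (auto simp: fiso_def)
  have c: "\<pi> i * G * (F * \<iota> j) = \<pi> i * \<iota> j" if "i \<in> K" for i j
  proof -
    have "\<pi> i * G * (F * \<iota> j) = \<pi> i * (G * F) * \<iota> j" by (simp add: mult.assoc)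
    moreover have "\<pi> i * idf Q V = \<pi> i"
      using V that by (auto simp: has_sys_def retract_def intro: fhom_right)
    ultimately show ?thesis by (simp add: GF)
  qed
  have "(\<Sum>i\<in>K. F * \<iota> i * (\<pi> i * G)) = F * (\<Sum>i\<in>K. \<iota> i * \<pi> i) * G"
    by (simp add: sum_distrib_left sum_distrib_right mult.assoc)
  also have "\<dots> = idf Q W"
    using V FG fhom_right[OF F] by (simp add: has_sys_def)
  finally have "has_sys n Q W K t (\<lambda>i. F * \<iota> i) (\<lambda>i. \<pi> i * G)"
    using V F G c by (auto simp: has_sys_def retract_def intro: fhom_mult)
  then show ?thesis by blast
qed

lemma retract_fiso:
  assumes VW: "fiso Q V W" and xy: "retract Q V s x y"
  shows "\<exists>x y. retract Q W s x y"
proof -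
  obtain F G where F: "fhom Q V W F" and G: "fhom Q W V G" and GF: "G * F = idf Q V"
    using VW by (auto simp: fiso_def)
  have "y * G * (F * x) = y * (G * F) * x" by (simp add: mult.assoc)
  also have "\<dots> = y * x"
    using xy fhom_right[of Q V _ y] by (auto simp: GF retract_def)
  finally have "retract Q W s (F * x) (y * G)"
    using xy F G by (auto simp: retract_def intro: fhom_mult)
  then show ?thesis by blast
qed

lemma has_sys_dsum:
  fixes V W :: "(nat, 'a, 'k::field) qrep"
  assumes rV: "is_rep Q V" and rW: "is_rep Q W"
    and V: "has_sys n Q V K t \<iota> \<pi>" and W: "has_sys n Q W L u \<kappa> \<rho>"
  shows "has_sys n Q (dsum V W) (K <+> L) (case_sum t u)
    (case_sum (\<lambda>i. inl Q V W * \<iota> i) (\<lambda>i. inr Q V W * \<kappa> i))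
    (case_sum (\<lambda>i. \<pi> i * prl Q V W) (\<lambda>i. \<rho> i * prr Q V W))"
proof -
  note B = biproduct_fhom[OF wf rV rW] and e = biproduct_equations[of Q V W]
  have a: "A * P * (I * C) = A * (P * I) * C" for A P I C :: "nat \<Rightarrow> 'k fmat"
    by (simp add: mult.assoc)
  have fin: "finite K" "finite L" using V W by (auto simp: has_sys_def)
  have "\<pi> i * idf Q V = \<pi> i" if "i \<in> K" for i
    using V that by (auto simp: has_sys_def retract_def intro: fhom_right)
  moreover have "\<rho> i * idf Q W = \<rho> i" if "i \<in> L" for i
    using W that by (auto simp: has_sys_def retract_def intro: fhom_right)
  moreover have "(\<Sum>i\<in>K <+> L. case_sum (\<lambda>i. inl Q V W * \<iota> i) (\<lambda>i. inr Q V W * \<kappa> i) i *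
      case_sum (\<lambda>i. \<pi> i * prl Q V W) (\<lambda>i. \<rho> i * prr Q V W) i) = idf Q (dsum V W)"
  proof -
    have "(\<Sum>i\<in>K. inl Q V W * \<iota> i * (\<pi> i * prl Q V W)) = inl Q V W * (\<Sum>i\<in>K. \<iota> i * \<pi> i) * prl Q V W"
      "(\<Sum>i\<in>L. inr Q V W * \<kappa> i * (\<rho> i * prr Q V W)) = inr Q V W * (\<Sum>i\<in>L. \<kappa> i * \<rho> i) * prr Q V W"
      by (simp_all add: sum_distrib_left sum_distrib_right mult.assoc)
    moreover have "(\<Sum>i\<in>K. \<iota> i * \<pi> i) = idf Q V" "(\<Sum>i\<in>L. \<kappa> i * \<rho> i) = idf Q W"
      using V W by (auto simp: has_sys_def)
    ultimately show ?thesis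
      using e(5) fhom_right[OF B(1)] fhom_right[OF B(3)] by (simp add: sum.Plus[OF fin])
  qed
  ultimately show ?thesis
    using V W fin
    by (auto simp: has_sys_def retract_def a e
        intro!: fhom_mult[OF B(1)] fhom_mult[OF B(3)] fhom_mult[OF _ B(2)] fhom_mult[OF _ B(4)])
qed

lemma has_sys_reindex:
  assumes V: "has_sys n Q V K t \<iota> \<pi>" and f: "bij_betw f L K"
  shows "has_sys n Q V L (t \<circ> f) (\<iota> \<circ> f) (\<pi> \<circ> f)"
proof -
  have "finite L" using V f bij_betw_finite by (auto simp: has_sys_def)
  moreover have "(\<Sum>i\<in>L. \<iota> (f i) * \<pi> (f i)) = (\<Sum>i\<in>K. \<iota> i * \<pi> i)"
    by (rule sum.reindex_bij_betw[OF f])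
  moreover have "\<pi> (f i) * \<iota> (f j) = 0" if "i \<in> L" "j \<in> L" "i \<noteq> j" for i j
  proof -
    have "f i \<in> K" "f j \<in> K" "f i \<noteq> f j"
      using that f by (auto simp: bij_betw_def inj_on_def)
    then show ?thesis using V by (simp add: has_sys_def)
  qed
  ultimately show ?thesis
    using V bij_betwE[OF f] by (auto simp: has_sys_def)
qed

text \<open>Direct sums of decompositions are indexed by a sum type. Returning to natural numbers
  lets an induction state the existence of a decomposition at a fixed type.\<close>

lemma has_sys_nat_index:
  assumes "has_sys n Q V (K :: 'i set) t \<iota> \<pi>"
  shows "\<exists>(L :: nat set) u \<kappa> \<rho>. has_sys n Q V L u \<kappa> \<rho>"
proof -
  have "finite K" using assms by (simp add: has_sys_def)
  then obtain f :: "nat \<Rightarrow> 'i" where "bij_betw f {0..<card K} K"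
    using ex_bij_betw_nat_finite by blast
  then show ?thesis using has_sys_reindex[OF assms] by blast
qed

lemma has_sys_iv:
  assumes "s \<in> segments n"
  shows "has_sys n Q (iv Q s) {()} (\<lambda>_. s) (\<lambda>_. idf Q (iv Q s)) (\<lambda>_. idf Q (iv Q s))"
  using assms by (auto simp: has_sys_def retract_def fhom_idf[OF wf is_rep_iv])

end

section \<open>Every representation is a direct sum of intervals\<close>

lemma sum_family_apply: "(\<Sum>i\<in>K. F i) v = (\<Sum>i\<in>K. F i v :: 'b::comm_monoid_add)"
  by (induction K rule: infinite_finite_induct) auto

lemma ent_mult_shift_down [simp]:
  "ent (A * shift_down d e) i j = (if j < e then ent A i (d + j) else 0)"
proof -
  obtain N where N: "\<And>i j. N \<le> i \<or> N \<le> j \<Longrightarrow> ent A i j = 0"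
    using ent_bounded by blast
  have "ent (A * shift_down d e) i j = (\<Sum>k<N. ent A i k * ent (shift_down d e) k j)"
    by (rule ent_times_bounded) (use N in auto)
  also have "\<dots> = (\<Sum>k<N. if k = d + j then if j < e then ent A i k else 0 else 0)"
    by (rule sum.cong) (auto simp: ent_shift_down)
  finally show ?thesis using N[of i "d + j"] by (auto simp: not_less)
qed

section \<open>Splitting off a retract, with coordinates on the complement\<close>

lemma row_right_inverse:
  assumes "fcar 1 d \<phi>" "\<phi> \<noteq> 0" shows "\<exists>x. fcar d 1 x \<and> \<phi> * x = idm 1"
proof -
  obtain r i where ri: "ent \<phi> r i \<noteq> 0" using assms(2) by (auto simp: fmat_eq_iff)
  with assms(1) have "r = 0" "i < d" by (auto simp: fcar_ent_iff) (metis One_nat_def less_one not_le, metis not_le)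
  let ?x = "sm (inverse (ent \<phi> 0 i)) (shift_down i 1)"
  have "fcar d 1 ?x" using \<open>i < d\<close> by (auto simp: fcar_ent_iff ent_shift_down)
  moreover have "\<phi> * ?x = idm 1"
    using ri \<open>r = 0\<close> assms(1) by (auto simp: sm_mult_right fmat_eq_iff ent_idm fcar_ent_iff)
  ultimately show ?thesis by blast
qed

lemma column_left_inverse:
  assumes "fcar d 1 \<phi>" "\<phi> \<noteq> 0" shows "\<exists>y. fcar 1 d y \<and> y * \<phi> = idm 1"
proof -
  obtain i r where ri: "ent \<phi> i r \<noteq> 0" using assms(2) by (auto simp: fmat_eq_iff)
  with assms(1) have "r = 0" "i < d" by (auto simp: fcar_ent_iff) (metis One_nat_def less_one not_le, metis not_le)
  let ?y = "sm (inverse (ent \<phi> i 0)) (shift_up i 1)"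
  have "fcar 1 d ?y" using \<open>i < d\<close> by (auto simp: fcar_ent_iff ent_shift_up)
  moreover have "?y * \<phi> = idm 1"
    using ri \<open>r = 0\<close> assms(1) by (auto simp: sm_mult_left fmat_eq_iff ent_idm fcar_ent_iff)
  ultimately show ?thesis by blast
qed

text \<open>Deletes the coordinate i out of d; \<open>insert_row\<close> puts a zero back in its
  place. Kernels of row vectors receive coordinates in this way, since representations consist of
  coordinate spaces.\<close>

lift_definition drop_row :: "nat \<Rightarrow> nat \<Rightarrow> 'k::field fmat" is
  "\<lambda>d i r c. if r < d - 1 \<and> c = (if r < i then r else r + 1) then 1 else 0"
  by (rule_tac x = "nat1" in exI) auto

lift_definition insert_row :: "nat \<Rightarrow> nat \<Rightarrow> 'k::field fmat" is
  "\<lambda>d i r c. if c < d - 1 \<and> r = (if c < i then c else c + 1) then 1 else 0"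
  by (rule_tac x = "nat1" in exI) auto

lemma ent_drop_row_mult:
  "ent (drop_row d i * A) r c = (if r < d - 1 then ent A (if r < i then r else r + 1) c else 0)"
proof -
  let ?s = "if r < i then r else r + 1"
  have "ent (drop_row d i * A) r c = (\<Sum>k<d. ent (drop_row d i) r k * ent A k c)"
    by (rule ent_times_bounded) (auto simp: drop_row.rep_eq)
  also have "\<dots> = (\<Sum>k<d. if k = ?s then if r < d - 1 then ent A k c else 0 else 0)"
    by (rule sum.cong) (auto simp: drop_row.rep_eq)
  finally show ?thesis by auto
qed

lemma ent_mult_drop_row:
  assumes "i < d"
  shows "ent (A * drop_row d i) r c =
    (if c < d \<and> c \<noteq> i then ent A r (if c < i then c else c - 1) else 0)"
proof -
  let ?s = "if c < i then c else c - 1"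
  obtain N where N: "\<And>i j. N \<le> i \<or> N \<le> j \<Longrightarrow> ent A i j = 0"
    using ent_bounded by blast
  have "ent (A * drop_row d i) r c = (\<Sum>k<N. ent A r k * ent (drop_row d i) k c)"
    by (rule ent_times_bounded) (use N in auto)
  also have "\<dots> = (\<Sum>k<N. if k = ?s then if c < d \<and> c \<noteq> i then ent A r k else 0 else 0)"
    using assms by (intro sum.cong) (auto simp: drop_row.rep_eq)
  finally show ?thesis using N[of r ?s] by (auto simp: not_less)
qed

lemma complement_coordinates:
  assumes x: "fcar d 1 x" and y: "fcar 1 d y" and yx: "y * x = idm 1"
  shows "\<exists>\<kappa> \<rho>. fcar d (d - 1) \<kappa> \<and> fcar (d - 1) d \<rho> \<and> \<rho> * \<kappa> = idm (d - 1) \<and> \<kappa> * \<rho> = idm d - x * y"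
proof -
  have "y \<noteq> 0" using yx by auto
  then obtain r i where ri: "ent y r i \<noteq> 0" by (auto simp: fmat_eq_iff)
  with y have "r = 0" and i: "i < d" by (auto simp: fcar_ent_iff) (metis One_nat_def less_one not_le, metis not_le)
  with ri have ne: "ent y 0 i \<noteq> 0" by simp
  let ?I = "idm d" and ?D = "drop_row d i" and ?T = "insert_row d i"
  \<comment> \<open>The multiple of the i-th unit vector on which y takes the value 1; dropping the
    coordinate i kills it.\<close>
  define e where "e = sm (inverse (ent y 0 i)) (shift_down i 1)"
  have ye: "y * e = idm 1"
    unfolding e_def using ne y by (auto simp: sm_mult_right fmat_eq_iff ent_idm fcar_ent_iff)
  have e: "?I * e = e" "e * idm 1 = e" using i by (auto simp: e_def fmat_eq_iff ent_shift_down)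
  have De: "?D * e = 0"
    by (auto simp: e_def fmat_eq_iff ent_drop_row_mult ent_shift_down)
  have DT: "?D * ?T = idm (d - 1)"
    by (auto simp: fmat_eq_iff ent_drop_row_mult insert_row.rep_eq ent_idm)
  define u where "u = (shift_up i 1 :: 'a fmat)"
  have TD: "?T * ?D = ?I - sm (ent y 0 i) (e * u)"
    using i ne by (auto simp: fmat_eq_iff ent_mult_drop_row insert_row.rep_eq ent_idm e_def u_def ent_shift_down)
  have D: "?D * ?I = ?D" "idm (d - 1) * ?D = ?D" "?I * ?T = ?T" "?T * idm (d - 1) = ?T"
    by (auto simp: fmat_eq_iff drop_row.rep_eq insert_row.rep_eq)
  have xy: "?I * x = x" "y * ?I = y" "x * idm 1 = x" "idm 1 * y = y" using x y by (auto simp: fcar_def)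
  note E = D[unfolded One_nat_def] xy[unfolded One_nat_def] e[unfolded One_nat_def] De DT[unfolded One_nat_def]
    TD ye[unfolded One_nat_def] yx[unfolded One_nat_def]
  have E_assoc: "?D * (e * X) = 0" "?D * (?T * X) = idm (d - 1) * X" "?I * (e * X) = e * X" "y * (e * X) = idm 1 * X"
    "y * (x * X) = idm 1 * X" "e * (idm 1 * X) = e * X" "idm 1 * (y * X) = y * X" "?I * (?T * X) = ?T * X"
    "?T * (?D * X) = (?I - sm (ent y 0 i) (e * u)) * X" "?I * (x * X) = x * X" for X
    by (simp_all add: E flip: mult.assoc)
  note E' = E_assoc[unfolded One_nat_def]
  \<comment> \<open>\<open>?k\<close> is \<open>(1 - e * y) * ?T\<close>: insert a zero at i, then
    move along e into the kernel of y. \<open>?r\<close> is \<open>?D * (1 - x * y)\<close>: project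
    to the kernel of y along x, then forget the coordinate i, which is determined by the others
    because y is nonzero there.\<close>
  let ?k = "?T - e * (y * ?T)" and ?r = "?D - ?D * (x * y)"
  have "fcar d (d - 1) ?k" "fcar (d - 1) d ?r"
    unfolding fcar_def by (simp_all add: right_diff_distrib left_diff_distrib E' mult.assoc E)
      (simp_all add: E flip: mult.assoc)
  moreover have "?r * ?k = idm (d - 1)"
    by (simp add: right_diff_distrib left_diff_distrib E' mult.assoc E)
  moreover have "?k * ?r = ?I - x * y"
  proof -
    have r: "?r = ?D * (?I - x * y)" by (simp add: right_diff_distrib E)
    have "?k * ?r = (?T * ?D - e * (y * (?T * ?D))) * (?I - x * y)"
      unfolding r by (simp only: left_diff_distrib mult.assoc)
    also have "?T * ?D - e * (y * (?T * ?D)) = ?I - e * y"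
      by (simp add: right_diff_distrib left_diff_distrib E E' sm_mult_right mult.assoc)
    finally show ?thesis
      by (simp add: right_diff_distrib left_diff_distrib E E' mult.assoc)
  qed
  ultimately show ?thesis by blast
qed

context type_A
begin

text \<open>The complement is the kernel of y. It is given coordinates separately at each vertex,
  and the arrows act on it by restricting V along \<kappa> and \<rho>; that these commute with the
  arrows is then a consequence of \<open>y * \<kappa> = 0\<close> and
  \<open>\<rho> * x = 0\<close>.\<close>

lemma split_retract:
  fixes V :: "(nat, 'a, 'k::field) qrep"
  assumes V: "is_rep Q V" and s: "s \<in> segments n" and xy: "retract Q V s x y"
  shows "\<exists>C. is_rep Q C \<and> fiso Q V (dsum (iv Q s) C) \<and>
    (\<forall>v\<in>verts Q. vdim V v = vdim C v + (if v \<in> ivl s then 1 else 0))"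
proof -
  have x: "fhom Q (iv Q s) V x" and y: "fhom Q V (iv Q s) y" and yx: "y * x = idf Q (iv Q s)"
    using xy by (auto simp: retract_def)
  have yxv: "y v * x v = (if v \<in> ivl s then idm 1 else 0)" for v
    using yx by (auto simp: fun_eq_iff idf_iv_seg[OF s] ind_def)
  \<comment> \<open>The truncated subtraction is a genuine one: \<open>y * x\<close> is the identity
    on the interval, so V is nonzero there, as the end of the proof shows.\<close>
  define c where "c v = vdim V v - (if v \<in> ivl s then 1 else 0)" for v
  have "\<exists>\<kappa> \<rho>. (if v \<in> verts Q then fcar (vdim V v) (c v) \<kappa> \<and> fcar (c v) (vdim V v) \<rho> \<and>
      \<rho> * \<kappa> = idm (c v) \<and> \<kappa> * \<rho> = idm (vdim V v) - x v * y v else \<kappa> = 0 \<and> \<rho> = 0)" for v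
  proof (cases "v \<in> verts Q")
    case v: True
    show ?thesis
    proof (cases "v \<in> ivl s")
      case True
      then have "fcar (vdim V v) 1 (x v)" "fcar 1 (vdim V v) (y v)" "y v * x v = idm 1"
        using fhom_fsup[OF x, unfolded fsup_iff, rule_format, of v]
          fhom_fsup[OF y, unfolded fsup_iff, rule_format, of v] v yxv[of v] by (auto simp: vdim_iv)
      from complement_coordinates[OF this] show ?thesis using v True by (simp add: c_def)
    next
      case False
      then have "x v = 0"
        using fhom_fsup[OF x, unfolded fsup_iff, rule_format, of v] fcar_trivial[of "vdim V v" 0 "x v"] v
        by (auto simp: vdim_iv)
      then show ?thesis using v False fcar_idm by (intro exI[of _ "idm (vdim V v)"]) (simp add: c_def)
    qed
  qed auto
  then obtain \<kappa> \<rho> where \<kappa>\<rho>: "\<And>v. if v \<in> verts Q then fcar (vdim V v) (c v) (\<kappa> v) \<and> fcar (c v) (vdim V v) (\<rho> v) \<and>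
      \<rho> v * \<kappa> v = idm (c v) \<and> \<kappa> v * \<rho> v = idm (vdim V v) - x v * y v else \<kappa> v = 0 \<and> \<rho> v = 0"
    by metis
  define C where "C = \<lparr>vdim = c, amap = (\<lambda>a. mat_of (c (head Q a)) (c (tail Q a)) (\<rho> (head Q a) * mm V a * \<kappa> (tail Q a)))\<rparr>"
  have C: "is_rep Q C" and dC: "vdim C = c" by (auto simp: C_def is_rep_def)
  have ht: "head Q a \<in> verts Q \<and> tail Q a \<in> verts Q" if "a \<in> arcs Q" for a
    using wf that by (simp add: wf_digraph_def)
  have mC: "mm C a = \<rho> (head Q a) * mm V a * \<kappa> (tail Q a)" if a: "a \<in> arcs Q" for a
  proof -
    have "fcar (c (head Q a)) (c (tail Q a)) (\<rho> (head Q a) * mm V a * \<kappa> (tail Q a))"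
      using \<kappa>\<rho>[of "head Q a"] \<kappa>\<rho>[of "tail Q a"] fcar_mm[OF V a] ht[OF a] fcar_mult by metis
    moreover have "amap C a = mat_of (c (head Q a)) (c (tail Q a)) (\<rho> (head Q a) * mm V a * \<kappa> (tail Q a))"
      by (simp add: C_def)
    ultimately show ?thesis unfolding mm_def[of C] by (simp only: fm_of_mat_of)
  qed
  have sup: "fsup Q C V \<kappa>" "fsup Q V C \<rho>"
    using \<kappa>\<rho> by (auto simp: fsup_iff dC)
  have rk: "\<rho> * \<kappa> = idf Q C" and kr: "\<kappa> * \<rho> = idf Q V - x * y"
  proof -
    have "x v * y v = 0" if "v \<notin> verts Q" for v
      using fhom_fsup[OF x, unfolded fsup_iff, rule_format, of v] that by simp
    then show "\<rho> * \<kappa> = idf Q C" "\<kappa> * \<rho> = idf Q V - x * y"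
      using \<kappa>\<rho> by (auto simp: fun_eq_iff idf_def dC)
  qed
  have yk: "y * \<kappa> = 0"
  proof -
    have "y * \<kappa> = y * (\<kappa> * (\<rho> * \<kappa>))" using fsup_right[OF sup(1)] rk by simp
    also have "\<dots> = y * (\<kappa> * \<rho>) * \<kappa>" by (simp add: mult.assoc)
    also have "y * (\<kappa> * \<rho>) = y * idf Q V - (y * x) * y" by (simp add: kr right_diff_distrib mult.assoc)
    also have "\<dots> = 0" using fhom_right[OF y] fhom_left[OF y] by (simp add: yx)
    finally show ?thesis by (simp only: mult_zero_left)
  qed
  have rx: "\<rho> * x = 0"
  proof -
    have "\<rho> * x = \<rho> * \<kappa> * \<rho> * x" using fsup_left[OF sup(2)] rk by simp
    also have "\<dots> = \<rho> * ((\<kappa> * \<rho>) * x)" by (simp add: mult.assoc)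
    also have "(\<kappa> * \<rho>) * x = idf Q V * x - x * (y * x)" by (simp add: kr left_diff_distrib mult.assoc)
    also have "\<dots> = 0" using fhom_right[OF x] fhom_left[OF x] by (simp add: yx)
    finally show ?thesis by (simp only: mult_zero_right)
  qed
  have yk': "y v * \<kappa> v = 0" and rx': "\<rho> v * x v = 0" for v
    using yk rx by (auto simp: fun_eq_iff)
  have kr': "\<kappa> v * \<rho> v = idf Q V v - x v * y v" for v
    using kr by (auto simp: fun_eq_iff)
  \<comment> \<open>\<open>\<kappa> * \<rho>\<close> differs from the identity by
    \<open>x * y\<close>. Moving y past the arrow brings it next to \<kappa>, where the extra term
    dies.\<close>
  have k: "fhom Q C V \<kappa>"
    unfolding fhom_def
  proof (intro conjI ballI sup)
    fix a assume a: "a \<in> arcs Q"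
    let ?h = "head Q a" and ?t = "tail Q a"
    have "\<kappa> ?h * mm C a = (\<kappa> ?h * \<rho> ?h) * mm V a * \<kappa> ?t" by (simp add: mC[OF a] mult.assoc)
    also have "\<dots> = mm V a * \<kappa> ?t - x ?h * ((y ?h * mm V a) * \<kappa> ?t)"
      unfolding kr' by (simp add: left_diff_distrib idf_mm[OF wf V a] mult.assoc)
    also have "y ?h * mm V a = mm (iv Q s) a * y ?t" using y a by (simp add: fhom_def)
    finally show "\<kappa> ?h * mm C a = mm V a * \<kappa> ?t" by (simp add: mult.assoc yk')
  qed
  have r: "fhom Q V C \<rho>"
    unfolding fhom_def
  proof (intro conjI ballI sup)
    fix a assume a: "a \<in> arcs Q"
    let ?h = "head Q a" and ?t = "tail Q a"
    have "mm C a * \<rho> ?t = \<rho> ?h * (mm V a * (\<kappa> ?t * \<rho> ?t))" by (simp add: mC[OF a] mult.assoc)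
    also have "\<dots> = \<rho> ?h * mm V a - \<rho> ?h * (mm V a * x ?t) * y ?t"
      unfolding kr' by (simp add: right_diff_distrib idf_mm[OF wf V a] mult.assoc)
    also have "mm V a * x ?t = x ?h * mm (iv Q s) a" using x a by (simp add: fhom_def)
    also have "\<rho> ?h * (x ?h * mm (iv Q s) a) = 0" by (simp add: rx' flip: mult.assoc)
    finally show "\<rho> ?h * mm V a = mm C a * \<rho> ?t" by simp
  qed
  note B = biproduct_fhom[OF wf is_rep_iv C, of s] and e = biproduct_equations[of Q "iv Q s :: (nat, 'a, 'k) qrep" C]
  let ?F = "inl Q (iv Q s) C * y + inr Q (iv Q s) C * \<rho>" and ?G = "x * prl Q (iv Q s) C + \<kappa> * prr Q (iv Q s) C"
  have a: "A * P * (I * D) = A * (P * I) * D" for A P I D :: "nat \<Rightarrow> 'k fmat"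
    by (simp add: mult.assoc)
  have "?G * ?F = x * y + \<kappa> * \<rho>"
    by (simp add: distrib_left distrib_right a e fhom_right[OF x] fsup_right[OF sup(1)])
  then have GF: "?G * ?F = idf Q V" by (simp add: kr)
  have FG: "?F * ?G = idf Q (dsum (iv Q s) C)"
    by (simp add: distrib_left distrib_right a yk rx yx rk fhom_right[OF B(1)] fhom_right[OF B(3)] e)
  have "fhom Q V (dsum (iv Q s) C) ?F" "fhom Q (dsum (iv Q s) C) V ?G"
    using B x y k r by (auto intro!: fhom_add intro: fhom_mult)
  with GF FG have "fiso Q V (dsum (iv Q s) C)" unfolding fiso_def by blast
  moreover have "vdim V v = vdim C v + (if v \<in> ivl s then 1 else 0)" if "v \<in> verts Q" for v
  proof -
    have "vdim V v \<noteq> 0" if "v \<in> ivl s"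
    proof
      assume "vdim V v = 0"
      then have "x v = 0"
        using fhom_fsup[OF x, unfolded fsup_iff vdim_iv, rule_format, of v] \<open>v \<in> verts Q\<close> that
        by (intro fcar_trivial[of 0 1]) auto
      then show False using yxv[of v] that by simp
    qed
    then show ?thesis by (auto simp: dC c_def)
  qed
  ultimately show ?thesis using C by blast
qed

section \<open>Extending a decomposition by one more vertex\<close>

lemma no_opposite_arcs:
  assumes "a \<in> arcs Q" "b \<in> arcs Q" "tail Q a = head Q b" "head Q a = tail Q b" shows False
  by (rule arc_cases[OF assms(1)]; rule arc_cases[OF assms(2)]; use assms(3,4) in auto)

text \<open>The restriction is extended by zero so that it remains a representation of the same
  quiver; an induction over subquivers is thereby avoided.\<close>

definition trunc :: "nat \<Rightarrow> (nat, 'a, 'k::field) qrep \<Rightarrow> (nat, 'a, 'k) qrep" where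
  "trunc k V = \<lparr>vdim = (\<lambda>v. if v \<le> k then 0 else vdim V v),
     amap = (\<lambda>a. if tail Q a \<le> k \<or> head Q a \<le> k
       then 0\<^sub>m (if head Q a \<le> k then 0 else vdim V (head Q a)) (if tail Q a \<le> k then 0 else vdim V (tail Q a))
       else amap V a)\<rparr>"

lemma vdim_trunc: "vdim (trunc k V) v = (if v \<le> k then 0 else vdim V v)"
  by (simp add: trunc_def)

lemma mm_trunc: "mm (trunc k V) a = (if tail Q a \<le> k \<or> head Q a \<le> k then 0 else mm V a)"
  by (auto simp: trunc_def mm_def fmat_eq_iff ent_fm_of)

lemma is_rep_trunc: "is_rep Q V \<Longrightarrow> is_rep Q (trunc k V)"
  by (auto simp: is_rep_def trunc_def)

lemma mm_below:
  assumes "is_rep Q V" "\<forall>v\<in>verts Q. v < k \<longrightarrow> vdim V v = 0" "a \<in> arcs Q" "tail Q a < k \<or> head Q a < k"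
  shows "mm V a = 0"
  using fcar_trivial[OF fcar_mm[OF assms(1,3)]] assms wf by (auto simp: wf_digraph_def)

lemma trunc_entry:
  assumes "fsup Q (iv Q s) (trunc k V) F"
  shows "v \<le> k \<Longrightarrow> F v = 0" "v \<notin> ivl s \<Longrightarrow> F v = 0" "F v * idm 1 = F v"
    "v \<in> verts Q \<Longrightarrow> fcar (vdim V v) (if v \<in> ivl s then 1 else 0) (F v)"
proof -
  have *: "if v \<in> verts Q then fcar (vdim (trunc k V) v) (if v \<in> ivl s then 1 else 0) (F v) else F v = 0"
    using assms[unfolded fsup_iff vdim_iv, rule_format, of v] by simp
  then show 1: "v \<le> k \<Longrightarrow> F v = 0" and 2: "v \<notin> ivl s \<Longrightarrow> F v = 0"
    using fcar_trivial[of "vdim (trunc k V) v" "if v \<in> ivl s then 1 else 0" "F v"]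
    by (auto simp: vdim_trunc vdim_iv split: if_splits)
  show "F v * idm 1 = F v" using * 2 by (cases "v \<in> ivl s") (auto simp: vdim_iv fcar_def split: if_splits)
  show "v \<in> verts Q \<Longrightarrow> fcar (vdim V v) (if v \<in> ivl s then 1 else 0) (F v)"
    using * 1 by (cases "v \<le> k") (auto simp: vdim_trunc)
qed

lemma trunc_entry':
  assumes "fsup Q (trunc k V) (iv Q s) F"
  shows "v \<le> k \<Longrightarrow> F v = 0" "v \<notin> ivl s \<Longrightarrow> F v = 0" "idm 1 * F v = F v"
    "v \<in> verts Q \<Longrightarrow> fcar (if v \<in> ivl s then 1 else 0) (vdim V v) (F v)"
proof -
  have *: "if v \<in> verts Q then fcar (if v \<in> ivl s then 1 else 0) (vdim (trunc k V) v) (F v) else F v = 0"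
    using assms[unfolded fsup_iff vdim_iv, rule_format, of v] by simp
  then show 1: "v \<le> k \<Longrightarrow> F v = 0" and 2: "v \<notin> ivl s \<Longrightarrow> F v = 0"
    using fcar_trivial[of "if v \<in> ivl s then 1 else 0" "vdim (trunc k V) v" "F v"]
    by (auto simp: vdim_trunc vdim_iv split: if_splits)
  show "idm 1 * F v = F v" using * 2 by (cases "v \<in> ivl s") (auto simp: vdim_iv fcar_def split: if_splits)
  show "v \<in> verts Q \<Longrightarrow> fcar (if v \<in> ivl s then 1 else 0) (vdim V v) (F v)"
    using * 1 by (cases "v \<le> k") (auto simp: vdim_trunc)
qed

text \<open>Let \<open>V\<close> vanish at the vertices before \<open>k\<close>, and decompose its truncation to the vertices after
  \<open>k\<close> into intervals. A summand that does not contain \<open>k + 1\<close> is a summand of \<open>V\<close>. Otherwise all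
  summands start at \<open>k + 1\<close>, and \<open>pos\<close> below totally orders them by the existence of a nonzero
  morphism. Among the summands on which the arrow between \<open>k\<close> and \<open>k + 1\<close> does not vanish, the first
  or the last one in this order can be enlarged by \<open>k\<close> to a summand of \<open>V\<close>.\<close>

context
  fixes V :: "(nat, 'a, 'k::field) qrep" and k :: nat
  assumes V: "is_rep Q V" and below: "\<forall>v\<in>verts Q. v < k \<longrightarrow> vdim V v = 0" and k: "1 \<le> k" "k \<le> n + 2"
begin

text \<open>Only the arrow between k and k + 1 ties the column X to the rest. The case
  \<open>b = k\<close> is allowed: the interval \<open>(k, k)\<close> is empty and the glued one
  consists of k alone. Then an arrow into k imposes nothing, whence the condition
  \<open>k < b\<close>, while an arrow out of k has to kill X, as \<open>x (k + 1)\<close> is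
  zero.\<close>

lemma glue_in:
  assumes b: "k \<le> b" "b \<le> n + 2" and x: "fhom Q (iv Q (k, b)) (trunc k V) x" and X: "fcar (vdim V k) 1 X"
    and u: "\<And>a. a \<in> arcs Q \<Longrightarrow> tail Q a = k \<Longrightarrow> head Q a = k + 1 \<Longrightarrow> x (k + 1) = mm V a * X"
    and d: "\<And>a. a \<in> arcs Q \<Longrightarrow> tail Q a = k + 1 \<Longrightarrow> head Q a = k \<Longrightarrow> k < b \<Longrightarrow> X = mm V a * x (k + 1)"
  shows "fhom Q (iv Q (k - 1, b)) V (x(k := X))"
  unfolding fhom_def
proof (intro conjI ballI)
  note E = trunc_entry[OF fhom_fsup[OF x]]
  have out: "x v = 0" if "v \<notin> verts Q" for v
    using fhom_fsup[OF x] that by (auto simp: fsup_iff)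
  show "fsup Q (iv Q (k - 1, b)) V (x(k := X))"
    unfolding fsup_iff
  proof
    fix v
    consider "v \<notin> verts Q" | "v = k" | "v \<in> verts Q" "v < k" | "v \<in> verts Q" "k < v" by linarith
    then show "if v \<in> verts Q then fcar (vdim V v) (vdim (iv Q (k - 1, b)) v) ((x(k := X)) v) else (x(k := X)) v = 0"
    proof cases
      case 1 then show ?thesis using k out[of v] by (auto simp: verts)
    next
      case 2 then show ?thesis using k X b by (auto simp: verts vdim_iv ivl_def)
    next
      case 3 then show ?thesis using E(1)[of v] by simp
    next
      case 4 then show ?thesis using E(4)[of v] by (simp add: vdim_iv ivl_def less_imp_diff_less)
    qed
  qed
  fix a assume a: "a \<in> arcs Q"
  have hom: "x (head Q a) * mm (iv Q (k, b)) a = mm (trunc k V) a * x (tail Q a)"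
    using x a by (simp add: fhom_def)
  have low: "mm V a = 0" "mm (iv Q (k - 1, b)) a = 0" if "tail Q a < k \<or> head Q a < k"
    using mm_below[OF V below a that] that k by (auto simp: mm_iv ivl_def)
  from a show "(x(k := X)) (head Q a) * mm (iv Q (k - 1, b)) a = mm V a * (x(k := X)) (tail Q a)"
  proof (cases rule: arc_cases)
    case (1 i)
    consider "i < k" | "i = k" | "k < i" by linarith
    then show ?thesis
    proof cases
      case 1: 1
      then have "tail Q a < k \<or> head Q a < k" using \<open>tail Q a = i\<close> by simp
      then show ?thesis by (simp add: low[unfolded One_nat_def])
    next
      case 2: 2
      then show ?thesis using u[OF a] 1 E(2,3)[of "k + 1"] b k by (auto simp: mm_iv ivl_def)
    next
      case 3: 3 then show ?thesis using hom 1 by (auto simp: mm_iv mm_trunc ivl_def)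
    qed
  next
    case (2 i)
    consider "i < k" | "i = k" | "k < i" by linarith
    then show ?thesis
    proof cases
      case 1: 1
      then have "tail Q a < k \<or> head Q a < k" using \<open>head Q a = i\<close> by simp
      then show ?thesis by (simp add: low[unfolded One_nat_def])
    next
      case two: 2
      have "X * idm 1 = X" using X by (simp add: fcar_def)
      then show ?thesis using d[OF a] 2 two E(2)[of "k + 1"] b k by (auto simp: mm_iv ivl_def)
    next
      case 3: 3 then show ?thesis using hom 2 by (auto simp: mm_iv mm_trunc ivl_def)
    qed
  qed
qed

text \<open>Dual to \<open>glue_in\<close>: for morphisms into the interval, the two directions of
  the arrow between k and k + 1 exchange their roles.\<close>

lemma glue_out:
  assumes b: "k \<le> b" "b \<le> n + 2" and y: "fhom Q (trunc k V) (iv Q (k, b)) y" and Y: "fcar 1 (vdim V k) Y"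
    and u: "\<And>a. a \<in> arcs Q \<Longrightarrow> tail Q a = k \<Longrightarrow> head Q a = k + 1 \<Longrightarrow> k < b \<Longrightarrow> Y = y (k + 1) * mm V a"
    and d: "\<And>a. a \<in> arcs Q \<Longrightarrow> tail Q a = k + 1 \<Longrightarrow> head Q a = k \<Longrightarrow> y (k + 1) = Y * mm V a"
  shows "fhom Q V (iv Q (k - 1, b)) (y(k := Y))"
  unfolding fhom_def
proof (intro conjI ballI)
  note E = trunc_entry'[OF fhom_fsup[OF y]]
  have out: "y v = 0" if "v \<notin> verts Q" for v
    using fhom_fsup[OF y] that by (auto simp: fsup_iff)
  show "fsup Q V (iv Q (k - 1, b)) (y(k := Y))"
    unfolding fsup_iff
  proof
    fix v
    consider "v \<notin> verts Q" | "v = k" | "v \<in> verts Q" "v < k" | "v \<in> verts Q" "k < v" by linarith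
    then show "if v \<in> verts Q then fcar (vdim (iv Q (k - 1, b)) v) (vdim V v) ((y(k := Y)) v) else (y(k := Y)) v = 0"
    proof cases
      case 1 then show ?thesis using k out[of v] by (auto simp: verts)
    next
      case 2 then show ?thesis using k Y b by (auto simp: verts vdim_iv ivl_def)
    next
      case 3 then show ?thesis using E(1)[of v] by simp
    next
      case 4 then show ?thesis using E(4)[of v] by (simp add: vdim_iv ivl_def less_imp_diff_less)
    qed
  qed
  fix a assume a: "a \<in> arcs Q"
  have hom: "y (head Q a) * mm (trunc k V) a = mm (iv Q (k, b)) a * y (tail Q a)"
    using y a by (simp add: fhom_def)
  have low: "mm V a = 0" "mm (iv Q (k - 1, b)) a = 0" if "tail Q a < k \<or> head Q a < k"
    using mm_below[OF V below a that] that k by (auto simp: mm_iv ivl_def)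
  from a show "(y(k := Y)) (head Q a) * mm V a = mm (iv Q (k - 1, b)) a * (y(k := Y)) (tail Q a)"
  proof (cases rule: arc_cases)
    case (1 i)
    consider "i < k" | "i = k" | "k < i" by linarith
    then show ?thesis
    proof cases
      case 1: 1
      then have "tail Q a < k \<or> head Q a < k" using \<open>tail Q a = i\<close> by simp
      then show ?thesis by (simp add: low[unfolded One_nat_def])
    next
      case 2: 2
      have "idm 1 * Y = Y" using Y by (simp add: fcar_def)
      then show ?thesis using u[OF a] 1 2 E(2)[of "k + 1"] b k by (auto simp: mm_iv ivl_def)
    next
      case 3: 3 then show ?thesis using hom 1 by (auto simp: mm_iv mm_trunc ivl_def)
    qed
  next
    case (2 i)
    consider "i < k" | "i = k" | "k < i" by linarith
    then show ?thesis
    proof cases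
      case 1: 1
      then have "tail Q a < k \<or> head Q a < k" using \<open>head Q a = i\<close> by simp
      then show ?thesis by (simp add: low[unfolded One_nat_def])
    next
      case two: 2
      then show ?thesis using d[OF a] 2 E(2,3)[of "k + 1"] b k by (auto simp: mm_iv ivl_def)
    next
      case 3: 3 then show ?thesis using hom 2 by (auto simp: mm_iv mm_trunc ivl_def)
    qed
  qed
qed

text \<open>Both maps vanish at all vertices up to k + 1, so the arrows that truncation changes
  impose nothing on them.\<close>

lemma trunc_retract:
  assumes xy: "retract Q (trunc k V) s x y" and ks: "k + 1 \<notin> ivl s"
  shows "retract Q V s x y"
proof -
  have x: "fhom Q (iv Q s) (trunc k V) x" and y: "fhom Q (trunc k V) (iv Q s) y" and yx: "y * x = idf Q (iv Q s)"
    using xy by (auto simp: retract_def)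
  note E = trunc_entry[OF fhom_fsup[OF x]] and E' = trunc_entry'[OF fhom_fsup[OF y]]
  have out: "x v = 0" "y v = 0" if "v \<notin> verts Q" for v
    using fhom_fsup[OF x] fhom_fsup[OF y] that by (auto simp: fsup_iff)
  have "if v \<in> verts Q then fcar (vdim V v) (if v \<in> ivl s then 1 else 0) (x v) else x v = 0"
    "if v \<in> verts Q then fcar (if v \<in> ivl s then 1 else 0) (vdim V v) (y v) else y v = 0" for v
    using E(4)[of v] E'(4)[of v] out[of v] by presburger+
  then have "fsup Q (iv Q s) V x" "fsup Q V (iv Q s) y"
    unfolding fsup_iff vdim_iv by blast+
  moreover have "x (head Q a) * mm (iv Q s) a = mm V a * x (tail Q a)"
    "y (head Q a) * mm V a = mm (iv Q s) a * y (tail Q a)" if a: "a \<in> arcs Q" for a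
  proof -
    have hom: "x (head Q a) * mm (iv Q s) a = mm (trunc k V) a * x (tail Q a)"
      "y (head Q a) * mm (trunc k V) a = mm (iv Q s) a * y (tail Q a)"
      using x y a by (auto simp: fhom_def)
    have z: "x v = 0" "y v = 0" if "v \<le> k + 1" for v
      using E(1)[of v] E(2)[of v] E'(1)[of v] E'(2)[of v] ks that by (cases "v = k + 1", auto)+
    show "x (head Q a) * mm (iv Q s) a = mm V a * x (tail Q a)"
      "y (head Q a) * mm V a = mm (iv Q s) a * y (tail Q a)"
      by (rule arc_cases[OF a]; cases "tail Q a \<le> k \<or> head Q a \<le> k"; use hom z in \<open>auto simp: mm_trunc\<close>)+
  qed
  ultimately show ?thesis using yx by (auto simp: retract_def fhom_def)
qed

definition pos :: "nat \<Rightarrow> nat" where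
  "pos b = (if up b then 2 * (n + 3) - b else b)"

text \<open>The left ends agree, so only the shorter right end matters: the arrow across it must
  enter the overlap if the target is longer, and leave it if the source is. \<open>pos\<close> lists
  the ends b with \<open>\<not> up b\<close> increasingly and then those with \<open>up b\<close>
  decreasingly; its constant puts the latter after all the former, as ends are at most n +
  2.\<close>

lemma overlap_hom_pos:
  assumes "b \<le> n + 2" "b' \<le> n + 2" "pos b \<le> pos b'"
  shows "overlap_hom (k, b) (k, b')"
  unfolding overlap_hom_def
proof
  fix a assume "a \<in> arcs Q"
  then show "tail Q a \<in> ivl (k, b) \<and> head Q a \<in> ivl (k, b) \<and> head Q a \<in> ivl (k, b') \<longleftrightarrow>
     tail Q a \<in> ivl (k, b) \<and> tail Q a \<in> ivl (k, b') \<and> head Q a \<in> ivl (k, b')"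
  proof (cases rule: arc_cases)
    case (1 i)
    have "\<not> (i = b \<and> b < b')" using 1 assms by (auto simp: pos_def split: if_splits)
    then show ?thesis using 1 by (auto simp: ivl_def)
  next
    case (2 i)
    have "\<not> (i = b' \<and> b' < b)" using 2 assms by (auto simp: pos_def split: if_splits)
    then show ?thesis using 2 by (auto simp: ivl_def)
  qed
qed

lemma retract_simple:
  assumes d: "vdim V k \<noteq> 0" and z: "\<And>a. a \<in> arcs Q \<Longrightarrow> tail Q a = k \<or> head Q a = k \<Longrightarrow> mm V a = 0"
  shows "\<exists>s\<in>segments n. \<exists>x y. retract Q V s x y"
proof -
  have d1: "fcar (vdim V k) 1 (idm 1)" "fcar 1 (vdim V k) (idm 1)"
  proof -
    have "min (vdim V k) 1 = 1" "min 1 (vdim V k) = 1" using d by auto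
    then show "fcar (vdim V k) 1 (idm 1)" "fcar 1 (vdim V k) (idm 1)"
      unfolding fcar_def by (simp_all only: idm_mult_idm min.idem)
  qed
  \<comment> \<open>The zero morphism out of the empty interval \<open>(k, k)\<close>, glued with
    the first basis vector at k.\<close>
  have "fhom Q (iv Q (k - 1, k)) V (0(k := idm 1))"
    by (rule glue_in) (use k d1 z fhom_0 in auto)
  moreover have "fhom Q V (iv Q (k - 1, k)) (0(k := idm 1))"
    by (rule glue_out) (use k d1 z fhom_0 in auto)
  moreover have s: "(k - 1, k) \<in> segments n" using k by (auto simp: mem_segments)
  moreover have "(0(k := idm 1) :: nat \<Rightarrow> 'k fmat) * 0(k := idm 1) = idf Q (iv Q (k - 1, k))"
    using k by (auto simp: idf_iv ind_def ivl_def fun_eq_iff)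
  ultimately show ?thesis unfolding retract_def by blast
qed

lemma min_exists: "finite J \<Longrightarrow> J \<noteq> {} \<Longrightarrow> \<exists>p\<in>J. \<forall>j\<in>J. (f p :: nat) \<le> f j"
  by (metis (no_types, lifting) arg_min_if_finite(1) arg_min_least)

lemma max_exists: "finite J \<Longrightarrow> J \<noteq> {} \<Longrightarrow> \<exists>p\<in>J. \<forall>j\<in>J. (f j :: nat) \<le> f p"
  using Max_in[of "f ` J"] Max_ge[of "f ` J"] by fastforce

text \<open>The truncation vanishes up to k, so no summand starts before k + 1. One that starts
  later avoids k + 1, and \<open>trunc_retract\<close> makes it a retract of V.\<close>

lemma trunc_sys_dichotomy:
  assumes sys: "has_sys n Q (trunc k V) K t \<iota> \<pi>"
  shows "(\<exists>s\<in>segments n. \<exists>x y. retract Q V s x y) \<or> (\<forall>i\<in>K. \<exists>b. t i = (k, b) \<and> k < b \<and> b \<le> n + 2)"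
proof (rule disjCI)
  assume no: "\<not> (\<forall>i\<in>K. \<exists>b. t i = (k, b) \<and> k < b \<and> b \<le> n + 2)"
  then obtain i where i: "i \<in> K" "\<not> (\<exists>b. t i = (k, b) \<and> k < b \<and> b \<le> n + 2)" by blast
  obtain a b where ab: "t i = (a, b)" by fastforce
  have s: "(a, b) \<in> segments n" and r: "retract Q (trunc k V) (a, b) (\<iota> i) (\<pi> i)"
    using sys i ab unfolding has_sys_def by metis+
  have x: "fhom Q (iv Q (a, b)) (trunc k V) (\<iota> i)" and yx: "\<pi> i * \<iota> i = idf Q (iv Q (a, b))"
    using r by (auto simp: retract_def)
  have "\<iota> i (a + 1) \<noteq> 0"
  proof
    assume "\<iota> i (a + 1) = 0"
    then have "(\<pi> i * \<iota> i) (a + 1) = 0" by simp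
    then show False unfolding yx using s by (simp add: idf_iv_seg[OF s] ind_def ivl_def mem_segments)
  qed
  then have "k < a + 1" using trunc_entry(1)[OF fhom_fsup[OF x], of "a + 1"] by linarith
  moreover have "a \<noteq> k" using i ab s by (auto simp: mem_segments)
  ultimately have "k + 1 \<notin> ivl (a, b)" by (auto simp: ivl_def)
  with trunc_retract[OF r] s show "\<exists>s\<in>segments n. \<exists>x y. retract Q V s x y" by blast
qed

text \<open>A vector at k has an image with components in several summands. Following it requires
  morphisms from one summand p to all the others that it meets, so p is chosen first in the order
  \<open>pos\<close>. The projection to p extends to k without any choice.\<close>

lemma retract_up:
  assumes sys: "has_sys n Q (trunc k V) K t \<iota> \<pi>"
    and t: "\<forall>i\<in>K. \<exists>b. t i = (k, b) \<and> k < b \<and> b \<le> n + 2"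
    and a: "a \<in> arcs Q" "tail Q a = k" "head Q a = k + 1" and nz: "mm V a \<noteq> 0"
  shows "\<exists>s\<in>segments n. \<exists>x y. retract Q V s x y"
proof -
  let ?\<phi> = "mm V a"
  have k1: "k + 1 \<in> verts Q" "k \<in> verts Q" using a wf by (auto simp: wf_digraph_def)
  have \<phi>: "fcar (vdim V (k + 1)) (vdim V k) ?\<phi>" using fcar_mm[OF V a(1)] a by simp
  have fin: "finite K" and ret: "\<And>i. i \<in> K \<Longrightarrow> retract Q (trunc k V) (t i) (\<iota> i) (\<pi> i)"
    and orth: "\<And>i j. i \<in> K \<Longrightarrow> j \<in> K \<Longrightarrow> i \<noteq> j \<Longrightarrow> \<pi> i * \<iota> j = 0"
    and one: "(\<Sum>i\<in>K. \<iota> i * \<pi> i) = idf Q (trunc k V)"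
    using sys by (auto simp: has_sys_def)
  have hi: "fhom Q (iv Q (t i)) (trunc k V) (\<iota> i)" and hp: "fhom Q (trunc k V) (iv Q (t i)) (\<pi> i)"
    and pi1: "\<pi> i * \<iota> i = idf Q (iv Q (t i))" if "i \<in> K" for i
    using ret[OF that] by (auto simp: retract_def)
  have s1: "(\<Sum>i\<in>K. \<iota> i (k + 1) * \<pi> i (k + 1)) = idm (vdim V (k + 1))"
    using fun_cong[OF one, of "k + 1"] k1 by (simp add: sum_family_apply idf_def vdim_trunc)
  then have expand: "(\<Sum>i\<in>K. \<iota> i (k + 1) * (\<pi> i (k + 1) * X)) = X" if "idm (vdim V (k + 1)) * X = X" for X
  proof -
    have "(\<Sum>i\<in>K. \<iota> i (k + 1) * (\<pi> i (k + 1) * X)) = (\<Sum>i\<in>K. \<iota> i (k + 1) * \<pi> i (k + 1)) * X"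
      by (simp only: sum_distrib_right mult.assoc)
    with s1 that show ?thesis by simp
  qed
  define J where "J = {j \<in> K. \<pi> j (k + 1) * ?\<phi> \<noteq> 0}"
  have "J \<noteq> {}"
  proof
    assume "J = {}"
    then have "(\<Sum>i\<in>K. \<iota> i (k + 1) * (\<pi> i (k + 1) * ?\<phi>)) = 0" by (intro sum.neutral) (auto simp: J_def)
    with expand[of ?\<phi>] \<phi> nz show False by (simp add: fcar_def)
  qed
  moreover have "finite J" using fin by (simp add: J_def)
  ultimately obtain p where p: "p \<in> J" and pmin: "\<forall>j\<in>J. pos (snd (t p)) \<le> pos (snd (t j))"
    using min_exists[of J "\<lambda>j. pos (snd (t j))"] by blast
  have pK: "p \<in> K" using p by (simp add: J_def)
  obtain b where b: "t p = (k, b)" "k < b" "b \<le> n + 2" using t pK by blast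
  have k1t: "k + 1 \<in> ivl (t i)" if "i \<in> K" for i using t that by (force simp: ivl_def)
  have row: "fcar 1 (vdim V k) (\<pi> j (k + 1) * ?\<phi>)" if "j \<in> K" for j
    using fcar_mult[OF trunc_entry'(4)[OF fhom_fsup[OF hp[OF that]] k1(1)] \<phi>] k1t[OF that] by (simp add: vdim_iv)
  obtain X where X: "fcar (vdim V k) 1 X" "\<pi> p (k + 1) * ?\<phi> * X = idm 1"
    using row_right_inverse[OF row[OF pK]] p by (auto simp: J_def)
  define C where "C j = \<pi> j (k + 1) * ?\<phi> * X" for j
  have C: "fcar 1 1 (C j)" if "j \<in> K" for j
    unfolding C_def by (rule fcar_mult[OF row[OF that] X(1)])
  \<comment> \<open>For j outside J the scalar \<open>C j\<close> is zero, so the zero morphism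
    serves there and no morphism between the two intervals has to exist.\<close>
  define \<kappa> where "\<kappa> j = (if j \<in> J then (\<lambda>v. if v \<in> ivl (t p) \<inter> ivl (t j) then C j else 0) else 0)" for j
  have \<kappa>: "fhom Q (iv Q (t p)) (iv Q (t j)) (\<kappa> j)" if jK: "j \<in> K" for j
  proof (cases "j \<in> J")
    case True
    obtain b' where b': "t j = (k, b')" "k < b'" "b' \<le> n + 2" using t jK by blast
    have "overlap_hom (t p) (t j)"
      unfolding b b' by (rule overlap_hom_pos) (use pmin True b b' in auto)
    then have "fhom Q (iv Q (t p)) (iv Q (t j)) (\<lambda>v. if v \<in> ivl (t p) \<inter> ivl (t j) then C j else 0)"
      by (intro fhom_overlap C that) (use b b' in simp_all)
    with True show ?thesis by (simp only: \<kappa>_def if_True)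
  qed (simp add: \<kappa>_def fhom_0)
  define x where "x = (\<Sum>j\<in>K. \<iota> j * \<kappa> j)"
  have x: "fhom Q (iv Q (t p)) (trunc k V) x"
    unfolding x_def by (rule fhom_sum) (rule fhom_mult[OF hi \<kappa>])
  have kc: "\<kappa> j (k + 1) = \<pi> j (k + 1) * (?\<phi> * X)" if "j \<in> K" for j
  proof (cases "j \<in> J")
    case True
    then show ?thesis using k1t[OF that] k1t[OF pK] by (simp add: \<kappa>_def C_def mult.assoc)
  next
    case False
    then have "\<pi> j (k + 1) * ?\<phi> * X = 0" using that by (simp add: J_def)
    with False show ?thesis by (simp add: \<kappa>_def mult.assoc)
  qed
  \<comment> \<open>The scalars \<open>C j\<close> are the components of the image of X under the
    arrow, so that x takes exactly this value at k + 1 and the gluing condition holds.\<close>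
  have xk: "x (k + 1) = ?\<phi> * X"
  proof -
    have "x (k + 1) = (\<Sum>j\<in>K. \<iota> j (k + 1) * (\<pi> j (k + 1) * (?\<phi> * X)))"
      unfolding x_def sum_family_apply
      by (rule sum.cong) (simp_all only: kc times_fun_apply)
    then show ?thesis using expand[of "?\<phi> * X"] \<phi> by (simp add: fcar_def flip: mult.assoc)
  qed
  have same: "a' = a" if "a' \<in> arcs Q" "tail Q a' = k" "head Q a' = k + 1" for a'
    using arc_unique[OF that(1) a(1)] that a by simp
  have noarc: False if "a' \<in> arcs Q" "tail Q a' = k + 1" "head Q a' = k" for a'
    using no_opposite_arcs[of a a'] that a by auto
  have gx: "fhom Q (iv Q (k - 1, b)) V (x(k := X))"
    by (rule glue_in) (use b x X xk in \<open>auto dest: same noarc\<close>)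
  have gy: "fhom Q V (iv Q (k - 1, b)) ((\<pi> p)(k := \<pi> p (k + 1) * ?\<phi>))"
    by (rule glue_out) (use b hp[OF pK] row[OF pK] in \<open>auto dest: same noarc\<close>)
  have s: "(k - 1, b) \<in> segments n" using b k by (auto simp: mem_segments)
  have "\<pi> p * x = (\<Sum>j\<in>K. \<pi> p * \<iota> j * \<kappa> j)" by (simp add: x_def sum_distrib_left mult.assoc)
  also have "\<dots> = (\<Sum>j\<in>K. if j = p then \<kappa> p else 0)"
    by (rule sum.cong) (use orth pK pi1[OF pK] fhom_left[OF \<kappa>[OF pK]] in auto)
  also have "\<dots> = \<kappa> p" using fin pK by simp
  finally have "\<pi> p v * x v = \<kappa> p v" for v by (metis times_fun_apply)
  then have "((\<pi> p)(k := \<pi> p (k + 1) * ?\<phi>)) * (x(k := X)) = idf Q (iv Q (k - 1, b))"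
    using p X k b by (auto simp: fun_eq_iff idf_iv ind_def ivl_def \<kappa>_def C_def)
  with gx gy s show ?thesis unfolding retract_def by blast
qed

text \<open>Dual to \<open>retract_up\<close>: now the inclusion of p extends to k without any
  choice, and the projection has to be corrected by morphisms from the other summands into p. Hence
  p is chosen last in the order \<open>pos\<close>.\<close>

lemma retract_down:
  assumes sys: "has_sys n Q (trunc k V) K t \<iota> \<pi>"
    and t: "\<forall>i\<in>K. \<exists>b. t i = (k, b) \<and> k < b \<and> b \<le> n + 2"
    and a: "a \<in> arcs Q" "tail Q a = k + 1" "head Q a = k" and nz: "mm V a \<noteq> 0"
  shows "\<exists>s\<in>segments n. \<exists>x y. retract Q V s x y"
proof -
  let ?\<phi> = "mm V a"
  have k1: "k + 1 \<in> verts Q" "k \<in> verts Q" using a wf by (auto simp: wf_digraph_def)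
  have \<phi>: "fcar (vdim V k) (vdim V (k + 1)) ?\<phi>" using fcar_mm[OF V a(1)] a by simp
  have fin: "finite K" and ret: "\<And>i. i \<in> K \<Longrightarrow> retract Q (trunc k V) (t i) (\<iota> i) (\<pi> i)"
    and orth: "\<And>i j. i \<in> K \<Longrightarrow> j \<in> K \<Longrightarrow> i \<noteq> j \<Longrightarrow> \<pi> i * \<iota> j = 0"
    and one: "(\<Sum>i\<in>K. \<iota> i * \<pi> i) = idf Q (trunc k V)"
    using sys by (auto simp: has_sys_def)
  have hi: "fhom Q (iv Q (t i)) (trunc k V) (\<iota> i)" and hp: "fhom Q (trunc k V) (iv Q (t i)) (\<pi> i)"
    and pi1: "\<pi> i * \<iota> i = idf Q (iv Q (t i))" if "i \<in> K" for i
    using ret[OF that] by (auto simp: retract_def)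
  have s1: "(\<Sum>i\<in>K. \<iota> i (k + 1) * \<pi> i (k + 1)) = idm (vdim V (k + 1))"
    using fun_cong[OF one, of "k + 1"] k1 by (simp add: sum_family_apply idf_def vdim_trunc)
  then have expand: "(\<Sum>i\<in>K. X * \<iota> i (k + 1) * \<pi> i (k + 1)) = X" if "X * idm (vdim V (k + 1)) = X" for X
  proof -
    have "(\<Sum>i\<in>K. X * \<iota> i (k + 1) * \<pi> i (k + 1)) = X * (\<Sum>i\<in>K. \<iota> i (k + 1) * \<pi> i (k + 1))"
      by (simp only: sum_distrib_left mult.assoc)
    with s1 that show ?thesis by simp
  qed
  define J where "J = {j \<in> K. ?\<phi> * \<iota> j (k + 1) \<noteq> 0}"
  have "J \<noteq> {}"
  proof
    assume "J = {}"
    then have "(\<Sum>i\<in>K. ?\<phi> * \<iota> i (k + 1) * \<pi> i (k + 1)) = 0" by (intro sum.neutral) (auto simp: J_def)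
    with expand[of ?\<phi>] \<phi> nz show False by (simp add: fcar_def)
  qed
  moreover have "finite J" using fin by (simp add: J_def)
  ultimately obtain p where p: "p \<in> J" and pmax: "\<forall>j\<in>J. pos (snd (t j)) \<le> pos (snd (t p))"
    using max_exists[of J "\<lambda>j. pos (snd (t j))"] by blast
  have pK: "p \<in> K" using p by (simp add: J_def)
  obtain b where b: "t p = (k, b)" "k < b" "b \<le> n + 2" using t pK by blast
  have k1t: "k + 1 \<in> ivl (t i)" if "i \<in> K" for i using t that by (force simp: ivl_def)
  have col: "fcar (vdim V k) 1 (?\<phi> * \<iota> j (k + 1))" if "j \<in> K" for j
    using fcar_mult[OF \<phi> trunc_entry(4)[OF fhom_fsup[OF hi[OF that]] k1(1)]] k1t[OF that] by (simp add: vdim_iv)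
  obtain Y where Y: "fcar 1 (vdim V k) Y" "Y * (?\<phi> * \<iota> p (k + 1)) = idm 1"
    using column_left_inverse[OF col[OF pK]] p by (auto simp: J_def)
  define C where "C j = Y * (?\<phi> * \<iota> j (k + 1))" for j
  have C: "fcar 1 1 (C j)" if "j \<in> K" for j
    unfolding C_def by (rule fcar_mult[OF Y(1) col[OF that]])
  define \<kappa> where "\<kappa> j = (if j \<in> J then (\<lambda>v. if v \<in> ivl (t j) \<inter> ivl (t p) then C j else 0) else 0)" for j
  have \<kappa>: "fhom Q (iv Q (t j)) (iv Q (t p)) (\<kappa> j)" if jK: "j \<in> K" for j
  proof (cases "j \<in> J")
    case True
    obtain b' where b': "t j = (k, b')" "k < b'" "b' \<le> n + 2" using t jK by blast
    have "overlap_hom (t j) (t p)"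
      unfolding b b' by (rule overlap_hom_pos) (use pmax True b b' in auto)
    then have "fhom Q (iv Q (t j)) (iv Q (t p)) (\<lambda>v. if v \<in> ivl (t j) \<inter> ivl (t p) then C j else 0)"
      by (intro fhom_overlap C that) (use b b' in simp_all)
    with True show ?thesis by (simp only: \<kappa>_def if_True)
  qed (simp add: \<kappa>_def fhom_0)
  define y where "y = (\<Sum>j\<in>K. \<kappa> j * \<pi> j)"
  have y: "fhom Q (trunc k V) (iv Q (t p)) y"
    unfolding y_def by (rule fhom_sum) (rule fhom_mult[OF \<kappa> hp])
  have kc: "\<kappa> j (k + 1) = Y * ?\<phi> * \<iota> j (k + 1)" if "j \<in> K" for j
  proof (cases "j \<in> J")
    case True
    then show ?thesis using k1t[OF that] k1t[OF pK] by (simp add: \<kappa>_def C_def mult.assoc)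
  next
    case False
    then have "Y * (?\<phi> * \<iota> j (k + 1)) = 0" using that by (simp add: J_def)
    with False show ?thesis by (simp add: \<kappa>_def mult.assoc)
  qed
  have yk: "y (k + 1) = Y * ?\<phi>"
  proof -
    have "y (k + 1) = (\<Sum>j\<in>K. (Y * ?\<phi>) * \<iota> j (k + 1) * \<pi> j (k + 1))"
      unfolding y_def sum_family_apply
      by (rule sum.cong) (simp_all only: kc times_fun_apply)
    then show ?thesis using expand[of "Y * ?\<phi>"] \<phi> by (simp add: fcar_def mult.assoc)
  qed
  have same: "a' = a" if "a' \<in> arcs Q" "tail Q a' = k + 1" "head Q a' = k" for a'
    using arc_unique[OF that(1) a(1)] that a by simp
  have noarc: False if "a' \<in> arcs Q" "tail Q a' = k" "head Q a' = k + 1" for a'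
    using no_opposite_arcs[of a a'] that a by auto
  have gx: "fhom Q (iv Q (k - 1, b)) V ((\<iota> p)(k := ?\<phi> * \<iota> p (k + 1)))"
    by (rule glue_in) (use b hi[OF pK] col[OF pK] in \<open>auto dest: same noarc\<close>)
  have gy: "fhom Q V (iv Q (k - 1, b)) (y(k := Y))"
    by (rule glue_out) (use b y Y yk in \<open>auto dest: same noarc\<close>)
  have s: "(k - 1, b) \<in> segments n" using b k by (auto simp: mem_segments)
  have "y * \<iota> p = (\<Sum>j\<in>K. \<kappa> j * (\<pi> j * \<iota> p))" by (simp add: y_def sum_distrib_right mult.assoc)
  also have "\<dots> = (\<Sum>j\<in>K. if j = p then \<kappa> p else 0)"
    by (rule sum.cong) (use orth pK pi1[OF pK] fhom_right[OF \<kappa>[OF pK]] in auto)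
  also have "\<dots> = \<kappa> p" using fin pK by simp
  finally have "y v * \<iota> p v = \<kappa> p v" for v by (metis times_fun_apply)
  then have "(y(k := Y)) * ((\<iota> p)(k := ?\<phi> * \<iota> p (k + 1))) = idf Q (iv Q (k - 1, b))"
    using p Y k b by (auto simp: fun_eq_iff idf_iv ind_def ivl_def \<kappa>_def C_def)
  with gx gy s show ?thesis unfolding retract_def by blast
qed

lemma retract_exists_above:
  assumes d: "vdim V k \<noteq> 0" and sys: "has_sys n Q (trunc k V) K t \<iota> \<pi>"
  shows "\<exists>s\<in>segments n. \<exists>x y. retract Q V s x y"
proof (cases "\<forall>a\<in>arcs Q. tail Q a = k \<or> head Q a = k \<longrightarrow> mm V a = 0")
  case True
  then show ?thesis using retract_simple[OF d] by blast
next
  case False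
  then obtain a where a: "a \<in> arcs Q" "tail Q a = k \<or> head Q a = k" "mm V a \<noteq> 0" by blast
  have "\<not> (tail Q a < k \<or> head Q a < k)" using mm_below[OF V below a(1)] a(3) by blast
  then have "tail Q a = k \<and> head Q a = k + 1 \<or> tail Q a = k + 1 \<and> head Q a = k"
    using a(2) by (cases rule: arc_cases[OF a(1)]) auto
  then show ?thesis
    using trunc_sys_dichotomy[OF sys] retract_up[OF sys _ a(1) _ _ a(3)] retract_down[OF sys _ a(1) _ _ a(3)] by blast
qed

end

lemma has_sys_empty:
  assumes "\<forall>v\<in>verts Q. vdim V v = 0" shows "has_sys n Q V {} t \<iota> \<pi>"
  using assms by (auto simp: has_sys_def idf_def fun_eq_iff)

text \<open>Two nested inductions: the outer one, on the number m of vertices left from k on,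
  decomposes the truncation; the inner one, on the total dimension, decomposes the complement of the
  interval split off. For m = 0 the representation is zero.\<close>

lemma gabriel_above:
  "n + 3 \<le> k + m \<Longrightarrow> 1 \<le> k \<Longrightarrow> is_rep Q V \<Longrightarrow> \<forall>v\<in>verts Q. v < k \<longrightarrow> vdim V v = 0 \<Longrightarrow>
    \<exists>(K :: nat set) t \<iota> \<pi>. has_sys n Q V K t \<iota> \<pi>"
proof (induction m arbitrary: k V)
  case 0
  then have "\<forall>v\<in>verts Q. vdim V v = 0" by (auto simp: verts)
  from has_sys_empty[OF this] show ?case by blast
next
  case (Suc m)
  from Suc.prems show ?case
  proof (induction "\<Sum>v\<in>verts Q. vdim V v" arbitrary: V rule: less_induct)
    case (less V)
    have below1: "\<forall>v\<in>verts Q. v < k + 1 \<longrightarrow> vdim V v = 0" if "vdim V k = 0"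
      using less.prems(4) that by (auto simp: less_Suc_eq)
    show ?case
    proof (cases "vdim V k = 0 \<or> n + 3 \<le> k")
      case True
      then show ?thesis
      proof
        assume "vdim V k = 0"
        from Suc.IH[of "k + 1" V, OF _ _ less.prems(3) below1[OF this]] less.prems(1) show ?thesis by simp
      next
        assume "n + 3 \<le> k"
        then have "\<forall>v\<in>verts Q. vdim V v = 0" using less.prems(4) by (auto simp: verts)
        from has_sys_empty[OF this] show ?thesis by blast
      qed
    next
      case False
      have "\<forall>v\<in>verts Q. v < k + 1 \<longrightarrow> vdim (trunc k V) v = 0" by (simp add: vdim_trunc)
      then obtain K :: "nat set" and t \<iota> \<pi> where sys: "has_sys n Q (trunc k V) K t \<iota> \<pi>"
        using Suc.IH[of "k + 1" "trunc k V"] is_rep_trunc[OF less.prems(3)] less.prems(1) by auto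
      have "\<exists>s\<in>segments n. \<exists>x y. retract Q V s x y"
        by (rule retract_exists_above[OF less.prems(3,4,2) _ _ sys]) (use False in auto)
      then obtain s x y where s: "s \<in> segments n" and r: "retract Q V s x y" by blast
      obtain C where C: "is_rep Q C" "fiso Q V (dsum (iv Q s) C)"
        and dC: "\<forall>v\<in>verts Q. vdim V v = vdim C v + (if v \<in> ivl s then 1 else 0)"
        using split_retract[OF less.prems(3) s r] by blast
      have "(\<Sum>v\<in>verts Q. vdim C v) < (\<Sum>v\<in>verts Q. vdim V v)"
      proof (rule sum_strict_mono_ex1)
        show "finite (verts Q)" by (simp add: verts)
        show "\<exists>v\<in>verts Q. vdim C v < vdim V v"
          using dC s ivl_verts[OF s] by (intro bexI[of _ "snd s"]) (auto simp: ivl_def mem_segments)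
      qed (use dC in auto)
      moreover have "\<forall>v\<in>verts Q. v < k \<longrightarrow> vdim C v = 0" using less.prems(4) dC by auto
      ultimately obtain L :: "nat set" and u \<kappa> \<rho> where "has_sys n Q C L u \<kappa> \<rho>"
        using less.hyps[of C] less.prems C(1) by blast
      from has_sys_fiso[OF has_sys_dsum[OF is_rep_iv C(1) has_sys_iv[OF s] this] fiso_sym[OF C(2)]]
      show ?thesis using has_sys_nat_index by metis
    qed
  qed
qed

lemma gabriel:
  assumes "is_rep Q V" shows "\<exists>(K :: nat set) t \<iota> \<pi>. has_sys n Q V K t \<iota> \<pi>"
  by (rule gabriel_above[of 1 "n + 2"]) (use assms in \<open>auto simp: verts\<close>)

end

section \<open>Decompositions and indecomposable summands\<close>

lemma has_sys_cong:
  assumes "has_sys n Q V K t \<iota> \<pi>" "\<And>i. i \<in> K \<Longrightarrow> t i = u i"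
  shows "has_sys n Q V K u \<iota> \<pi>"
  using assms by (simp add: has_sys_def)

context type_A
begin

section \<open>Decompositions with the same intervals, and the set of intervals that occur\<close>

lemma sys_iso_aux:
  assumes V: "has_sys n Q V K t \<iota> \<pi>" and W: "has_sys n Q W K t \<kappa> \<rho>"
  shows "(\<Sum>i\<in>K. \<iota> i * \<rho> i) * (\<Sum>i\<in>K. \<kappa> i * \<pi> i) = idf Q V"
proof -
  have fin: "finite K" using V by (simp add: has_sys_def)
  have "(\<Sum>i\<in>K. \<iota> i * \<rho> i) * (\<Sum>j\<in>K. \<kappa> j * \<pi> j) = (\<Sum>i\<in>K. \<Sum>j\<in>K. \<iota> i * (\<rho> i * \<kappa> j) * \<pi> j)"
    by (simp add: sum_distrib_left sum_distrib_right mult.assoc) (rule sum.swap)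
  also have "\<dots> = (\<Sum>i\<in>K. \<Sum>j\<in>K. if j = i then \<iota> i * \<pi> i else 0)"
  proof (intro sum.cong refl)
    fix i j assume i: "i \<in> K" and j: "j \<in> K"
    have "\<iota> i * idf Q (iv Q (t i)) = \<iota> i"
      using V i by (auto simp: has_sys_def retract_def intro: fhom_right)
    moreover have "\<rho> i * \<kappa> i = idf Q (iv Q (t i))"
      using W i by (auto simp: has_sys_def retract_def)
    moreover have "i \<noteq> j \<Longrightarrow> \<rho> i * \<kappa> j = 0"
      using W i j by (auto simp: has_sys_def)
    ultimately show "\<iota> i * (\<rho> i * \<kappa> j) * \<pi> j = (if j = i then \<iota> i * \<pi> i else 0)"
      by auto
  qed
  also have "\<dots> = (\<Sum>i\<in>K. \<iota> i * \<pi> i)" using fin by simp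
  finally show ?thesis using V by (simp add: has_sys_def)
qed

lemma sys_iso:
  assumes V: "has_sys n Q V K t \<iota> \<pi>" and W: "has_sys n Q W L u \<kappa> \<rho>"
    and f: "bij_betw f K L" and t: "\<And>i. i \<in> K \<Longrightarrow> u (f i) = t i"
  shows "fiso Q V W"
proof -
  have W': "has_sys n Q W K t (\<kappa> \<circ> f) (\<rho> \<circ> f)"
    by (rule has_sys_cong[OF has_sys_reindex[OF W f]]) (simp add: t)
  have "fhom Q V W (\<Sum>i\<in>K. (\<kappa> \<circ> f) i * \<pi> i)"
    using V W' by (intro fhom_sum fhom_mult) (auto simp: has_sys_def retract_def)
  moreover have "fhom Q W V (\<Sum>i\<in>K. \<iota> i * (\<rho> \<circ> f) i)"
    using V W' by (intro fhom_sum fhom_mult) (auto simp: has_sys_def retract_def)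
  ultimately show ?thesis
    unfolding fiso_def using sys_iso_aux[OF V W'] sys_iso_aux[OF W' V] by blast
qed

lemma sys_iso_same:
  assumes "has_sys n Q V K t \<iota> \<pi>" "has_sys n Q W K t \<kappa> \<rho>" shows "fiso Q V W"
  by (rule sys_iso[OF assms bij_betw_id[of K, unfolded id_def]]) simp

lemma sys_exists:
  assumes "finite K" "\<And>i. i \<in> K \<Longrightarrow> t i \<in> segments n"
  shows "\<exists>(R :: (nat, 'a, 'k::field) qrep) \<iota> \<pi>. is_rep Q R \<and> has_sys n Q R K t \<iota> \<pi>"
  using assms
proof (induction K)
  case empty
  let ?R = "\<lparr>vdim = (\<lambda>_. 0), amap = (\<lambda>_. 0\<^sub>m 0 0)\<rparr> :: (nat, 'a, 'k) qrep"
  have "is_rep Q ?R" by (auto simp: is_rep_def)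
  moreover have "has_sys n Q ?R {} t (\<lambda>_. 0) (\<lambda>_. 0)" by (rule has_sys_empty) simp
  ultimately show ?case by blast
next
  case (insert i K)
  then obtain R :: "(nat, 'a, 'k) qrep" and \<iota> \<pi> where R: "is_rep Q R" "has_sys n Q R K t \<iota> \<pi>" by auto
  have i: "t i \<in> segments n" using insert by simp
  note S = has_sys_dsum[OF is_rep_iv R(1) has_sys_iv[OF i] R(2)]
  let ?f = "\<lambda>j. if j = i then Inl () else Inr j"
  have "bij_betw ?f (insert i K) ({()} <+> K)"
    using insert(2) by (auto simp: bij_betw_def inj_on_def)
  note S' = has_sys_reindex[OF S this]
  have "\<exists>\<kappa> \<rho>. has_sys n Q (dsum (iv Q (t i)) R) (insert i K) t \<kappa> \<rho>"
    by (intro exI, rule has_sys_cong[OF S']) auto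
  then show ?case using is_rep_dsum[OF is_rep_iv R(1)] by blast
qed

text \<open>Defined by retracts, hence visibly independent of a decomposition;
  \<open>supp_sys\<close> computes it from any decomposition.\<close>

definition supp :: "(nat, 'a, 'k::field) qrep \<Rightarrow> (nat \<times> nat) set" where
  "supp V = {s \<in> segments n. \<exists>x y. retract Q V s x y}"

text \<open>Two copies of s show as two retracts with \<open>y * x' = 0\<close>. This one-sided
  orthogonality suffices by \<open>double_retract_in_sys\<close>, so nothing is required of
  \<open>y' * x\<close>.\<close>

definition mfree :: "(nat, 'a, 'k::field) qrep \<Rightarrow> bool" where
  "mfree V \<longleftrightarrow> (\<nexists>s x y x' y'. s \<in> segments n \<and> retract Q V s x y \<and> retract Q V s x' y' \<and> y * x' = 0)"

lemma supp_segments: "supp V \<subseteq> segments n"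
  by (auto simp: supp_def)

lemma finite_segments: "finite (segments n)"
  by (rule finite_subset[of _ "{..n + 2} \<times> {..n + 2}"]) (auto simp: segments_def)

lemma supp_sys:
  assumes "has_sys n Q V K t \<iota> \<pi>" shows "supp V = t ` K"
proof -
  have "s \<in> t ` K" if "s \<in> supp V" for s
    using that retract_in_sys[OF assms] unfolding supp_def by blast
  moreover have "t i \<in> supp V" if "i \<in> K" for i
    using assms that by (auto simp: supp_def has_sys_def)
  ultimately show ?thesis by blast
qed

lemma mfree_sys:
  assumes V: "has_sys n Q V K t \<iota> \<pi>" shows "mfree V \<longleftrightarrow> inj_on t K"
proof
  assume mf: "mfree V"
  show "inj_on t K"
  proof (rule inj_onI, rule ccontr)
    fix i j assume ij: "i \<in> K" "j \<in> K" "t i = t j" "i \<noteq> j"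
    have "t i \<in> segments n" "retract Q V (t i) (\<iota> i) (\<pi> i)" "retract Q V (t j) (\<iota> j) (\<pi> j)" "\<pi> i * \<iota> j = 0"
      using V ij by (auto simp: has_sys_def)
    then show False using mf ij(3) unfolding mfree_def by metis
  qed
next
  assume inj: "inj_on t K"
  show "mfree V"
    unfolding mfree_def
  proof (rule notI, elim exE conjE)
    fix s x y x' y'
    assume "s \<in> segments n" "retract Q V s x y" "retract Q V s x' y'" "y * x' = 0"
    from double_retract_in_sys[OF V this] inj show False by (metis inj_onD)
  qed
qed

lemma supp_fiso: "fiso Q V W \<Longrightarrow> supp V = supp W"
  unfolding supp_def using retract_fiso fiso_sym by blast

lemma mfree_fiso:
  assumes "is_rep Q V" "fiso Q V W" shows "mfree V \<longleftrightarrow> mfree W"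
proof -
  obtain K :: "nat set" and t \<iota> \<pi> where V: "has_sys n Q V K t \<iota> \<pi>" using gabriel[OF assms(1)] by blast
  obtain \<kappa> \<rho> where W: "has_sys n Q W K t \<kappa> \<rho>" using has_sys_fiso[OF V assms(2)] by blast
  show ?thesis using mfree_sys[OF V] mfree_sys[OF W] by simp
qed

lemma supp_dsum:
  assumes V: "is_rep Q V" and W: "is_rep Q W" shows "supp (dsum V W) = supp V \<union> supp W"
proof -
  obtain K :: "nat set" and t \<iota> \<pi> where 1: "has_sys n Q V K t \<iota> \<pi>" using gabriel[OF V] by blast
  obtain L :: "nat set" and u \<kappa> \<rho> where 2: "has_sys n Q W L u \<kappa> \<rho>" using gabriel[OF W] by blast
  show ?thesis
    unfolding supp_sys[OF 1] supp_sys[OF 2] supp_sys[OF has_sys_dsum[OF V W 1 2]] by (force simp: image_iff)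
qed

lemma mfree_dsum:
  assumes V: "is_rep Q V" and W: "is_rep Q W"
  shows "mfree (dsum V W) \<longleftrightarrow> mfree V \<and> mfree W \<and> supp V \<inter> supp W = {}"
proof -
  obtain K :: "nat set" and t \<iota> \<pi> where 1: "has_sys n Q V K t \<iota> \<pi>" using gabriel[OF V] by blast
  obtain L :: "nat set" and u \<kappa> \<rho> where 2: "has_sys n Q W L u \<kappa> \<rho>" using gabriel[OF W] by blast
  have "inj_on (case_sum t u) (K <+> L) \<longleftrightarrow> inj_on t K \<and> inj_on u L \<and> t ` K \<inter> u ` L = {}"
    unfolding inj_on_def Plus_def by (auto simp: ball_Un image_iff)
  then show ?thesis
    unfolding mfree_sys[OF 1] mfree_sys[OF 2] mfree_sys[OF has_sys_dsum[OF V W 1 2]]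
      supp_sys[OF 1] supp_sys[OF 2] .
qed

lemma supp_iv: "s \<in> segments n \<Longrightarrow> supp (iv Q s) = {s}"
  using supp_sys[OF has_sys_iv[of s]] by simp

lemma mfree_iv: "s \<in> segments n \<Longrightarrow> mfree (iv Q s)"
  using mfree_sys[OF has_sys_iv[of s]] by simp

text \<open>Without multiplicities any decomposition is indexed bijectively by the support. This is
  the only part of the uniqueness of decompositions that matching representations with sets of
  segments requires.\<close>

lemma mfree_determined:
  assumes V: "is_rep Q V" and W: "is_rep Q W" and mf: "mfree V" "mfree W" and eq: "supp V = supp W"
  shows "fiso Q V W"
proof -
  obtain K :: "nat set" and t \<iota> \<pi> where 1: "has_sys n Q V K t \<iota> \<pi>" using gabriel[OF V] by blast
  obtain L :: "nat set" and u \<kappa> \<rho> where 2: "has_sys n Q W L u \<kappa> \<rho>" using gabriel[OF W] by blast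
  have t: "bij_betw t K (supp V)" and u: "bij_betw u L (supp V)"
    using mf mfree_sys[OF 1] mfree_sys[OF 2] supp_sys[OF 1] supp_sys[OF 2] eq by (auto simp: bij_betw_def)
  show ?thesis
    by (rule sys_iso[OF 1 2 bij_betw_trans[OF t bij_betw_inv_into[OF u]]])
      (use bij_betwE[OF t] u in \<open>auto simp: bij_betw_inv_into_right\<close>)
qed

lemma mfree_exists:
  assumes "S \<subseteq> segments n"
  shows "\<exists>T :: (nat, 'a, 'k::field) qrep. is_rep Q T \<and> mfree T \<and> supp T = S"
proof -
  have "finite S" using assms finite_segments by (rule finite_subset)
  then obtain T :: "(nat, 'a, 'k) qrep" and \<iota> \<pi> where "is_rep Q T" "has_sys n Q T S (\<lambda>s. s) \<iota> \<pi>"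
    using sys_exists[of S "\<lambda>s. s"] assms by blast
  then show ?thesis using supp_sys mfree_sys by fastforce
qed

lemma fiso_dsum:
  assumes "is_rep Q A" "is_rep Q A'" "is_rep Q C" "is_rep Q C'" "fiso Q A A'" "fiso Q C C'"
  shows "fiso Q (dsum A C) (dsum A' C')"
proof -
  obtain K :: "nat set" and t \<iota> \<pi> where A: "has_sys n Q A K t \<iota> \<pi>" using gabriel[OF assms(1)] by blast
  obtain L :: "nat set" and u \<kappa> \<rho> where C: "has_sys n Q C L u \<kappa> \<rho>" using gabriel[OF assms(3)] by blast
  obtain \<iota>' \<pi>' where A': "has_sys n Q A' K t \<iota>' \<pi>'" using has_sys_fiso[OF A assms(5)] by blast
  obtain \<kappa>' \<rho>' where C': "has_sys n Q C' L u \<kappa>' \<rho>'" using has_sys_fiso[OF C assms(6)] by blast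
  show ?thesis
    by (rule sys_iso_same[OF has_sys_dsum[OF assms(1,3) A C] has_sys_dsum[OF assms(2,4) A' C']])
qed

lemma fiso_vdim:
  assumes "fiso Q V W" "v \<in> verts Q" shows "vdim V v = vdim W v"
proof -
  obtain F G where F: "fhom Q V W F" and G: "fhom Q W V G" and e: "G * F = idf Q V" "F * G = idf Q W"
    using assms(1) by (auto simp: fiso_def)
  have "fcar (vdim W v) (vdim V v) (F v)" "fcar (vdim V v) (vdim W v) (G v)"
    using fhom_fsup[OF F, unfolded fsup_iff, rule_format, of v]
      fhom_fsup[OF G, unfolded fsup_iff, rule_format, of v] assms(2) by auto
  moreover have "G v * F v = idm (vdim V v)" "F v * G v = idm (vdim W v)"
    using fun_cong[OF e(1), of v] fun_cong[OF e(2), of v] assms(2) by (auto simp: idf_def)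
  ultimately show ?thesis using left_inverse_dim_le by (metis le_antisym)
qed

lemma zero_rep_iff:
  assumes V: "is_rep Q V" shows "zero_rep Q V \<longleftrightarrow> supp V = {}"
proof
  assume z: "zero_rep Q V"
  have "has_sys n Q V {} (\<lambda>_ :: nat. (0, 0)) (\<lambda>_. 0) (\<lambda>_. 0)"
    by (rule has_sys_empty) (use z in \<open>simp add: zero_rep_def\<close>)
  from supp_sys[OF this] show "supp V = {}" by simp
next
  assume "supp V = {}"
  moreover obtain K :: "nat set" and t \<iota> \<pi> where s: "has_sys n Q V K t \<iota> \<pi>" using gabriel[OF V] by blast
  ultimately have "K = {}" using supp_sys[OF s] by simp
  then have z: "idf Q V = 0" using s by (simp add: has_sys_def)
  have "vdim V v = 0" if "v \<in> verts Q" for v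
    using fun_cong[OF z, of v] that by (simp add: idf_def)
  then show "zero_rep Q V" by (simp add: zero_rep_def)
qed

section \<open>Indecomposable representations and direct summands\<close>

lemma rep_iso_fiso: "is_rep Q V \<Longrightarrow> is_rep Q W \<Longrightarrow> rep_iso Q V W \<longleftrightarrow> fiso Q V W"
  by (rule rep_iso_iff[OF wf])

text \<open>Two summands of a multiplicity free representation have disjoint supports; here their
  union is a singleton, so one of them is empty and its summand is zero.\<close>

lemma indecomposable_fiso_iv:
  assumes M: "is_rep Q M" and s: "s \<in> segments n" and iso: "fiso Q M (iv Q s)"
  shows "indecomposable Q M"
  unfolding indecomposable_def
proof (intro conjI allI impI M)
  have sup: "supp M = {s}" and mf: "mfree M"
    using supp_fiso[OF iso] supp_iv[OF s] mfree_fiso[OF M iso] mfree_iv[OF s] by auto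
  show "\<not> zero_rep Q M" using zero_rep_iff[OF M] sup by simp
  fix A B :: "(nat, 'a, 'b) qrep"
  assume AB: "is_rep Q A" "is_rep Q B" and "rep_iso Q M (dsum A B)"
  then have i: "fiso Q M (dsum A B)" using rep_iso_fiso[OF M is_rep_dsum[OF AB]] by simp
  have "supp A \<union> supp B = {s}" "supp A \<inter> supp B = {}"
    using supp_fiso[OF i] supp_dsum[OF AB] mfree_fiso[OF M i] mfree_dsum[OF AB] sup mf by auto
  then have "supp A = {} \<or> supp B = {}" by (cases "s \<in> supp A") auto
  then show "zero_rep Q A \<or> zero_rep Q B"
    by (simp add: zero_rep_iff[OF AB(1)] zero_rep_iff[OF AB(2)])
qed

lemma indecomposable_iv: "s \<in> segments n \<Longrightarrow> indecomposable Q (iv Q s)"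
  using indecomposable_fiso_iv[OF is_rep_iv _ fiso_refl[OF wf is_rep_iv]] .

lemma split_supp:
  assumes V: "is_rep Q V" and s: "s \<in> supp V"
  shows "\<exists>C. is_rep Q C \<and> fiso Q V (dsum (iv Q s) C)"
proof -
  obtain x y where "s \<in> segments n" "retract Q V s x y" using s by (auto simp: supp_def)
  from split_retract[OF V this] show ?thesis by blast
qed

lemma indecomposable_imp_iv:
  assumes M: "indecomposable Q M"
  shows "\<exists>s\<in>segments n. fiso Q M (iv Q s)"
proof -
  have rM: "is_rep Q M" and "supp M \<noteq> {}"
    using M zero_rep_iff by (auto simp: indecomposable_def)
  then obtain s where s: "s \<in> supp M" by blast
  obtain C where C: "is_rep Q C" "fiso Q M (dsum (iv Q s) C)" using split_supp[OF rM s] by blast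
  have sg: "s \<in> segments n" using s supp_segments by blast
  have "rep_iso Q M (dsum (iv Q s) C)"
    using rep_iso_fiso[OF rM is_rep_dsum[OF is_rep_iv C(1)]] C(2) by simp
  then have "zero_rep Q (iv Q s :: (nat, 'a, 'b) qrep) \<or> zero_rep Q C"
    using M C(1) is_rep_iv unfolding indecomposable_def by blast
  moreover have "\<not> zero_rep Q (iv Q s :: (nat, 'a, 'b) qrep)"
    using indecomposable_iv[OF sg] unfolding indecomposable_def by blast
  ultimately have z: "zero_rep Q C" by blast
  have "has_sys n Q C {} (\<lambda>_ :: nat. (0, 0)) (\<lambda>_. 0) (\<lambda>_. 0)"
    by (rule has_sys_empty) (use z in \<open>simp add: zero_rep_def\<close>)
  note S = has_sys_dsum[OF is_rep_iv C(1) has_sys_iv[OF sg] this]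
  have "fiso Q (dsum (iv Q s) C) (iv Q s)"
    by (rule sys_iso[OF S has_sys_iv[OF sg], where f = "\<lambda>_. ()"]) (auto simp: bij_betw_def inj_on_def Plus_def)
  then show ?thesis using fiso_trans[OF C(2)] sg by blast
qed

lemma indecomposable_iff:
  "indecomposable Q M \<longleftrightarrow> is_rep Q M \<and> (\<exists>s\<in>segments n. fiso Q M (iv Q s))"
proof
  assume "indecomposable Q M"
  then show "is_rep Q M \<and> (\<exists>s\<in>segments n. fiso Q M (iv Q s))"
    using indecomposable_imp_iv by (simp add: indecomposable_def)
qed (use indecomposable_fiso_iv in blast)

lemma complement_iff:
  assumes T: "is_rep Q T"
  shows "complement Q T M C \<longleftrightarrow> is_rep Q M \<and> is_rep Q C \<and> fiso Q T (dsum M C)"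
  unfolding complement_def using rep_iso_fiso[OF T is_rep_dsum] by blast

lemma indec_summand_iff:
  assumes T: "is_rep Q T"
  shows "indec_summand Q T A \<longleftrightarrow> is_rep Q A \<and> (\<exists>s\<in>supp T. fiso Q A (iv Q s))"
proof
  assume "indec_summand Q T A"
  then obtain C where A: "indecomposable Q A" and C: "complement Q T A C" by (auto simp: indec_summand_def)
  from A obtain s where rA: "is_rep Q A" and s: "s \<in> segments n" "fiso Q A (iv Q s)"
    unfolding indecomposable_iff by blast
  have rC: "is_rep Q C" and i: "fiso Q T (dsum A C)" using C complement_iff[OF T] by auto
  have "s \<in> supp T"
    using supp_fiso[OF i] supp_dsum[OF rA rC] supp_fiso[OF s(2)] supp_iv[OF s(1)] by auto
  with rA s show "is_rep Q A \<and> (\<exists>s\<in>supp T. fiso Q A (iv Q s))" by blast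
next
  assume "is_rep Q A \<and> (\<exists>s\<in>supp T. fiso Q A (iv Q s))"
  then obtain s where rA: "is_rep Q A" and s: "s \<in> supp T" and i: "fiso Q A (iv Q s)" by blast
  obtain C where C: "is_rep Q C" "fiso Q T (dsum (iv Q s) C)" using split_supp[OF T s] by blast
  have "fiso Q (dsum (iv Q s) C) (dsum A C)"
    by (rule fiso_dsum[OF is_rep_iv rA C(1) C(1) fiso_sym[OF i] fiso_refl[OF wf C(1)]])
  then have "complement Q T A C"
    using complement_iff[OF T] rA C fiso_trans by blast
  moreover have "indecomposable Q A"
    unfolding indecomposable_iff using rA i s supp_segments by blast
  ultimately show "indec_summand Q T A" by (auto simp: indec_summand_def)
qed

lemma repeated_summand_iff:
  assumes T: "is_rep Q T"
  shows "(\<exists>M C. indecomposable Q M \<and> is_rep Q C \<and> rep_iso Q T (dsum (dsum M M) C)) \<longleftrightarrow> \<not> mfree T"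
proof
  assume "\<exists>M C. indecomposable Q M \<and> is_rep Q C \<and> rep_iso Q T (dsum (dsum M M) C)"
  then obtain M C where M: "indecomposable Q M" and C: "is_rep Q C" and i: "rep_iso Q T (dsum (dsum M M) C)"
    by blast
  have rM: "is_rep Q M" "supp M \<noteq> {}"
    using M zero_rep_iff by (auto simp: indecomposable_def)
  have "is_rep Q (dsum (dsum M M) C)"
    by (intro is_rep_dsum rM C)
  then have "fiso Q T (dsum (dsum M M) C)"
    using i rep_iso_fiso[OF T] by blast
  from mfree_fiso[OF T this] show "\<not> mfree T"
    using mfree_dsum[OF is_rep_dsum[OF rM(1) rM(1)] C] mfree_dsum[OF rM(1) rM(1)] rM(2) by auto
next
  assume nm: "\<not> mfree T"
  obtain K :: "nat set" and t \<iota> \<pi> where s: "has_sys n Q T K t \<iota> \<pi>" using gabriel[OF T] by blast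
  then obtain i j where ij: "i \<in> K" "j \<in> K" "i \<noteq> j" "t i = t j"
    using nm mfree_sys[OF s] by (auto simp: inj_on_def)
  have fin: "finite K" and tK: "\<And>i. i \<in> K \<Longrightarrow> t i \<in> segments n" using s by (auto simp: has_sys_def)
  \<comment> \<open>The remaining summands of T, assembled into a new representation; matching
    indices then gives the isomorphism with T.\<close>
  obtain C :: "(nat, 'a, 'b) qrep" and \<kappa> \<rho> where C: "is_rep Q C" "has_sys n Q C (K - {i, j}) t \<kappa> \<rho>"
    using sys_exists[of "K - {i, j}" t] fin tK by auto
  let ?M = "iv Q (t i)"
  note I = has_sys_iv[OF tK[OF ij(1)]]
  note S = has_sys_dsum[OF is_rep_dsum[OF is_rep_iv is_rep_iv] C(1) has_sys_dsum[OF is_rep_iv is_rep_iv I I] C(2)]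
  let ?f = "case_sum (case_sum (\<lambda>_. i) (\<lambda>_. j)) (\<lambda>x. x)"
  have "bij_betw ?f (({()} <+> {()}) <+> (K - {i, j})) K"
    using ij by (auto simp: bij_betw_def inj_on_def Plus_def image_iff split: sum.splits)
  from sys_iso[OF S s this] have "fiso Q (dsum (dsum ?M ?M) C) T"
    using ij(4) by (auto split: sum.splits)
  moreover have "is_rep Q (dsum (dsum ?M ?M) C)"
    by (intro is_rep_dsum is_rep_iv C(1))
  ultimately have "rep_iso Q T (dsum (dsum ?M ?M) C)"
    using rep_iso_fiso[OF T] fiso_sym by blast
  then show "\<exists>M C. indecomposable Q M \<and> is_rep Q C \<and> rep_iso Q T (dsum (dsum M M) C)"
    using indecomposable_iv[OF tK[OF ij(1)]] C(1) by blast
qed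

end

section \<open>Extensions and cocycles\<close>

lemma short_exact_iff:
  assumes Q: "wf_digraph Q" and reps: "is_rep Q B" "is_rep Q E" "is_rep Q A"
    and f: "\<And>v. v \<in> verts Q \<Longrightarrow> f v \<in> carrier_mat (vdim E v) (vdim B v)"
    and g: "\<And>v. v \<in> verts Q \<Longrightarrow> g v \<in> carrier_mat (vdim A v) (vdim E v)"
  shows "short_exact Q B E A f g \<longleftrightarrow> (\<exists>R S. fexact Q B E A (fam Q f) (fam Q g) R S)"
proof
  assume "short_exact Q B E A f g"
  then show "\<exists>R S. fexact Q B E A (fam Q f) (fam Q g) R S" by (rule short_exactD[OF Q reps])
next
  assume "\<exists>R S. fexact Q B E A (fam Q f) (fam Q g) R S"
  then obtain R S where ex: "fexact Q B E A (fam Q f) (fam Q g) R S" by blast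
  have eq: "unfam B E (fam Q f) v = f v" "unfam E A (fam Q g) v = g v" if "v \<in> verts Q" for v
    using that mat_of_fm_of[OF f[OF that]] mat_of_fm_of[OF g[OF that]] by (auto simp: unfam_def fam_def)
  have "fhom Q B E (fam Q f)" "fhom Q E A (fam Q g)" using ex by (auto simp: fexact_def)
  then have "rep_hom Q B E f" "rep_hom Q E A g"
    using rep_hom_iff[OF Q reps(1,2) f] rep_hom_iff[OF Q reps(2,3) g] by auto
  then show "short_exact Q B E A f g"
    using short_exact_unfam[OF Q reps ex] eq unfolding short_exact_def by simp
qed

text \<open>F is injective at every vertex, so the commutation squares of \<open>F * r\<close> can
  be cancelled to those of r.\<close>

lemma fhom_cancel_left:
  assumes Q: "wf_digraph Q" "is_rep Q B" and F: "fhom Q B E F" and RF: "R * F = idf Q B"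
    and r: "fsup Q U B r" and Fr: "fhom Q U E (F * r)"
  shows "fhom Q U B r"
  unfolding fhom_def
proof (intro conjI ballI r)
  fix a assume a: "a \<in> arcs Q"
  let ?h = "head Q a" and ?t = "tail Q a"
  have RF': "R v * (F v * X) = idf Q B v * X" for v X
    using fun_cong[OF RF, of v] by (simp flip: mult.assoc)
  have "F ?h * (r ?h * mm U a) = (mm E a * F ?t) * r ?t"
    using Fr a by (simp add: fhom_def mult.assoc)
  also have "mm E a * F ?t = F ?h * mm B a" using F a by (simp add: fhom_def)
  finally have "R ?h * (F ?h * (r ?h * mm U a)) = R ?h * (F ?h * (mm B a * r ?t))"
    by (simp add: mult.assoc)
  then have "idf Q B ?h * r ?h * mm U a = idf Q B ?h * mm B a * r ?t"
    by (simp add: RF' mult.assoc)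
  moreover have "idf Q B ?h * r ?h = r ?h" using fun_cong[OF fsup_left[OF r], of ?h] by simp
  ultimately show "r ?h * mm U a = mm B a * r ?t" by (simp add: idf_mm[OF Q a])
qed

text \<open>\<open>P = S' * G\<close> is a projection of E by morphisms, and \<open>1 - P\<close>
  factors through F. The factor r is a morphism because F can be cancelled, so the given vertexwise
  R is replaced by one that commutes with the arrows.\<close>

lemma split_exact:
  assumes Q: "wf_digraph Q" "is_rep Q B" "is_rep Q E"
    and ex: "fexact Q B E A F G R S" and hS: "fhom Q A E S'" "G * S' = idf Q A"
  shows "\<exists>R'. fhom Q E B R' \<and> fexact Q B E A F G R' S'"
proof -
  have F: "fhom Q B E F" and G: "fhom Q E A G" and R: "fsup Q E B R" and S: "fsup Q A E S"
    and RF: "R * F = idf Q B" and one: "F * R + S * G = idf Q E"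
    using ex by (auto simp: fexact_def)
  define P where "P = S' * G"
  have P: "fhom Q E E P" unfolding P_def by (rule fhom_mult[OF hS(1) G])
  define r where "r = R - R * P"
  have r: "fsup Q E B r" unfolding r_def by (intro fsup_diff fsup_mult[OF R] R fhom_fsup[OF P])
  have FR: "F * R = idf Q E - S * G" using one by (simp add: algebra_simps)
  have "G * P = G" unfolding P_def using hS(2) fhom_left[OF G] by (simp flip: mult.assoc)
  then have "S * G * P = S * G" by (simp add: mult.assoc)
  then have Fr: "F * r = idf Q E - P"
    unfolding r_def right_diff_distrib mult.assoc[symmetric] FR left_diff_distrib
    using fhom_left[OF P] by simp
  have "fhom Q E E (F * r)" unfolding Fr by (intro fhom_diff fhom_idf[OF Q(1,3)] P)
  then have hr: "fhom Q E B r" by (rule fhom_cancel_left[OF Q(1,2) F RF r])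
  have "P * F = 0" unfolding P_def using fexact_zero(1)[OF ex] by (simp add: mult.assoc)
  then have "r * F = idf Q B" unfolding r_def by (simp add: left_diff_distrib mult.assoc RF)
  moreover have "F * r + S' * G = idf Q E" unfolding Fr P_def[symmetric] by simp
  ultimately have "fexact Q B E A F G r S'"
    using F G hr hS r by (simp add: fexact_def fhom_fsup)
  with hr show ?thesis by blast
qed

lemma split_exact_dsum:
  assumes Q: "wf_digraph Q" "is_rep Q B" "is_rep Q E" "is_rep Q A"
    and ex: "fexact Q B E A F G R S" and hS: "fhom Q A E S'" "G * S' = idf Q A"
  shows "fiso Q E (dsum B A)"
proof -
  obtain R' where R': "fhom Q E B R'" and ex': "fexact Q B E A F G R' S'"
    using split_exact[OF Q(1-3) ex hS] by blast
  have F: "fhom Q B E F" and G: "fhom Q E A G" and e: "R' * F = idf Q B" "G * S' = idf Q A"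
    "F * R' + S' * G = idf Q E"
    using ex' by (auto simp: fexact_def)
  note z = fexact_zero[OF ex']
  note B = biproduct_fhom[OF Q(1,2,4)] and b = biproduct_equations[of Q B A]
  let ?X = "inl Q B A * R' + inr Q B A * G" and ?Y = "F * prl Q B A + S' * prr Q B A"
  have a: "C * D * (I * J) = C * (D * I) * J" for C D I J :: "'a \<Rightarrow> 'c fmat"
    by (simp add: mult.assoc)
  have "fhom Q E (dsum B A) ?X" "fhom Q (dsum B A) E ?Y"
    using B F G R' hS by (auto intro!: fhom_add intro: fhom_mult)
  moreover have "?Y * ?X = idf Q E"
    using fhom_right[OF F] fhom_right[OF hS(1)] by (simp add: distrib_left distrib_right a b e)
  moreover have "?X * ?Y = idf Q (dsum B A)"
    using fhom_right[OF B(1)] fhom_right[OF B(3)] by (simp add: distrib_left distrib_right a b e z)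
  ultimately show ?thesis unfolding fiso_def by blast
qed

lemma dsum_exact:
  assumes "wf_digraph Q" "is_rep Q B" "is_rep Q A"
  shows "fexact Q B (dsum B A) A (inl Q B A) (prr Q B A) (prl Q B A) (inr Q B A)"
  using biproduct_fhom[OF assms] biproduct_fsup[where Q = Q and V = B and W = A]
    biproduct_equations[of Q B A] by (simp add: fexact_def)

text \<open>The vanishing of Ext in terms of sections only, free of equivalence classes and of
  \<open>matfam\<close>; this form is transported along isomorphisms.\<close>

definition all_split :: "('v, 'a) pre_digraph \<Rightarrow> ('v, 'a, 'k::field) qrep \<Rightarrow> ('v, 'a, 'k) qrep \<Rightarrow> bool" where
  "all_split Q A B \<longleftrightarrow> (\<forall>E F G R S. is_rep Q E \<longrightarrow> fexact Q B E A F G R S \<longrightarrow>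
     (\<exists>S'. fhom Q A E S' \<and> G * S' = idf Q A))"

lemma extensions_iff:
  assumes Q: "wf_digraph Q" "is_rep Q A" "is_rep Q B"
  shows "(E, f, g) \<in> extensions Q A B \<longleftrightarrow> is_rep Q E \<and> short_exact Q B E A f g"
  by (simp add: extensions_def)

lemma extension_mor_id_iff:
  assumes Q: "wf_digraph Q" "is_rep Q A" "is_rep Q B"
    and \<xi>: "(E, f, g) \<in> extensions Q A B" "(E', f', g') \<in> extensions Q A B"
  shows "((E, f, g), (E', f', g')) \<in> extn_equiv Q A B \<longleftrightarrow>
    (\<exists>H. fhom Q E E' H \<and> H * fam Q f = fam Q f' \<and> fam Q g' * H = fam Q g)"
proof -
  have r: "is_rep Q E" "is_rep Q E'" and s: "short_exact Q B E A f g" "short_exact Q B E' A f' g'"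
    using \<xi> by (auto simp: extensions_def)
  have h: "rep_hom Q B E f" "rep_hom Q B E' f'" "rep_hom Q E A g" "rep_hom Q E' A g'"
    using s by (auto simp: short_exact_def)
  have i: "fam Q f' * idf Q B = fam Q f'" "idf Q A * fam Q g = fam Q g"
    using fhom_right[OF fhom_fam[OF Q(1,3) r(2) h(2)]] fhom_left[OF fhom_fam[OF Q(1) r(1) Q(2) h(3)]] by auto
  have "extn_mor Q (id_fam B) (id_fam A) (E, f, g) (E', f', g') \<longleftrightarrow>
    (\<exists>H. fhom Q E E' H \<and> H * fam Q f = fam Q f' * fam Q (id_fam B) \<and> fam Q g' * H = fam Q (id_fam A) * fam Q g)"
    by (rule extn_mor_iff[OF Q(1) r h]) (rule id_fam_carrier)+
  then show ?thesis using \<xi> by (simp add: extn_equiv_def i)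
qed

text \<open>The direct sum always gives one class. If there is no other, an equivalence from it to a
  given sequence, restricted to the second summand, is a section. Conversely two sequences split by
  morphisms are equivalent.\<close>

lemma Ext1_singleton_iff:
  assumes Q: "wf_digraph Q" "is_rep Q A" "is_rep Q B"
  shows "is_singleton (Ext1 Q A B) \<longleftrightarrow> all_split Q A B"
proof
  let ?D = "dsum B A"
  let ?i = "unfam B ?D (inl Q B A)" and ?p = "unfam ?D A (prr Q B A)"
  have D: "is_rep Q ?D" using is_rep_dsum[OF Q(3,2)] .
  have fi: "fam Q ?i = inl Q B A" "fam Q ?p = prr Q B A"
    by (auto intro: fam_unfam biproduct_fsup)
  have \<xi>0: "(?D, ?i, ?p) \<in> extensions Q A B"
    unfolding extensions_iff[OF Q] using D short_exact_unfam[OF Q(1,3) D Q(2) dsum_exact[OF Q(1,3,2)]] by blast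
  {
    assume "is_singleton (Ext1 Q A B)"
    then obtain X where X: "Ext1 Q A B = {X}" by (auto simp: is_singleton_def)
    show "all_split Q A B"
      unfolding all_split_def
    proof (intro allI impI)
      fix E F G R S assume E: "is_rep Q E" and ex: "fexact Q B E A F G R S"
      let ?f = "unfam B E F" and ?g = "unfam E A G"
      have f: "fam Q ?f = F" "fam Q ?g = G"
        using ex by (auto intro!: fam_unfam fhom_fsup simp: fexact_def)
      have \<xi>: "(E, ?f, ?g) \<in> extensions Q A B"
        unfolding extensions_iff[OF Q] using E short_exact_unfam[OF Q(1,3) E Q(2) ex] by blast
      have "((E, ?f, ?g), (E, ?f, ?g)) \<in> extn_equiv Q A B"
        unfolding extension_mor_id_iff[OF Q \<xi> \<xi>] f
        using fhom_idf[OF Q(1) E] ex by (auto simp: fexact_def fhom_left fhom_right)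
      moreover have "extn_equiv Q A B `` {(E, ?f, ?g)} = extn_equiv Q A B `` {(?D, ?i, ?p)}"
        using X \<xi> \<xi>0 unfolding Ext1_def by (metis quotientI singletonD)
      ultimately have "((?D, ?i, ?p), (E, ?f, ?g)) \<in> extn_equiv Q A B" by blast
      then obtain H where H: "fhom Q ?D E H" "G * H = prr Q B A"
        unfolding extension_mor_id_iff[OF Q \<xi>0 \<xi>] f fi by blast
      have "G * (H * inr Q B A) = idf Q A"
        using H(2) biproduct_equations(2)[of Q B A] by (simp flip: mult.assoc)
      then show "\<exists>S'. fhom Q A E S' \<and> G * S' = idf Q A"
        using fhom_mult[OF H(1) biproduct_fhom(3)[OF Q(1,3,2)]] by blast
    qed
  next
    assume sp: "all_split Q A B"
    have split: "\<exists>R S. fhom Q A E S \<and> fhom Q E B R \<and> fexact Q B E A (fam Q f) (fam Q g) R S"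
      if \<xi>: "(E, f, g) \<in> extensions Q A B" for E f g
    proof -
      have E: "is_rep Q E" and "short_exact Q B E A f g" using \<xi> by (auto simp: extensions_def)
      from short_exactD[OF Q(1,3) E Q(2) this(2)] obtain R S where ex: "fexact Q B E A (fam Q f) (fam Q g) R S"
        by blast
      with sp E obtain S' where S': "fhom Q A E S'" "fam Q g * S' = idf Q A" unfolding all_split_def by blast
      from split_exact[OF Q(1,3) E ex S'] S' show ?thesis by blast
    qed
    have rel: "(\<xi>, \<eta>) \<in> extn_equiv Q A B" if xe: "\<xi> \<in> extensions Q A B" "\<eta> \<in> extensions Q A B" for \<xi> \<eta>
    proof -
      obtain E f g E' f' g' where [simp]: "\<xi> = (E, f, g)" "\<eta> = (E', f', g')" by (metis prod_cases3)
      obtain R S where 1: "fhom Q A E S" "fhom Q E B R" "fexact Q B E A (fam Q f) (fam Q g) R S"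
        using split[of E f g] xe(1) by (simp, blast)
      obtain R' S' where 2: "fhom Q A E' S'" "fhom Q E' B R'" "fexact Q B E' A (fam Q f') (fam Q g') R' S'"
        using split[of E' f' g'] xe(2) by (simp, blast)
      \<comment> \<open>Match the two splittings: project to B and include by f', project to A and
        lift by S'.\<close>
      let ?H = "fam Q f' * R + S' * fam Q g"
      have h: "fhom Q B E' (fam Q f')" "fhom Q E A (fam Q g)" and e: "R * fam Q f = idf Q B" "fam Q g' * S' = idf Q A"
        using 1 2 by (auto simp: fexact_def)
      have "fhom Q E E' ?H" by (intro fhom_add fhom_mult[OF h(1) 1(2)] fhom_mult[OF 2(1) h(2)])
      moreover have "?H * fam Q f = fam Q f'"
        using fexact_zero(1)[OF 1(3)] fhom_right[OF h(1)] by (simp add: distrib_right mult.assoc e)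
      moreover have "fam Q g' * ?H = fam Q g"
      proof -
        have "fam Q g' * ?H = (fam Q g' * fam Q f') * R + (fam Q g' * S') * fam Q g"
          by (simp add: distrib_left mult.assoc)
        then show ?thesis using fhom_left[OF h(2)] by (simp only: fexact_zero(1)[OF 2(3)] e) simp
      qed
      ultimately show ?thesis using extension_mor_id_iff[OF Q] xe by auto
    qed
    have "extn_equiv Q A B `` {\<xi>} = extensions Q A B" if "\<xi> \<in> extensions Q A B" for \<xi>
    proof -
      have "\<eta> \<in> extensions Q A B" if "(\<xi>, \<eta>) \<in> extn_equiv Q A B" for \<eta>
        using that by (auto simp: extn_equiv_def)
      then show ?thesis using rel[OF that] by blast
    qed
    then have "Ext1 Q A B = {extensions Q A B}"
      unfolding Ext1_def quotient_def using \<xi>0 by blast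
    then show "is_singleton (Ext1 Q A B)" by simp
  }
qed

lemma fexact_transport:
  assumes ex: "fexact Q B E A F G R S"
    and \<beta>: "fhom Q B' B \<beta>" "fhom Q B B' \<beta>'" "\<beta>' * \<beta> = idf Q B'" "\<beta> * \<beta>' = idf Q B"
    and \<alpha>: "fhom Q A A' \<alpha>" "fhom Q A' A \<alpha>'" "\<alpha>' * \<alpha> = idf Q A" "\<alpha> * \<alpha>' = idf Q A'"
  shows "fexact Q B' E A' (F * \<beta>) (\<alpha> * G) (\<beta>' * R) (S * \<alpha>')"
proof -
  have F: "fhom Q B E F" and G: "fhom Q E A G" and R: "fsup Q E B R" and S: "fsup Q A E S"
    and e: "R * F = idf Q B" "G * S = idf Q A" "F * R + S * G = idf Q E"
    using ex by (auto simp: fexact_def)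
  have a: "C * D * (I * J) = C * (D * I) * J" for C D I J :: "'a \<Rightarrow> 'c fmat"
    by (simp add: mult.assoc)
  show ?thesis
    unfolding fexact_def a e \<beta>(4) \<alpha>(3)
    using fhom_mult[OF F \<beta>(1)] fhom_mult[OF \<alpha>(1) G] fsup_mult[OF fhom_fsup[OF \<beta>(2)] R]
      fsup_mult[OF S fhom_fsup[OF \<alpha>(2)]] fhom_right[OF \<beta>(2)] fhom_right[OF \<alpha>(1)] fhom_right[OF F] fsup_right[OF S]
      \<beta>(3) \<alpha>(4) e(3)
    by simp
qed

lemma all_split_transport:
  assumes A: "fiso Q A A'" and B: "fiso Q B B'" and sp: "all_split Q A' B'"
  shows "all_split Q A B"
  unfolding all_split_def
proof (intro allI impI)
  fix E F G R S assume E: "is_rep Q E" and ex: "fexact Q B E A F G R S"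
  obtain \<alpha> \<alpha>' where \<alpha>: "fhom Q A A' \<alpha>" "fhom Q A' A \<alpha>'" "\<alpha>' * \<alpha> = idf Q A" "\<alpha> * \<alpha>' = idf Q A'"
    using A by (auto simp: fiso_def)
  obtain \<beta> \<beta>' where \<beta>: "fhom Q B' B \<beta>" "fhom Q B B' \<beta>'" "\<beta>' * \<beta> = idf Q B'" "\<beta> * \<beta>' = idf Q B"
    using B by (auto simp: fiso_def)
  obtain S' where S': "fhom Q A' E S'" "\<alpha> * G * S' = idf Q A'"
    using sp E fexact_transport[OF ex \<beta> \<alpha>] unfolding all_split_def by blast
  have G: "fhom Q E A G" using ex by (simp add: fexact_def)
  have "G * (S' * \<alpha>) = \<alpha>' * (\<alpha> * G * S') * \<alpha>"
    using fhom_left[OF G] by (simp add: mult.assoc) (simp add: \<alpha>(3) flip: mult.assoc)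
  then have "G * (S' * \<alpha>) = idf Q A" unfolding S'(2) using fhom_right[OF \<alpha>(2)] \<alpha>(3) by simp
  then show "\<exists>S'. fhom Q A E S' \<and> G * S' = idf Q A" using fhom_mult[OF S'(1) \<alpha>(1)] by blast
qed

text \<open>F and S together embed the direct sum of B and A into E at each vertex, with left
  inverse given by R and G.\<close>

lemma fexact_vdim:
  assumes ex: "fexact Q B E A F G R S" and v: "v \<in> verts Q"
  shows "vdim B v + vdim A v \<le> vdim E v"
proof -
  note z = fexact_zero[OF ex]
  let ?x = "F * prl Q B A + S * prr Q B A" and ?y = "inl Q B A * R + inr Q B A * G"
  have s: "fsup Q B E F" "fsup Q E A G" "fsup Q E B R" "fsup Q A E S" and e: "R * F = idf Q B" "G * S = idf Q A"
    using ex by (auto simp: fexact_def fhom_fsup)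
  note B = biproduct_fsup[where Q = Q and V = B and W = A] and b = biproduct_equations[of Q B A]
  have x: "fsup Q (dsum B A) E ?x" and y: "fsup Q E (dsum B A) ?y"
    using B s by (auto intro!: fsup_add intro: fsup_mult)
  have a: "C * D * (I * J) = C * (D * I) * J" for C D I J :: "'a \<Rightarrow> 'c fmat"
    by (simp add: mult.assoc)
  have yx: "?y * ?x = idf Q (dsum B A)"
    using fsup_right[OF B(1)] fsup_right[OF B(3)] by (simp add: distrib_left distrib_right a b e z)
  have "fcar (vdim E v) (vdim B v + vdim A v) (?x v)" "fcar (vdim B v + vdim A v) (vdim E v) (?y v)"
    using x[unfolded fsup_iff, rule_format, of v] y[unfolded fsup_iff, rule_format, of v] v by (simp_all only: if_True vdim_dsum)
  moreover have "?y v * ?x v = idm (vdim B v + vdim A v)"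
    using fun_cong[OF yx, of v] v by (simp add: idf_def)
  ultimately show ?thesis by (rule left_inverse_dim_le)
qed

section \<open>Classification of extensions by cocycles when the ends have disjoint supports\<close>

definition disjoint_supp :: "('v, 'a) pre_digraph \<Rightarrow> ('v, 'a, 'k::field) qrep \<Rightarrow> ('v, 'a, 'k) qrep \<Rightarrow> bool" where
  "disjoint_supp Q A B \<longleftrightarrow> (\<forall>v\<in>verts Q. vdim A v = 0 \<or> vdim B v = 0)"

lemma fsup_disjoint: "disjoint_supp Q A B \<Longrightarrow> fsup Q A B k \<Longrightarrow> k = 0"
  unfolding disjoint_supp_def fsup_iff fun_eq_iff by (metis fcar_trivial zero_fun_apply)

text \<open>\<open>R\<close> and \<open>S\<close> split the sequence at each vertex, but need not commute with the arrows; the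
  cocycle measures this failure. When \<open>A\<close> and \<open>B\<close> have no common vertex, every family of matrices
  is a cocycle and equivalent extensions have equal cocycles.\<close>

definition cocycle_of ::
    "('v, 'a) pre_digraph \<Rightarrow> ('v, 'a, 'k::field) qrep \<Rightarrow> ('v \<Rightarrow> 'k fmat) \<Rightarrow> ('v \<Rightarrow> 'k fmat) \<Rightarrow> 'a \<Rightarrow> 'k fmat" where
  "cocycle_of Q E R S a = R (head Q a) * mm E a * S (tail Q a)"

text \<open>In the decomposition of E that R and S provide, an arrow acts by a triangular block
  matrix: the actions on B and A stand on the diagonal and the cocycle in the corner from A to
  B.\<close>

lemma exact_arc_expansion:
  assumes Q: "wf_digraph Q" "is_rep Q B" "is_rep Q E" "is_rep Q A" and ex: "fexact Q B E A F G R S" and a: "a \<in> arcs Q"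
  shows "R (head Q a) * mm E a = mm B a * R (tail Q a) + cocycle_of Q E R S a * G (tail Q a)"
    "mm E a * S (tail Q a) = F (head Q a) * cocycle_of Q E R S a + S (head Q a) * mm A a"
proof -
  let ?h = "head Q a" and ?t = "tail Q a"
  have hF: "F ?h * mm B a = mm E a * F ?t" and hG: "G ?h * mm E a = mm A a * G ?t"
    using ex a by (auto simp: fhom_def fexact_def)
  have e: "R * F = idf Q B" "G * S = idf Q A" "F * R + S * G = idf Q E" using ex by (auto simp: fexact_def)
  have ev: "R v * F v = idf Q B v" "G v * S v = idf Q A v" "F v * R v + S v * G v = idf Q E v" for v
    using fun_cong[OF e(1), of v] fun_cong[OF e(2), of v] fun_cong[OF e(3), of v] by auto
  have "R ?h * mm E a = R ?h * mm E a * (F ?t * R ?t + S ?t * G ?t)"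
    unfolding ev by (simp add: idf_mm[OF Q(1,3) a] mult.assoc)
  also have "\<dots> = R ?h * (mm E a * F ?t) * R ?t + cocycle_of Q E R S a * G ?t"
    by (simp add: cocycle_of_def distrib_left mult.assoc)
  also have "R ?h * (mm E a * F ?t) = R ?h * F ?h * mm B a" unfolding hF[symmetric] by (simp add: mult.assoc)
  also have "\<dots> = mm B a" by (simp add: ev idf_mm[OF Q(1,2) a])
  finally show "R ?h * mm E a = mm B a * R ?t + cocycle_of Q E R S a * G ?t" .
  have "mm E a * S ?t = (F ?h * R ?h + S ?h * G ?h) * mm E a * S ?t"
    unfolding ev by (simp add: idf_mm[OF Q(1,3) a])
  also have "\<dots> = F ?h * cocycle_of Q E R S a + S ?h * (G ?h * mm E a) * S ?t"
    by (simp add: cocycle_of_def distrib_right mult.assoc)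
  also have "S ?h * (G ?h * mm E a) * S ?t = S ?h * (mm A a * (G ?t * S ?t))"
    unfolding hG by (simp add: mult.assoc)
  also have "\<dots> = S ?h * mm A a" by (simp add: ev idf_mm[OF Q(1,4) a])
  finally show "mm E a * S ?t = F ?h * cocycle_of Q E R S a + S ?h * mm A a" .
qed

text \<open>Replacing S by \<open>S - F * k\<close> changes the cocycle by the coboundary of k. Here
  this makes it zero, and a section with zero cocycle commutes with the arrows.\<close>

lemma cobound_splits:
  assumes Q: "wf_digraph Q" "is_rep Q B" "is_rep Q E" "is_rep Q A"
    and ex: "fexact Q B E A F G R S" and k: "fsup Q A B k"
    and z: "\<And>a. a \<in> arcs Q \<Longrightarrow> cocycle_of Q E R S a = mm B a * k (tail Q a) - k (head Q a) * mm A a"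
  shows "\<exists>S'. fhom Q A E S' \<and> G * S' = idf Q A"
proof -
  have F: "fhom Q B E F" and S: "fsup Q A E S" and e: "G * S = idf Q A"
    using ex by (auto simp: fexact_def)
  let ?S = "S - F * k"
  have "G * ?S = G * S - (G * F) * k" by (simp add: right_diff_distrib mult.assoc)
  then have "G * ?S = idf Q A" by (simp add: fexact_zero(1)[OF ex] e)
  moreover have "fhom Q A E ?S"
    unfolding fhom_def
  proof (intro conjI ballI)
    show "fsup Q A E ?S" by (intro fsup_diff S fsup_mult[OF fhom_fsup[OF F] k])
    fix a assume a: "a \<in> arcs Q"
    let ?h = "head Q a" and ?t = "tail Q a"
    have hF: "mm E a * F ?t = F ?h * mm B a" using F a by (simp add: fhom_def)
    have "mm E a * S ?t = F ?h * (mm B a * k ?t - k ?h * mm A a) + S ?h * mm A a"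
      using exact_arc_expansion(2)[OF Q ex a] by (simp add: z[OF a])
    moreover have "mm E a * (F ?t * k ?t) = F ?h * (mm B a * k ?t)"
      using hF by (simp flip: mult.assoc)
    ultimately show "?S ?h * mm A a = mm E a * ?S ?t"
      by (simp add: right_diff_distrib left_diff_distrib mult.assoc)
  qed
  ultimately show ?thesis by blast
qed

text \<open>Relative to the vertexwise splittings a morphism of sequences has the diagonal blocks
  \<beta> and \<alpha> and one further block, from A to B'. That block vanishes as A and B' share no
  vertex. So H is determined by \<beta> and \<alpha>, and its compatibility with the arrows is the
  equation of the cocycles.\<close>

lemma cocycle_mor_iff:
  assumes Q: "wf_digraph Q" and r: "is_rep Q B" "is_rep Q E" "is_rep Q A" "is_rep Q B'" "is_rep Q E'" "is_rep Q A'"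
    and dis: "disjoint_supp Q A B'"
    and ex: "fexact Q B E A F G R S" and ex': "fexact Q B' E' A' F' G' R' S'"
    and \<beta>: "fhom Q B B' \<beta>" and \<alpha>: "fhom Q A A' \<alpha>"
  shows "(\<exists>H. fhom Q E E' H \<and> H * F = F' * \<beta> \<and> G' * H = \<alpha> * G) \<longleftrightarrow>
    (\<forall>a\<in>arcs Q. \<beta> (head Q a) * cocycle_of Q E R S a = cocycle_of Q E' R' S' a * \<alpha> (tail Q a))"
proof
  have F: "fhom Q B E F" and G: "fhom Q E A G" and R: "fsup Q E B R" and S: "fsup Q A E S"
    and e: "R * F = idf Q B" "G * S = idf Q A" "F * R + S * G = idf Q E"
    using ex by (auto simp: fexact_def)
  have F': "fhom Q B' E' F'" and G': "fhom Q E' A' G'" and R': "fsup Q E' B' R'" and S': "fsup Q A' E' S'"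
    and e': "R' * F' = idf Q B'" "G' * S' = idf Q A'" "F' * R' + S' * G' = idf Q E'"
    using ex' by (auto simp: fexact_def)
  {
    assume "\<exists>H. fhom Q E E' H \<and> H * F = F' * \<beta> \<and> G' * H = \<alpha> * G"
    then obtain H where H: "fhom Q E E' H" "H * F = F' * \<beta>" "G' * H = \<alpha> * G" by blast
    have z: "R' * H * S = 0"
      by (rule fsup_disjoint[OF dis]) (intro fsup_mult[OF fsup_mult[OF R' fhom_fsup[OF H(1)]] S])
    have "H * S = idf Q E' * H * S" using fhom_left[OF H(1)] by simp
    also have "\<dots> = F' * (R' * H * S) + S' * (G' * H) * S"
      unfolding e'(3)[symmetric] by (simp add: distrib_right mult.assoc)
    also have "\<dots> = S' * \<alpha> * (G * S)" unfolding z H(3) by (simp add: mult.assoc)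
    also have "\<dots> = S' * \<alpha>" unfolding e using fhom_right[OF \<alpha>] by (simp add: mult.assoc)
    finally have HS: "H * S = S' * \<alpha>" .
    have "R' * H = R' * (H * idf Q E)" using fhom_right[OF H(1)] by simp
    also have "\<dots> = R' * (H * F) * R + (R' * H * S) * G"
      unfolding e(3)[symmetric] by (simp add: distrib_left mult.assoc)
    also have "\<dots> = (R' * F') * \<beta> * R" unfolding z H(2) by (simp add: mult.assoc)
    also have "\<dots> = \<beta> * R" unfolding e' using fhom_left[OF \<beta>] by simp
    finally have RH: "R' * H = \<beta> * R" .
    show "\<forall>a\<in>arcs Q. \<beta> (head Q a) * cocycle_of Q E R S a = cocycle_of Q E' R' S' a * \<alpha> (tail Q a)"
    proof
      fix a assume a: "a \<in> arcs Q"
      let ?h = "head Q a" and ?t = "tail Q a"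
      have v: "\<beta> v * R v = R' v * H v" "H v * S v = S' v * \<alpha> v" for v
        using fun_cong[OF RH, of v] fun_cong[OF HS, of v] by auto
      have "\<beta> ?h * cocycle_of Q E R S a = \<beta> ?h * R ?h * mm E a * S ?t"
        by (simp add: cocycle_of_def mult.assoc)
      also have "\<dots> = R' ?h * (H ?h * mm E a) * S ?t" unfolding v(1) by (simp add: mult.assoc)
      also have "H ?h * mm E a = mm E' a * H ?t" using H(1) a by (simp add: fhom_def)
      also have "R' ?h * (mm E' a * H ?t) * S ?t = R' ?h * mm E' a * (H ?t * S ?t)" by (simp add: mult.assoc)
      finally show "\<beta> ?h * cocycle_of Q E R S a = cocycle_of Q E' R' S' a * \<alpha> ?t"
        unfolding v(2) by (simp add: cocycle_of_def mult.assoc)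
    qed
  next
    assume z: "\<forall>a\<in>arcs Q. \<beta> (head Q a) * cocycle_of Q E R S a = cocycle_of Q E' R' S' a * \<alpha> (tail Q a)"
    let ?H = "F' * \<beta> * R + S' * \<alpha> * G"
    have "fhom Q E E' ?H"
      unfolding fhom_def
    proof (intro conjI ballI)
      show "fsup Q E E' ?H"
        by (intro fsup_add fsup_mult[OF fsup_mult[OF fhom_fsup[OF F'] fhom_fsup[OF \<beta>]] R]
            fsup_mult[OF fsup_mult[OF S' fhom_fsup[OF \<alpha>]] fhom_fsup[OF G]])
      fix a assume a: "a \<in> arcs Q"
      let ?h = "head Q a" and ?t = "tail Q a" and ?z = "cocycle_of Q E R S a" and ?z' = "cocycle_of Q E' R' S' a"
      have hG: "G ?h * mm E a = mm A a * G ?t" and hF: "F' ?h * mm B' a = mm E' a * F' ?t"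
        and h\<beta>: "\<beta> ?h * mm B a = mm B' a * \<beta> ?t" and h\<alpha>: "\<alpha> ?h * mm A a = mm A' a * \<alpha> ?t"
        using G F' \<beta> \<alpha> a by (auto simp: fhom_def)
      have "?H ?h * mm E a = F' ?h * \<beta> ?h * (R ?h * mm E a) + S' ?h * \<alpha> ?h * (G ?h * mm E a)"
        by (simp add: distrib_right mult.assoc)
      also have "\<dots> = F' ?h * (\<beta> ?h * mm B a) * R ?t + F' ?h * (\<beta> ?h * ?z) * G ?t + S' ?h * (\<alpha> ?h * mm A a) * G ?t"
        unfolding exact_arc_expansion(1)[OF Q r(1-3) ex a] hG by (simp add: distrib_left mult.assoc)
      also have "\<dots> = F' ?h * (mm B' a * \<beta> ?t) * R ?t + F' ?h * (?z' * \<alpha> ?t) * G ?t + S' ?h * (mm A' a * \<alpha> ?t) * G ?t"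
        unfolding h\<beta> h\<alpha> using z a by simp
      also have "\<dots> = (F' ?h * mm B' a) * \<beta> ?t * R ?t + (F' ?h * ?z' + S' ?h * mm A' a) * \<alpha> ?t * G ?t"
        by (simp add: distrib_right mult.assoc)
      also have "\<dots> = mm E' a * ?H ?t"
        unfolding hF exact_arc_expansion(2)[OF Q r(4-6) ex' a, symmetric] by (simp add: distrib_left mult.assoc)
      finally show "?H ?h * mm E a = mm E' a * ?H ?t" .
    qed
    moreover have "?H * F = F' * \<beta>"
      using fhom_right[OF \<beta>] by (simp add: distrib_right mult.assoc e fexact_zero(1)[OF ex])
    moreover have "G' * ?H = \<alpha> * G"
    proof -
      have "G' * ?H = (G' * F') * \<beta> * R + (G' * S') * \<alpha> * G" by (simp add: distrib_left mult.assoc)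
      then show ?thesis unfolding e' fexact_zero(1)[OF ex'] using fhom_left[OF \<alpha>] by simp
    qed
    ultimately show "\<exists>H. fhom Q E E' H \<and> H * F = F' * \<beta> \<and> G' * H = \<alpha> * G" by blast
  }
qed

text \<open>Add z to the arrows of the direct sum, in the block from A to B. No condition on z
  arises, because a quiver without relations imposes none on its matrices.\<close>

lemma extension_with_cocycle:
  assumes Q: "wf_digraph Q" "is_rep Q B" "is_rep Q A"
    and z: "\<And>a. a \<in> arcs Q \<Longrightarrow> fcar (vdim B (head Q a)) (vdim A (tail Q a)) (z a)"
  shows "\<exists>E F G R S. is_rep Q E \<and> fexact Q B E A F G R S \<and> (\<forall>a\<in>arcs Q. cocycle_of Q E R S a = z a)"
proof -
  let ?i = "inl Q B A" and ?j = "inr Q B A" and ?p = "prl Q B A" and ?q = "prr Q B A"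
  note B = biproduct_fsup[where Q = Q and V = B and W = A] and b = biproduct_equations[of Q B A]
  note H = biproduct_fhom[OF Q]
  define M where "M a = mm (dsum B A) a + ?i (head Q a) * z a * ?q (tail Q a)" for a
  define E where "E = \<lparr>vdim = vdim (dsum B A),
    amap = (\<lambda>a. mat_of (vdim (dsum B A) (head Q a)) (vdim (dsum B A) (tail Q a)) (M a))\<rparr>"
  have E: "is_rep Q E" by (simp add: is_rep_def E_def)
  have dE: "vdim E v = vdim (dsum B A) v" for v by (simp add: E_def)
  have supE: "fsup Q V E X \<longleftrightarrow> fsup Q V (dsum B A) X" "fsup Q E V X \<longleftrightarrow> fsup Q (dsum B A) V X" for V X
    by (simp_all add: fsup_iff dE)
  have bv: "?p v * ?i v = idf Q B v" "?q v * ?j v = idf Q A v" "?p v * ?j v = 0" "?q v * ?i v = 0" for v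
    using fun_cong[OF b(1), of v] fun_cong[OF b(2), of v] fun_cong[OF b(3), of v] fun_cong[OF b(4), of v] by auto
  have zi: "idf Q B (head Q a) * z a = z a" "z a * idf Q A (tail Q a) = z a" if "a \<in> arcs Q" for a
    using z[OF that] that Q(1) by (auto simp: idf_def wf_digraph_def fcar_def)
  have mE: "mm E a = M a" if a: "a \<in> arcs Q" for a
  proof -
    have v: "head Q a \<in> verts Q" "tail Q a \<in> verts Q" using Q(1) a by (auto simp: wf_digraph_def)
    have "fcar (vdim (dsum B A) (head Q a)) (vdim B (head Q a)) (?i (head Q a))"
      "fcar (vdim A (tail Q a)) (vdim (dsum B A) (tail Q a)) (?q (tail Q a))"
      using B(1)[unfolded fsup_iff, rule_format, of "head Q a"] B(4)[unfolded fsup_iff, rule_format, of "tail Q a"] v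
      by (simp_all only: if_True)
    then have "fcar (vdim (dsum B A) (head Q a)) (vdim (dsum B A) (tail Q a)) (?i (head Q a) * z a * ?q (tail Q a))"
      using z[OF a] by (meson fcar_mult)
    then have "fcar (vdim (dsum B A) (head Q a)) (vdim (dsum B A) (tail Q a)) (M a)"
      using fcar_mm[OF is_rep_dsum[OF Q(2,3)] a] unfolding M_def fcar_def by (simp only: distrib_left distrib_right)
    moreover have "amap E a = mat_of (vdim (dsum B A) (head Q a)) (vdim (dsum B A) (tail Q a)) (M a)"
      by (simp add: E_def)
    ultimately show ?thesis unfolding mm_def[of E a] by (simp only: fm_of_mat_of)
  qed
  have bv': "?p v * (?i v * X) = idf Q B v * X" "?q v * (?j v * X) = idf Q A v * X" "?p v * (?j v * X) = 0"
    "?q v * (?i v * X) = 0" for v X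
    using bv[of v] by (simp_all flip: mult.assoc)
  have zi': "idf Q B (head Q a) * (z a * X) = z a * X" if "a \<in> arcs Q" for a X
    using zi[OF that] by (simp flip: mult.assoc)
  have hi: "fhom Q B E ?i"
    using H(1) by (auto simp: fhom_def supE mE M_def distrib_right mult.assoc bv)
  have hq: "fhom Q E A ?q"
    using H(4) by (auto simp: fhom_def supE mE M_def distrib_left bv bv' mult.assoc)
  have "idf Q E = idf Q (dsum B A)" unfolding idf_def dE ..
  then have "fexact Q B E A ?i ?q ?p ?j"
    using hi hq B b by (simp add: fexact_def supE)
  moreover have "cocycle_of Q E ?p ?j a = z a" if a: "a \<in> arcs Q" for a
  proof -
    have "mm (dsum B A) a * ?j (tail Q a) = ?j (head Q a) * mm A a"
      using H(3) a by (simp add: fhom_def)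
    then have "?p (head Q a) * (mm (dsum B A) a * ?j (tail Q a)) = 0" by (simp add: bv')
    then show ?thesis
      using a by (simp add: cocycle_of_def mE M_def distrib_left distrib_right mult.assoc bv bv' zi zi')
  qed
  ultimately show ?thesis using E by blast
qed

text \<open>A relation and not a function, since the cocycle depends on the chosen vertexwise
  splitting; for disjoint supports it becomes single-valued, by \<open>cocyc_unique\<close>.\<close>

definition cocyc ::
    "('v, 'a) pre_digraph \<Rightarrow> ('v, 'a, 'k::field) qrep \<Rightarrow> ('v, 'a, 'k) qrep \<Rightarrow> ('v, 'a, 'k) extn \<Rightarrow> ('a \<Rightarrow> 'k fmat) \<Rightarrow> bool"
  where "cocyc Q A B = (\<lambda>(E, f, g) z. (E, f, g) \<in> extensions Q A B \<and>
    (\<exists>R S. fexact Q B E A (fam Q f) (fam Q g) R S \<and> (\<forall>a\<in>arcs Q. cocycle_of Q E R S a = z a)))"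

lemma cocyc_extension: "cocyc Q A B \<xi> z \<Longrightarrow> \<xi> \<in> extensions Q A B"
  by (auto simp: cocyc_def)

lemma cocyc_cong: "cocyc Q A B \<xi> z \<Longrightarrow> (\<And>a. a \<in> arcs Q \<Longrightarrow> z a = w a) \<Longrightarrow> cocyc Q A B \<xi> w"
  by (cases \<xi>) (simp add: cocyc_def)

lemma fcar_cocycle:
  assumes Q: "wf_digraph Q" "is_rep Q E" and R: "fsup Q E B R" and S: "fsup Q A E S" and a: "a \<in> arcs Q"
  shows "fcar (vdim B (head Q a)) (vdim A (tail Q a)) (cocycle_of Q E R S a)"
proof -
  have v: "head Q a \<in> verts Q" "tail Q a \<in> verts Q" using Q(1) a by (auto simp: wf_digraph_def)
  then show ?thesis
    unfolding cocycle_of_def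
    using R[unfolded fsup_iff, rule_format, of "head Q a"] S[unfolded fsup_iff, rule_format, of "tail Q a"]
      fcar_mm[OF Q(2) a] by (simp only: if_True) (meson fcar_mult)
qed

lemma cocyc_exists:
  assumes Q: "wf_digraph Q" "is_rep Q A" "is_rep Q B" and \<xi>: "\<xi> \<in> extensions Q A B"
  shows "\<exists>z. cocyc Q A B \<xi> z"
proof -
  obtain E f g where e: "\<xi> = (E, f, g)" by (metis prod_cases3)
  have E: "is_rep Q E" "short_exact Q B E A f g" using \<xi> by (auto simp: e extensions_def)
  from short_exactD[OF Q(1,3) E(1) Q(2) E(2)] show ?thesis
    using \<xi> unfolding e cocyc_def by auto
qed

lemma cocyc_fcar:
  assumes Q: "wf_digraph Q" and z: "cocyc Q A B \<xi> z" and a: "a \<in> arcs Q"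
  shows "fcar (vdim B (head Q a)) (vdim A (tail Q a)) (z a)"
proof -
  obtain E f g where e: "\<xi> = (E, f, g)" by (metis prod_cases3)
  obtain R S where "is_rep Q E" "fexact Q B E A (fam Q f) (fam Q g) R S" "cocycle_of Q E R S a = z a"
    using z a by (auto simp: e cocyc_def extensions_def)
  then show ?thesis using fcar_cocycle[OF Q, of E B R A S a] a by (simp add: fexact_def)
qed

lemma cocyc_realized:
  assumes Q: "wf_digraph Q" "is_rep Q A" "is_rep Q B"
    and z: "\<And>a. a \<in> arcs Q \<Longrightarrow> fcar (vdim B (head Q a)) (vdim A (tail Q a)) (z a)"
  shows "\<exists>\<xi>. cocyc Q A B \<xi> z"
proof -
  obtain E F G R S where E: "is_rep Q E" and ex: "fexact Q B E A F G R S"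
    and c: "\<forall>a\<in>arcs Q. cocycle_of Q E R S a = z a"
    using extension_with_cocycle[OF Q(1,3,2) z] by blast
  have f: "fam Q (unfam B E F) = F" "fam Q (unfam E A G) = G"
    using ex by (auto intro!: fam_unfam fhom_fsup simp: fexact_def)
  have "cocyc Q A B (E, unfam B E F, unfam E A G) z"
    using E short_exact_unfam[OF Q(1,3) E Q(2) ex] ex c f by (auto simp: cocyc_def extensions_def)
  then show ?thesis by blast
qed

lemma cocyc_mor_iff:
  assumes Q: "wf_digraph Q" and r: "is_rep Q A" "is_rep Q B" "is_rep Q A'" "is_rep Q B'"
    and dis: "disjoint_supp Q A B'"
    and z: "cocyc Q A B \<xi> z" and z': "cocyc Q A' B' \<xi>' z'"
    and \<beta>c: "\<And>v. v \<in> verts Q \<Longrightarrow> \<beta> v \<in> carrier_mat (vdim B' v) (vdim B v)"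
    and \<alpha>c: "\<And>v. v \<in> verts Q \<Longrightarrow> \<alpha> v \<in> carrier_mat (vdim A' v) (vdim A v)"
    and \<beta>: "fhom Q B B' (fam Q \<beta>)" and \<alpha>: "fhom Q A A' (fam Q \<alpha>)"
  shows "extn_mor Q \<beta> \<alpha> \<xi> \<xi>' \<longleftrightarrow>
    (\<forall>a\<in>arcs Q. fam Q \<beta> (head Q a) * z a = z' a * fam Q \<alpha> (tail Q a))"
proof -
  obtain E f g E' f' g' where e: "\<xi> = (E, f, g)" "\<xi>' = (E', f', g')" by (metis prod_cases3)
  obtain R S where x: "is_rep Q E" "short_exact Q B E A f g" "fexact Q B E A (fam Q f) (fam Q g) R S"
    "\<forall>a\<in>arcs Q. cocycle_of Q E R S a = z a"
    using z by (auto simp: e cocyc_def extensions_def)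
  obtain R' S' where y: "is_rep Q E'" "short_exact Q B' E' A' f' g'" "fexact Q B' E' A' (fam Q f') (fam Q g') R' S'"
    "\<forall>a\<in>arcs Q. cocycle_of Q E' R' S' a = z' a"
    using z' by (auto simp: e cocyc_def extensions_def)
  have h: "rep_hom Q B E f" "rep_hom Q B' E' f'" "rep_hom Q E A g" "rep_hom Q E' A' g'"
    using x y by (auto simp: short_exact_def)
  have "extn_mor Q \<beta> \<alpha> (E, f, g) (E', f', g') \<longleftrightarrow>
    (\<exists>H. fhom Q E E' H \<and> H * fam Q f = fam Q f' * fam Q \<beta> \<and> fam Q g' * H = fam Q \<alpha> * fam Q g)"
    by (rule extn_mor_iff[OF Q x(1) y(1) h \<beta>c \<alpha>c])
  also have "\<dots> \<longleftrightarrow> (\<forall>a\<in>arcs Q.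
      fam Q \<beta> (head Q a) * cocycle_of Q E R S a = cocycle_of Q E' R' S' a * fam Q \<alpha> (tail Q a))"
    by (rule cocycle_mor_iff[OF Q r(2) x(1) r(1) r(4) y(1) r(3) dis x(3) y(3) \<beta> \<alpha>])
  finally show ?thesis using x(4) y(4) by (simp add: e)
qed

lemma cocyc_equiv_iff:
  assumes Q: "wf_digraph Q" and r: "is_rep Q A" "is_rep Q B" and dis: "disjoint_supp Q A B"
    and z: "cocyc Q A B \<xi> z" and w: "cocyc Q A B \<eta> w"
  shows "(\<xi>, \<eta>) \<in> extn_equiv Q A B \<longleftrightarrow> (\<forall>a\<in>arcs Q. z a = w a)"
proof -
  have "idf Q B (head Q a) * z a = z a" "w a * idf Q A (tail Q a) = w a" if "a \<in> arcs Q" for a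
    using cocyc_fcar[OF Q z that] cocyc_fcar[OF Q w that] that Q by (auto simp: idf_def wf_digraph_def fcar_def)
  moreover have "extn_mor Q (id_fam B) (id_fam A) \<xi> \<eta> \<longleftrightarrow>
    (\<forall>a\<in>arcs Q. fam Q (id_fam B) (head Q a) * z a = w a * fam Q (id_fam A) (tail Q a))"
    by (rule cocyc_mor_iff[OF Q r r dis z w]) (auto simp: id_fam_carrier fhom_idf[OF Q] r)
  ultimately show ?thesis
    using cocyc_extension[OF z] cocyc_extension[OF w] by (simp add: extn_equiv_def)
qed

lemma cocyc_unique:
  assumes Q: "wf_digraph Q" and r: "is_rep Q A" "is_rep Q B" and dis: "disjoint_supp Q A B"
    and z: "cocyc Q A B \<xi> z" and w: "cocyc Q A B \<xi> w" and a: "a \<in> arcs Q"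
  shows "z a = w a"
proof -
  have "(\<xi>, \<xi>) \<in> extn_equiv Q A B" using cocyc_equiv_iff[OF Q r dis z z] by simp
  then show ?thesis using cocyc_equiv_iff[OF Q r dis z w] a by simp
qed

text \<open>The block diagonal cocycle, obtained from the direct sums of the vertexwise splittings.
  It is what the Baer sum starts from.\<close>

lemma cocyc_dsum:
  fixes A B :: "('v, 'a, 'k::field) qrep"
  assumes Q: "wf_digraph Q" and r: "is_rep Q A" "is_rep Q B"
    and z: "cocyc Q A B \<xi> z" and w: "cocyc Q A B \<eta> w"
  shows "cocyc Q (dsum A A) (dsum B B) (extn_dsum \<xi> \<eta>)
    (\<lambda>a. inl Q B B (head Q a) * z a * prl Q A A (tail Q a) + inr Q B B (head Q a) * w a * prr Q A A (tail Q a))"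
proof -
  obtain E f g E' f' g' where e: "\<xi> = (E, f, g)" "\<eta> = (E', f', g')" by (metis prod_cases3)
  obtain R S where x: "is_rep Q E" "short_exact Q B E A f g" "fexact Q B E A (fam Q f) (fam Q g) R S"
    "\<forall>a\<in>arcs Q. cocycle_of Q E R S a = z a"
    using z by (auto simp: e cocyc_def extensions_def)
  obtain R' S' where y: "is_rep Q E'" "short_exact Q B E' A f' g'" "fexact Q B E' A (fam Q f') (fam Q g') R' S'"
    "\<forall>a\<in>arcs Q. cocycle_of Q E' R' S' a = w a"
    using w by (auto simp: e cocyc_def extensions_def)
  have h: "rep_hom Q B E f" "rep_hom Q B E' f'" "rep_hom Q E A g" "rep_hom Q E' A g'"
    using x y by (auto simp: short_exact_def)
  note hc = rep_homD[OF h(1)] rep_homD[OF h(2)] rep_homD[OF h(3)] rep_homD[OF h(4)]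
  let ?F = "fam Q f" and ?G = "fam Q g" and ?F' = "fam Q f'" and ?G' = "fam Q g'"
  let ?i = "inl Q E E'" and ?j = "inr Q E E'" and ?p = "prl Q E E'" and ?q = "prr Q E E'"
  have ff: "fam Q (\<lambda>v. dsum_mat (f v) (f' v)) = ?i * ?F * prl Q B B + ?j * ?F' * prr Q B B"
    by (rule fam_dsum_mat) (use hc in auto)
  have gg: "fam Q (\<lambda>v. dsum_mat (g v) (g' v)) = inl Q A A * ?G * ?p + inr Q A A * ?G' * ?q"
    by (rule fam_dsum_mat) (use hc in auto)
  have rr: "is_rep Q (dsum E E')" "is_rep Q (dsum A A)" "is_rep Q (dsum B B)"
    using x(1) y(1) r by (auto intro: is_rep_dsum)
  let ?R = "inl Q B B * R * ?p + inr Q B B * R' * ?q" and ?S = "?i * S * prl Q A A + ?j * S' * prr Q A A"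
  have F: "fhom Q B E ?F" "fhom Q E A ?G" "fsup Q E B R" "fsup Q A E S" "R * ?F = idf Q B" "?G * S = idf Q A"
    "?F * R + S * ?G = idf Q E" using x(3) by (auto simp: fexact_def)
  have F': "fhom Q B E' ?F'" "fhom Q E' A ?G'" "fsup Q E' B R'" "fsup Q A E' S'" "R' * ?F' = idf Q B" "?G' * S' = idf Q A"
    "?F' * R' + S' * ?G' = idf Q E'" using y(3) by (auto simp: fexact_def)
  note BE = biproduct_fhom[OF Q x(1) y(1)] and BA = biproduct_fhom[OF Q r(1) r(1)] and BB = biproduct_fhom[OF Q r(2) r(2)]
  note b = biproduct_equations[of Q E E'] biproduct_equations[of Q A A] biproduct_equations[of Q B B]
  have a: "C * D * (I * J) = C * (D * I) * J" for C D I J :: "'v \<Rightarrow> 'k fmat"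
    by (simp add: mult.assoc)
  have a': "C * X * D * (I * Y * J) = C * (X * (D * I) * Y) * J" for C D I J X Y :: "'v \<Rightarrow> 'k fmat"
    by (simp add: mult.assoc)
  have ex: "fexact Q (dsum B B) (dsum E E') (dsum A A) (fam Q (\<lambda>v. dsum_mat (f v) (f' v)))
      (fam Q (\<lambda>v. dsum_mat (g v) (g' v))) ?R ?S"
    unfolding fexact_def ff gg
  proof (intro conjI)
    show "fhom Q (dsum B B) (dsum E E') (?i * ?F * prl Q B B + ?j * ?F' * prr Q B B)"
      by (intro fhom_add fhom_mult[OF fhom_mult[OF BE(1) F(1)] BB(2)] fhom_mult[OF fhom_mult[OF BE(3) F'(1)] BB(4)])
    show "fhom Q (dsum E E') (dsum A A) (inl Q A A * ?G * ?p + inr Q A A * ?G' * ?q)"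
      by (intro fhom_add fhom_mult[OF fhom_mult[OF BA(1) F(2)] BE(2)] fhom_mult[OF fhom_mult[OF BA(3) F'(2)] BE(4)])
    note s = BE[THEN fhom_fsup] BA[THEN fhom_fsup] BB[THEN fhom_fsup]
    show "fsup Q (dsum E E') (dsum B B) ?R"
      by (intro fsup_add fsup_mult[OF fsup_mult[OF s(9) F(3)] s(2)] fsup_mult[OF fsup_mult[OF s(11) F'(3)] s(4)])
    show "fsup Q (dsum A A) (dsum E E') ?S"
      by (intro fsup_add fsup_mult[OF fsup_mult[OF s(1) F(4)] s(6)] fsup_mult[OF fsup_mult[OF s(3) F'(4)] s(8)])
    show "?R * (?i * ?F * prl Q B B + ?j * ?F' * prr Q B B) = idf Q (dsum B B)"
      using fsup_right[OF F(3)] fsup_right[OF F'(3)] fhom_right[OF BB(1)] fhom_right[OF BB(3)]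
      by (simp add: distrib_left distrib_right a' b F F')
    show "(inl Q A A * ?G * ?p + inr Q A A * ?G' * ?q) * ?S = idf Q (dsum A A)"
      using fhom_right[OF F(2)] fhom_right[OF F'(2)] fhom_right[OF BA(1)] fhom_right[OF BA(3)]
      by (simp add: distrib_left distrib_right a' b F F')
    have "(?i * ?F * prl Q B B + ?j * ?F' * prr Q B B) * ?R + ?S * (inl Q A A * ?G * ?p + inr Q A A * ?G' * ?q)
      = ?i * (?F * R + S * ?G) * ?p + ?j * (?F' * R' + S' * ?G') * ?q"
      using fhom_right[OF F(1)] fhom_right[OF F'(1)] fsup_right[OF F(4)] fsup_right[OF F'(4)]
      by (simp add: distrib_left distrib_right a' b)
    also have "\<dots> = idf Q (dsum E E')"
      unfolding F(7) F'(7) using fhom_right[OF BE(1)] fhom_right[OF BE(3)] by (simp add: b)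
    finally show "(?i * ?F * prl Q B B + ?j * ?F' * prr Q B B) * ?R + ?S * (inl Q A A * ?G * ?p + inr Q A A * ?G' * ?q)
      = idf Q (dsum E E')" .
  qed
  have "short_exact Q (dsum B B) (dsum E E') (dsum A A) (\<lambda>v. dsum_mat (f v) (f' v)) (\<lambda>v. dsum_mat (g v) (g' v))"
    by (subst short_exact_iff[OF Q rr(3,1,2)]) (use hc ex in \<open>auto simp: dsum_mat_def\<close>)
  moreover have "cocycle_of Q (dsum E E') ?R ?S c =
      inl Q B B (head Q c) * z c * prl Q A A (tail Q c) + inr Q B B (head Q c) * w c * prr Q A A (tail Q c)"
    if c: "c \<in> arcs Q" for c
  proof -
    let ?h = "head Q c" and ?t = "tail Q c"
    have bv: "?p v * ?i v = idf Q E v" "?q v * ?j v = idf Q E' v" "?p v * ?j v = 0" "?q v * ?i v = 0" for v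
      using fun_cong[OF b(1), of v] fun_cong[OF b(2), of v] fun_cong[OF b(3), of v] fun_cong[OF b(4), of v] by auto
    have bv': "?p v * (?i v * X) = idf Q E v * X" "?q v * (?j v * X) = idf Q E' v * X" "?p v * (?j v * X) = 0"
      "?q v * (?i v * X) = 0" for v X
      using bv[of v] by (simp_all flip: mult.assoc)
    have RS: "R v * idf Q E v = R v" "R' v * idf Q E' v = R' v" "idf Q E v * S v = S v" "idf Q E' v * S' v = S' v" for v
      using fun_cong[OF fsup_right[OF F(3)], of v] fun_cong[OF fsup_right[OF F'(3)], of v]
        fun_cong[OF fsup_left[OF F(4)], of v] fun_cong[OF fsup_left[OF F'(4)], of v] by auto
    have RS': "R v * (idf Q E v * X) = R v * X" "R' v * (idf Q E' v * X) = R' v * X"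
      "idf Q E v * (S v * X) = S v * X" "idf Q E' v * (S' v * X) = S' v * X" for v X
      using RS[of v] by (simp_all flip: mult.assoc)
    have "cocycle_of Q (dsum E E') ?R ?S c = inl Q B B ?h * (cocycle_of Q E R S c) * prl Q A A ?t
      + inr Q B B ?h * cocycle_of Q E' R' S' c * prr Q A A ?t"
      by (simp add: cocycle_of_def mm_dsum[OF Q x(1) y(1) c] distrib_left distrib_right mult.assoc bv bv' RS RS')
    then show ?thesis using x(4) y(4) c by simp
  qed
  ultimately show ?thesis
    using ex rr(1) by (auto simp: cocyc_def e extn_dsum_def extensions_def)
qed

text \<open>Classes correspond to cocycles, and by assumption these are the multiples of one nonzero
  cocycle. It remains to see that the operations on classes, defined by pushouts and pullbacks, are
  the scaling and the addition of cocycles.\<close>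

lemma Ext1_line:
  fixes A B :: "('v, 'a, 'k::field) qrep"
  assumes Q: "wf_digraph Q" and r: "is_rep Q A" "is_rep Q B" and dis: "disjoint_supp Q A B"
    and \<xi>: "cocyc Q A B \<xi> z0"
    and line: "\<And>z. (\<And>a. a \<in> arcs Q \<Longrightarrow> fcar (vdim B (head Q a)) (vdim A (tail Q a)) (z a)) \<Longrightarrow>
      \<exists>c. \<forall>a\<in>arcs Q. z a = sm c (z0 a)"
    and nz: "\<exists>a\<in>arcs Q. z0 a \<noteq> 0"
  shows "Ext1_line_generated_by Q A B \<xi>"
proof -
  \<comment> \<open>Equivalent extensions have equal cocycles and conversely, so this set is a full
    equivalence class.\<close>
  define \<phi> where "\<phi> c = {\<eta>. cocyc Q A B \<eta> (\<lambda>a. sm c (z0 a))}" for c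
  have fz: "fcar (vdim B (head Q a)) (vdim A (tail Q a)) (sm c (z0 a))" if "a \<in> arcs Q" for a c
    using cocyc_fcar[OF Q \<xi> that] by (simp add: fcar_def sm_mult_left sm_mult_right)
  have class_eq: "extn_equiv Q A B `` {\<eta>} = \<phi> c" if \<eta>: "\<eta> \<in> \<phi> c" for \<eta> c
  proof -
    have z: "cocyc Q A B \<eta> (\<lambda>a. sm c (z0 a))" using \<eta> by (simp add: \<phi>_def)
    have "(\<eta>, \<theta>) \<in> extn_equiv Q A B \<longleftrightarrow> \<theta> \<in> \<phi> c" for \<theta>
    proof
      assume eq: "(\<eta>, \<theta>) \<in> extn_equiv Q A B"
      then have "\<theta> \<in> extensions Q A B" by (auto simp: extn_equiv_def)
      then obtain w where w: "cocyc Q A B \<theta> w" using cocyc_exists[OF Q r] by blast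
      have "cocyc Q A B \<theta> (\<lambda>a. sm c (z0 a))"
        by (rule cocyc_cong[OF w]) (use eq cocyc_equiv_iff[OF Q r dis z w] in simp)
      then show "\<theta> \<in> \<phi> c" by (simp add: \<phi>_def)
    next
      assume "\<theta> \<in> \<phi> c"
      then show "(\<eta>, \<theta>) \<in> extn_equiv Q A B"
        using cocyc_equiv_iff[OF Q r dis z] by (auto simp: \<phi>_def)
    qed
    then show ?thesis by auto
  qed
  have nonempty: "\<exists>\<eta>. \<eta> \<in> \<phi> c" for c
    using cocyc_realized[OF Q r fz] by (auto simp: \<phi>_def)
  have scalar: "\<exists>c. \<eta> \<in> \<phi> c" if \<eta>: "\<eta> \<in> extensions Q A B" for \<eta>
  proof -
    obtain z where z: "cocyc Q A B \<eta> z" using cocyc_exists[OF Q r \<eta>] by blast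
    obtain c where c: "\<forall>a\<in>arcs Q. z a = sm c (z0 a)" using line[of z] cocyc_fcar[OF Q z] by blast
    have "cocyc Q A B \<eta> (\<lambda>a. sm c (z0 a))" by (rule cocyc_cong[OF z]) (use c in auto)
    then show ?thesis by (auto simp: \<phi>_def)
  qed
  have ext: "\<eta> \<in> extensions Q A B" if "\<eta> \<in> \<phi> c" for \<eta> c
    using that cocyc_extension[of Q A B \<eta>] by (auto simp: \<phi>_def)
  have "bij_betw \<phi> UNIV (Ext1 Q A B)"
    unfolding bij_betw_def
  proof
    show "inj \<phi>"
    proof (rule injI)
      fix c d assume "\<phi> c = \<phi> d"
      then obtain \<eta> where \<eta>: "\<eta> \<in> \<phi> c" "\<eta> \<in> \<phi> d" using nonempty[of c] by auto
      obtain a where a: "a \<in> arcs Q" "z0 a \<noteq> 0" using nz by blast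
      have "sm c (z0 a) = sm d (z0 a)"
        by (rule cocyc_unique[OF Q r dis _ _ a(1), of \<eta>]) (use \<eta> in \<open>auto simp: \<phi>_def\<close>)
      then have "sm (c - d) (z0 a) = 0" by (auto simp: fmat_eq_iff left_diff_distrib)
      then show "c = d" using a by (simp add: sm_eq_0_iff)
    qed
    show "range \<phi> = Ext1 Q A B"
    proof (intro subset_antisym subsetI)
      fix X assume "X \<in> range \<phi>"
      then obtain c where X: "X = \<phi> c" by blast
      obtain \<eta> where "\<eta> \<in> \<phi> c" using nonempty by blast
      then show "X \<in> Ext1 Q A B" unfolding X Ext1_def using class_eq ext by (metis quotientI)
    next
      fix X assume "X \<in> Ext1 Q A B"
      then obtain \<eta> where \<eta>: "\<eta> \<in> extensions Q A B" "X = extn_equiv Q A B `` {\<eta>}"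
        unfolding Ext1_def by (auto elim: quotientE)
      obtain c where "\<eta> \<in> \<phi> c" using scalar[OF \<eta>(1)] by blast
      then have "X = \<phi> c" using class_eq \<eta>(2) by simp
      then show "X \<in> range \<phi>" by blast
    qed
  qed
  moreover have "\<phi> (c * d) = ext_smult Q A B c (\<phi> d)" for c d
  proof -
    have mor: "extn_mor Q (\<lambda>v. c \<cdot>\<^sub>m id_fam B v) (id_fam A) \<eta> \<theta> \<longleftrightarrow> (\<forall>a\<in>arcs Q. sm c (z a) = w a)"
      if z: "cocyc Q A B \<eta> z" and w: "cocyc Q A B \<theta> w" for \<eta> \<theta> z w
    proof -
      have f: "fam Q (\<lambda>v. c \<cdot>\<^sub>m id_fam B v) = (\<lambda>v. sm c (idf Q B v))"
        by (auto simp: fam_def idf_def id_fam_def fun_eq_iff)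
      have "fhom Q B B (\<lambda>v. sm c (idf Q B v))"
      proof -
        have "idf Q B v * idf Q B v = idf Q B v" for v by (simp add: idf_def)
        then show ?thesis
          using fhom_idf[OF Q r(2)] by (auto simp: fhom_def fsup_def fun_eq_iff sm_mult_left sm_mult_right)
      qed
      then have "extn_mor Q (\<lambda>v. c \<cdot>\<^sub>m id_fam B v) (id_fam A) \<eta> \<theta> \<longleftrightarrow>
        (\<forall>a\<in>arcs Q. fam Q (\<lambda>v. c \<cdot>\<^sub>m id_fam B v) (head Q a) * z a = w a * fam Q (id_fam A) (tail Q a))"
        by (intro cocyc_mor_iff[OF Q r r dis z w]) (auto simp: id_fam_carrier f fhom_idf[OF Q] r)
      moreover have "idf Q B (head Q a) * z a = z a" "w a * idf Q A (tail Q a) = w a" if "a \<in> arcs Q" for a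
        using cocyc_fcar[OF Q z that] cocyc_fcar[OF Q w that] that Q by (auto simp: idf_def wf_digraph_def fcar_def)
      ultimately show ?thesis by (simp add: f sm_mult_left)
    qed
    show ?thesis
    proof (intro subset_antisym subsetI)
      fix \<theta> assume \<theta>: "\<theta> \<in> \<phi> (c * d)"
      obtain \<eta> where \<eta>: "\<eta> \<in> \<phi> d" using nonempty by blast
      have "extn_mor Q (\<lambda>v. c \<cdot>\<^sub>m id_fam B v) (id_fam A) \<eta> \<theta>"
        using mor[of \<eta> "\<lambda>a. sm d (z0 a)" \<theta> "\<lambda>a. sm (c * d) (z0 a)"] \<eta> \<theta> by (simp add: \<phi>_def)
      then show "\<theta> \<in> ext_smult Q A B c (\<phi> d)" using \<eta> ext[OF \<theta>] by (auto simp: ext_smult_def)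
    next
      fix \<theta> assume "\<theta> \<in> ext_smult Q A B c (\<phi> d)"
      then obtain \<eta> where \<theta>: "\<theta> \<in> extensions Q A B" and \<eta>: "\<eta> \<in> \<phi> d"
        and m: "extn_mor Q (\<lambda>v. c \<cdot>\<^sub>m id_fam B v) (id_fam A) \<eta> \<theta>" by (auto simp: ext_smult_def)
      obtain w where w: "cocyc Q A B \<theta> w" using cocyc_exists[OF Q r \<theta>] by blast
      have "\<forall>a\<in>arcs Q. sm c (sm d (z0 a)) = w a"
        using mor[of \<eta> "\<lambda>a. sm d (z0 a)" \<theta> w] \<eta> w m by (simp add: \<phi>_def)
      then have "cocyc Q A B \<theta> (\<lambda>a. sm (c * d) (z0 a))" by (intro cocyc_cong[OF w]) simp
      then show "\<theta> \<in> \<phi> (c * d)" by (simp add: \<phi>_def)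
    qed
  qed
  moreover have "\<phi> (c + d) = baer_sum Q A B (\<phi> c) (\<phi> d)" for c d
  proof -
    let ?AA = "dsum A A" and ?BB = "dsum B B"
    have rAA: "is_rep Q ?AA" and rBB: "is_rep Q ?BB" using r is_rep_dsum by blast+
    have dis2: "disjoint_supp Q ?AA B" using dis by (auto simp: disjoint_supp_def)
    note BA = biproduct_fhom[OF Q r(1) r(1)] and BB = biproduct_fhom[OF Q r(2) r(2)]
    have hD: "fhom Q A ?AA (fam Q (diagonal_fam A))" and hN: "fhom Q ?BB B (fam Q (codiagonal_fam B))"
      unfolding fam_diagonal fam_codiagonal using BA BB by (auto intro: fhom_add)
    have bA: "prl Q A A v * inl Q A A v = idf Q A v" "prr Q A A v * inr Q A A v = idf Q A v"
      "prl Q A A v * inr Q A A v = 0" "prr Q A A v * inl Q A A v = 0" for v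
      using biproduct_equations(1-4)[of Q A A] by (simp_all add: fun_eq_iff)
    have bB: "prl Q B B v * inl Q B B v = idf Q B v" "prr Q B B v * inr Q B B v = idf Q B v"
      "prl Q B B v * inr Q B B v = 0" "prr Q B B v * inl Q B B v = 0" for v
      using biproduct_equations(1-4)[of Q B B] by (simp_all add: fun_eq_iff)
    have bB': "prl Q B B v * (inl Q B B v * X) = idf Q B v * X" "prr Q B B v * (inr Q B B v * X) = idf Q B v * X"
      "prl Q B B v * (inr Q B B v * X) = 0" "prr Q B B v * (inl Q B B v * X) = 0" for v X
      using bB[of v] by (simp_all flip: mult.assoc)
    have zid: "idf Q B (head Q a) * z a = z a" "z a * idf Q A (tail Q a) = z a"
      "idf Q B (head Q a) * (z a * X) = z a * X"
      if z: "cocyc Q A B \<eta> z" and a: "a \<in> arcs Q" for \<eta> z a X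
    proof -
      show 1: "idf Q B (head Q a) * z a = z a" "z a * idf Q A (tail Q a) = z a"
        using cocyc_fcar[OF Q z a] a Q by (auto simp: idf_def wf_digraph_def fcar_def)
      show "idf Q B (head Q a) * (z a * X) = z a * X" using 1(1) by (simp flip: mult.assoc)
    qed
    \<comment> \<open>The row with entries z and w: the cocycle of the pushout of the direct sum
      along the codiagonal. Pulling back along the diagonal adds the two entries.\<close>
    define nz where "nz z w a = z a * prl Q A A (tail Q a) + w a * prr Q A A (tail Q a)" for z w :: "'a \<Rightarrow> 'k fmat" and a
    have mor1: "extn_mor Q (codiagonal_fam B) (id_fam ?AA) (extn_dsum \<eta> \<theta>) \<zeta> \<longleftrightarrow>
        (\<forall>a\<in>arcs Q. nz z w a = y a)"
      if z: "cocyc Q A B \<eta> z" and w: "cocyc Q A B \<theta> w" and y: "cocyc Q ?AA B \<zeta> y" for \<eta> \<theta> \<zeta> z w y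
    proof -
      have "y a * idf Q ?AA (tail Q a) = y a" if a: "a \<in> arcs Q" for a
        using cocyc_fcar[OF Q y a] a Q by (auto simp: idf_def wf_digraph_def fcar_def)
      moreover have "extn_mor Q (codiagonal_fam B) (id_fam ?AA) (extn_dsum \<eta> \<theta>) \<zeta> \<longleftrightarrow>
        (\<forall>a\<in>arcs Q. fam Q (codiagonal_fam B) (head Q a) * (inl Q B B (head Q a) * z a * prl Q A A (tail Q a)
            + inr Q B B (head Q a) * w a * prr Q A A (tail Q a)) = y a * fam Q (id_fam ?AA) (tail Q a))"
        by (rule cocyc_mor_iff[OF Q rAA rBB rAA r(2) dis2 cocyc_dsum[OF Q r z w] y diagonal_carrier(2) id_fam_carrier hN])
          (simp add: fhom_idf[OF Q rAA])
      ultimately show ?thesis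
        by (simp add: fam_codiagonal distrib_left distrib_right mult.assoc bB' zid[OF z] zid[OF w] nz_def)
    qed
    have mor2: "extn_mor Q (id_fam B) (diagonal_fam A) \<theta> \<zeta> \<longleftrightarrow>
        (\<forall>a\<in>arcs Q. w a = y a * (inl Q A A (tail Q a) + inr Q A A (tail Q a)))"
      if w: "cocyc Q A B \<theta> w" and y: "cocyc Q ?AA B \<zeta> y" for \<theta> \<zeta> w y
    proof -
      have "extn_mor Q (id_fam B) (diagonal_fam A) \<theta> \<zeta> \<longleftrightarrow>
        (\<forall>a\<in>arcs Q. fam Q (id_fam B) (head Q a) * w a = y a * fam Q (diagonal_fam A) (tail Q a))"
        by (rule cocyc_mor_iff[OF Q r rAA r(2) dis w y id_fam_carrier diagonal_carrier(1) _ hD])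
          (simp add: fhom_idf[OF Q r(2)])
      then show ?thesis by (simp add: fam_diagonal zid[OF w])
    qed
    have sum: "nz z w a * (inl Q A A (tail Q a) + inr Q A A (tail Q a)) = z a + w a"
      if z: "cocyc Q A B \<eta> z" and w: "cocyc Q A B \<theta> w" and a: "a \<in> arcs Q" for \<eta> \<theta> z w a
      using zid(2)[OF z a] zid(2)[OF w a] by (simp add: nz_def distrib_left distrib_right mult.assoc bA)
    show ?thesis
    proof (intro subset_antisym subsetI)
      fix \<theta> assume \<theta>: "\<theta> \<in> \<phi> (c + d)"
      obtain \<eta>1 \<eta>2 where \<eta>: "\<eta>1 \<in> \<phi> c" "\<eta>2 \<in> \<phi> d" using nonempty by blast
      let ?z = "\<lambda>a. sm c (z0 a)" and ?w = "\<lambda>a. sm d (z0 a)"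
      have z: "cocyc Q A B \<eta>1 ?z" and w: "cocyc Q A B \<eta>2 ?w" and t: "cocyc Q A B \<theta> (\<lambda>a. sm (c + d) (z0 a))"
        using \<eta> \<theta> by (auto simp: \<phi>_def)
      have "fcar (vdim B (head Q a)) (vdim ?AA (tail Q a)) (nz ?z ?w a)" if a: "a \<in> arcs Q" for a
      proof -
        have v: "tail Q a \<in> verts Q" using Q a by (simp add: wf_digraph_def)
        have "fcar (vdim A (tail Q a)) (vdim ?AA (tail Q a)) (prl Q A A (tail Q a))"
          "fcar (vdim A (tail Q a)) (vdim ?AA (tail Q a)) (prr Q A A (tail Q a))"
          using fhom_fsup[OF BA(2), unfolded fsup_iff, rule_format, of "tail Q a"]
            fhom_fsup[OF BA(4), unfolded fsup_iff, rule_format, of "tail Q a"] v by (simp_all only: if_True)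
        then have "fcar (vdim B (head Q a)) (vdim ?AA (tail Q a)) (?z a * prl Q A A (tail Q a))"
          "fcar (vdim B (head Q a)) (vdim ?AA (tail Q a)) (?w a * prr Q A A (tail Q a))"
          using fz[OF a] fcar_mult by blast+
        then show ?thesis unfolding nz_def fcar_def by (simp only: distrib_left distrib_right)
      qed
      from cocyc_realized[OF Q rAA r(2) this] obtain \<zeta> where \<zeta>: "cocyc Q ?AA B \<zeta> (nz ?z ?w)" by blast
      have "extn_mor Q (codiagonal_fam B) (id_fam ?AA) (extn_dsum \<eta>1 \<eta>2) \<zeta>"
        using mor1[OF z w \<zeta>] by simp
      moreover have "extn_mor Q (id_fam B) (diagonal_fam A) \<theta> \<zeta>"
        using mor2[OF t \<zeta>] sum[OF z w] by (simp add: sm_add_left)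
      ultimately show "\<theta> \<in> baer_sum Q A B (\<phi> c) (\<phi> d)"
        using \<eta> ext[OF \<theta>] cocyc_extension[OF \<zeta>] by (auto simp: baer_sum_def)
    next
      fix \<theta> assume "\<theta> \<in> baer_sum Q A B (\<phi> c) (\<phi> d)"
      then obtain \<eta>1 \<eta>2 \<zeta> where \<theta>: "\<theta> \<in> extensions Q A B" and \<eta>: "\<eta>1 \<in> \<phi> c" "\<eta>2 \<in> \<phi> d"
        and \<zeta>: "\<zeta> \<in> extensions Q ?AA B"
        and m: "extn_mor Q (codiagonal_fam B) (id_fam ?AA) (extn_dsum \<eta>1 \<eta>2) \<zeta>"
          "extn_mor Q (id_fam B) (diagonal_fam A) \<theta> \<zeta>"
        unfolding baer_sum_def by blast
      let ?z = "\<lambda>a. sm c (z0 a)" and ?w = "\<lambda>a. sm d (z0 a)"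
      have z: "cocyc Q A B \<eta>1 ?z" and w: "cocyc Q A B \<eta>2 ?w" using \<eta> by (auto simp: \<phi>_def)
      obtain t where t: "cocyc Q A B \<theta> t" using cocyc_exists[OF Q r \<theta>] by blast
      obtain y where y: "cocyc Q ?AA B \<zeta> y" using cocyc_exists[OF Q rAA r(2) \<zeta>] by blast
      have "t a = sm (c + d) (z0 a)" if a: "a \<in> arcs Q" for a
        using mor1[OF z w y] mor2[OF t y] m sum[OF z w a] a by (simp add: sm_add_left)
      then have "cocyc Q A B \<theta> (\<lambda>a. sm (c + d) (z0 a))" by (intro cocyc_cong[OF t]) simp
      then show "\<theta> \<in> \<phi> (c + d)" by (simp add: \<phi>_def)
    qed
  qed
  moreover have "\<phi> 1 = extn_equiv Q A B `` {\<xi>}"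
    using class_eq[of \<xi> 1] \<xi> by (simp add: \<phi>_def)
  ultimately show ?thesis
    using cocyc_extension[OF \<xi>] unfolding Ext1_line_generated_by_def by blast
qed

section \<open>Extensions between intervals\<close>

text \<open>A discrete primitive with one prescribed value, the constant of integration.\<close>

lemma exists_primitive:
  fixes u :: "nat \<Rightarrow> 'k::field"
  shows "\<exists>\<kappa>. (\<forall>i. \<kappa> i - \<kappa> (Suc i) = u i) \<and> \<kappa> v = c"
  by (rule exI[of _ "\<lambda>i. c + (\<Sum>j<v. u j) - (\<Sum>j<i. u j)"]) simp

lemma ind_add: "S \<inter> T = {} \<Longrightarrow> ind S + ind T = ind (S \<union> T)"
  by (auto simp: ind_def fun_eq_iff)

context type_A
begin

text \<open>For \<open>s = (a, b)\<close> and \<open>t = (c, d)\<close> this will turn out to say that the segments cross and \<open>s\<close> has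
  the larger slope: the second conjunct says that \<open>s\<close> passes below \<open>t\<close> at the larger of the
  left end points, the third that it passes above \<open>t\<close> at the smaller of the right end points.\<close>

definition cross :: "nat \<times> nat \<Rightarrow> nat \<times> nat \<Rightarrow> bool" where
  "cross s t \<longleftrightarrow> max (fst s) (fst t) < min (snd s) (snd t) \<and>
    (fst s < fst t \<and> up (fst t) \<or> fst t < fst s \<and> \<not> up (fst s)) \<and>
    (snd t < snd s \<and> \<not> up (snd t) \<or> snd s < snd t \<and> up (snd s))"

definition overlap :: "nat \<times> nat \<Rightarrow> nat \<times> nat \<Rightarrow> bool" where
  "overlap s t \<longleftrightarrow> max (fst s) (fst t) < min (snd s) (snd t)"

text \<open>The arrows from s into t are the only places where a cocycle of an extension of the
  interval s by the interval t can be nonzero.\<close>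

definition linked :: "nat \<times> nat \<Rightarrow> nat \<times> nat \<Rightarrow> bool" where
  "linked s t \<longleftrightarrow> (\<exists>e\<in>arcs Q. tail Q e \<in> ivl s \<and> head Q e \<in> ivl t)"

lemma cross_overlap: "cross s t \<Longrightarrow> overlap s t"
  by (simp add: cross_def overlap_def)

lemma overlap_iff: "overlap s t \<longleftrightarrow> ivl s \<inter> ivl t \<noteq> {}"
proof
  assume "overlap s t"
  then have "min (snd s) (snd t) \<in> ivl s \<inter> ivl t" by (auto simp: overlap_def ivl_def)
  then show "ivl s \<inter> ivl t \<noteq> {}" by blast
qed (auto simp: overlap_def ivl_def)

text \<open>Inside the overlap the equation prescribes the differences of \<kappa>, which leaves one
  constant free. Each end of the overlap imposes at most one more condition, and
  \<open>cross\<close> says that both ends do. Without it the constant satisfies the one condition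
  that may remain.\<close>

lemma cobound_solvable:
  fixes w :: "'a \<Rightarrow> 'k::field"
  assumes ov: "overlap s t" and nc: "\<not> cross s t"
  shows "\<exists>\<kappa>. \<forall>e\<in>arcs Q. tail Q e \<in> ivl s \<longrightarrow> head Q e \<in> ivl t \<longrightarrow>
    w e = (if tail Q e \<in> ivl t then \<kappa> (tail Q e) else 0) - (if head Q e \<in> ivl s then \<kappa> (head Q e) else 0)"
proof -
  obtain a b c d where st: "s = (a, b)" "t = (c, d)" by fastforce
  have mM: "max a c < min b d" using ov by (simp add: overlap_def st)
  \<comment> \<open>The sign removes the direction of the arrow: inside the overlap the equation
    reads \<open>\<kappa> i - \<kappa> (Suc i) = u i\<close> in both cases.\<close>
  define u where "u i = (let e = (SOME e. e \<in> arcs Q \<and> {tail Q e, head Q e} = {i, i + 1}) in if up i then w e else - w e)" for i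
  have u: "u i = (if up i then w e else - w e)" if e: "e \<in> arcs Q" "{tail Q e, head Q e} = {i, i + 1}" for i e
  proof -
    have "1 \<le> i \<and> i \<le> n + 1"
      by (rule arc_cases[OF e(1)]) (use e(2) in \<open>auto simp: doubleton_eq_iff\<close>)
    then have "(SOME e. e \<in> arcs Q \<and> {tail Q e, head Q e} = {i, i + 1}) = e"
      using arc_between[of i] e by (intro some1_equality) auto
    then show ?thesis by (simp add: u_def)
  qed
  \<comment> \<open>\<open>?L\<close> and \<open>?R\<close>: across the left, respectively right,
    end of the overlap there is an arrow from s into t. Only one of its two vertices is common, so
    it prescribes a value of \<kappa>.\<close>
  let ?L = "a < c \<and> up c \<or> c < a \<and> \<not> up a" and ?R = "d < b \<and> \<not> up d \<or> b < d \<and> up b"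
  have "\<not> (?L \<and> ?R)" using nc mM by (simp add: cross_def st)
  \<comment> \<open>The base values amount to \<kappa> being zero just outside the overlap: at
    \<open>Suc (min b d)\<close> in the first case, at \<open>max a c\<close> in the second.\<close>
  obtain \<kappa> where \<kappa>: "\<And>i. \<kappa> i - \<kappa> (Suc i) = u i"
    and base: "if ?R then \<kappa> (min b d) = u (min b d) else \<kappa> (Suc (max a c)) = - u (max a c)"
    using exists_primitive[of u "min b d" "u (min b d)"] exists_primitive[of u "Suc (max a c)" "- u (max a c)"]
    by (cases ?R) (simp_all, blast+)
  show ?thesis
  proof (intro exI[of _ \<kappa>] ballI impI)
    fix e assume e: "e \<in> arcs Q" and te: "tail Q e \<in> ivl s" and he: "head Q e \<in> ivl t"
    show "w e = (if tail Q e \<in> ivl t then \<kappa> (tail Q e) else 0) - (if head Q e \<in> ivl s then \<kappa> (head Q e) else 0)"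
    proof (rule arc_cases[OF e])
      fix i assume i: "up i" "tail Q e = i" "head Q e = i + 1"
      have ui: "u i = w e" using u[of e i] e i by simp
      have ineq: "a < i" "i \<le> b" "c < i + 1" "i + 1 \<le> d" using te he i by (auto simp: st ivl_def)
      consider "c < i" "i < b" | "i = c" | "c < i" "i = b" using ineq by linarith
      then show ?thesis
      proof cases
        case 1 then show ?thesis using \<kappa>[of i] ui i ineq by (auto simp: st ivl_def)
      next
        case 2
        then have "?L" and m: "max a c = i" using ineq i by auto
        then have "\<kappa> (Suc i) = - u i" using base \<open>\<not> (?L \<and> ?R)\<close> by (simp only: if_False m simp_thms)
        then show ?thesis using 2 ui i ineq mM by (auto simp: st ivl_def)
      next
        case 3
        then have "?R" and m: "min b d = i" using ineq i by auto
        then have "\<kappa> i = u i" using base by (simp only: if_True m simp_thms)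
        then show ?thesis using 3 ui i ineq mM by (auto simp: st ivl_def)
      qed
    next
      fix i assume i: "\<not> up i" "tail Q e = i + 1" "head Q e = i"
      have ui: "u i = - w e" using u[of e i] e i by (simp add: insert_commute)
      have ineq: "a < i + 1" "i + 1 \<le> b" "c < i" "i \<le> d" using te he i by (auto simp: st ivl_def)
      consider "a < i" "i < d" | "i = a" | "a < i" "i = d" using ineq by linarith
      then show ?thesis
      proof cases
        case 1
        have "w e = - u i" using ui by simp
        also have "\<dots> = \<kappa> (Suc i) - \<kappa> i" unfolding \<kappa>[of i, symmetric] by simp
        finally show ?thesis using 1 i ineq by (auto simp: st ivl_def)
      next
        case 2
        then have "?L" and m: "max a c = i" using ineq i by auto
        then have "\<kappa> (Suc i) = - u i" using base \<open>\<not> (?L \<and> ?R)\<close> by (simp only: if_False m simp_thms)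
        then show ?thesis using 2 ui i ineq mM by (auto simp: st ivl_def)
      next
        case 3
        then have "?R" and m: "min b d = i" using ineq i by auto
        then have "\<kappa> i = u i" using base by (simp only: if_True m simp_thms)
        then show ?thesis using 3 ui i ineq mM by (auto simp: st ivl_def)
      qed
    qed
  qed
qed

lemma fsup_iv:
  assumes "snd s \<le> n + 2" "\<And>v. fcar 1 1 (F v)" "\<And>v. v \<notin> ivl s \<inter> ivl t \<Longrightarrow> F v = 0"
  shows "fsup Q (iv Q s) (iv Q t) F"
  unfolding fsup_iff vdim_iv
proof
  fix v
  have "v \<in> verts Q" if "v \<in> ivl s" using that assms(1) by (auto simp: ivl_def verts)
  then show "if v \<in> verts Q then fcar (if v \<in> ivl t then 1 else 0) (if v \<in> ivl s then 1 else 0) (F v) else F v = 0"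
    using assms(2)[of v] assms(3)[of v] by (cases "v \<in> ivl s \<inter> ivl t") auto
qed

text \<open>Entries of the cocycle live on arrows from s into t. If there are none it is zero;
  otherwise the scalars of \<open>cobound_solvable\<close> show that it is a coboundary.\<close>

lemma all_split_iv:
  assumes s: "s \<in> segments n" and t: "t \<in> segments n"
    and h: "\<not> linked s t \<or> overlap s t \<and> \<not> cross s t"
  shows "all_split Q (iv Q s :: (nat, 'a, 'k::field) qrep) (iv Q t)"
  unfolding all_split_def
proof (intro allI impI)
  fix E :: "(nat, 'a, 'k) qrep" and F G R S
  assume E: "is_rep Q E" and ex: "fexact Q (iv Q t) E (iv Q s) F G R S"
  let ?z = "cocycle_of Q E R S"
  define w where "w e = ent (?z e) 0 0" for e
  have z: "?z e = (if tail Q e \<in> ivl s \<and> head Q e \<in> ivl t then sm (w e) (idm 1) else 0)" if e: "e \<in> arcs Q" for e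
  proof -
    have "fcar (vdim (iv Q t :: (nat, 'a, 'k) qrep) (head Q e)) (vdim (iv Q s :: (nat, 'a, 'k) qrep) (tail Q e)) (?z e)"
      by (rule fcar_cocycle[OF wf E _ _ e]) (use ex in \<open>auto simp: fexact_def\<close>)
    then have f: "fcar (if head Q e \<in> ivl t then 1 else 0) (if tail Q e \<in> ivl s then 1 else 0) (?z e)"
      by (simp only: vdim_iv)
    show ?thesis
    proof (cases "tail Q e \<in> ivl s \<and> head Q e \<in> ivl t")
      case True
      then have "fcar 1 1 (?z e)" using f by simp
      then show ?thesis using True fcar_1_eq[of "?z e"] by (simp add: w_def)
    next
      case False
      then show ?thesis using fcar_trivial[OF f] by auto
    qed
  qed
  obtain \<kappa> where \<kappa>: "\<forall>e\<in>arcs Q. tail Q e \<in> ivl s \<longrightarrow> head Q e \<in> ivl t \<longrightarrow>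
    w e = (if tail Q e \<in> ivl t then \<kappa> (tail Q e) else 0) - (if head Q e \<in> ivl s then \<kappa> (head Q e) else 0)"
    using h cobound_solvable[of s t w] unfolding linked_def by blast
  define k :: "nat \<Rightarrow> 'k fmat" where "k v = (if v \<in> ivl s \<inter> ivl t then sm (\<kappa> v) (idm 1) else 0)" for v
  have "fsup Q (iv Q s) (iv Q t) k"
    by (rule fsup_iv) (use s in \<open>auto simp: k_def mem_segments fcar_def sm_mult_left sm_mult_right\<close>)
  then show "\<exists>S'. fhom Q (iv Q s) E S' \<and> G * S' = idf Q (iv Q s)"
  proof (rule cobound_splits[OF wf is_rep_iv E is_rep_iv ex])
    fix e assume e: "e \<in> arcs Q"
    have d: "sm (x - y) (idm 1 :: 'k fmat) = sm x (idm 1) - sm y (idm 1)" for x y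
      by (simp add: fmat_eq_iff left_diff_distrib)
    show "?z e = mm (iv Q t) e * k (tail Q e) - k (head Q e) * mm (iv Q s) e"
      using \<kappa>[rule_format, OF e] unfolding z[OF e] mm_iv k_def
      by (auto simp: sm_mult_left sm_mult_right d[unfolded One_nat_def])
  qed
qed

text \<open>Where the source extends beyond the overlap, the arrow must leave the overlap, making it
  a quotient of the source. Where the target extends beyond it, the arrow must enter the overlap,
  making it a subrepresentation of the target.\<close>

lemma overlap_homI:
  assumes "p < p' \<Longrightarrow> \<not> up p'" "p' < p \<Longrightarrow> up p" "q < q' \<Longrightarrow> \<not> up q" "q' < q \<Longrightarrow> up q'"
  shows "overlap_hom (p, q) (p', q')"
  unfolding overlap_hom_def
proof
  fix e assume "e \<in> arcs Q"
  then show "tail Q e \<in> ivl (p, q) \<and> head Q e \<in> ivl (p, q) \<and> head Q e \<in> ivl (p', q') \<longleftrightarrow>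
     tail Q e \<in> ivl (p, q) \<and> tail Q e \<in> ivl (p', q') \<and> head Q e \<in> ivl (p', q')"
  proof (cases rule: arc_cases)
    case (1 i)
    have "\<not> (i = p' \<and> p < p')" "\<not> (i = q \<and> q < q')" using 1 assms by auto
    then show ?thesis using 1 by (auto simp: ivl_def)
  next
    case (2 i)
    have "\<not> (i = p \<and> p' < p)" "\<not> (i = q' \<and> q' < q)" using 2 assms by auto
    then show ?thesis using 2 by (auto simp: ivl_def)
  qed
qed

text \<open>Exchanging the right ends of the crossing segments yields two opposite sides. Their
  intervals have the same union and the same intersection as the original ones, so the sequence is
  of Mayer-Vietoris type; the orientation in \<open>cross\<close> makes all four identities on
  overlaps morphisms.\<close>

lemma cross_exact:
  assumes seg: "(a, b) \<in> segments n" "(c, d) \<in> segments n" and x: "cross (a, b) (c, d)"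
  shows "(a, d) \<in> segments n" "(c, b) \<in> segments n"
    "\<exists>F G R S. fexact Q (iv Q (c, d)) (dsum (iv Q (a, d)) (iv Q (c, b))) (iv Q (a, b) :: (nat, 'a, 'k::field) qrep) F G R S"
proof -
  show s: "(a, d) \<in> segments n" "(c, b) \<in> segments n"
    using seg x by (auto simp: mem_segments cross_def)
  let ?A = "ivl (a, b)" and ?B = "ivl (c, d)" and ?X = "ivl (a, d)" and ?Y = "ivl (c, b)"
  let ?RX = "iv Q (a, d) :: (nat, 'a, 'k) qrep" and ?RY = "iv Q (c, b) :: (nat, 'a, 'k) qrep"
  have sets: "?X \<inter> ?Y = ?A \<inter> ?B" "?X \<union> ?Y = ?A \<union> ?B"
    using x by (auto simp: ivl_def cross_def)
  have oh: "overlap_hom (c, d) (a, d)" "overlap_hom (c, d) (c, b)" "overlap_hom (a, d) (a, b)" "overlap_hom (c, b) (a, b)"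
    by (rule overlap_homI; use x in \<open>auto simp: cross_def\<close>)+
  have hom: "fhom Q (iv Q (c, d)) ?RX (ind (?B \<inter> ?X))" "fhom Q (iv Q (c, d)) ?RY (ind (?B \<inter> ?Y))"
    "fhom Q ?RX (iv Q (a, b)) (ind (?X \<inter> ?A))" "fhom Q ?RY (iv Q (a, b)) (ind (?Y \<inter> ?A))"
    using fhom_ind[OF _ _ oh(1)] fhom_ind[OF _ _ oh(2)] fhom_ind[OF _ _ oh(3)] fhom_ind[OF _ _ oh(4)] seg s
    by (auto simp: mem_segments)
  have sub: "fsup Q ?RX (iv Q (c, d)) (ind (?B - ?Y))" "fsup Q ?RY (iv Q (c, d)) (ind (?B \<inter> ?Y))"
    "fsup Q (iv Q (a, b)) ?RX (ind (?A \<inter> ?X))" "fsup Q (iv Q (a, b)) ?RY (ind (?A - ?X))"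
    by (rule fsup_iv; use seg s sets in \<open>auto simp: ind_def mem_segments fcar_idm[of 1, unfolded One_nat_def]\<close>)+
  note E = biproduct_equations[of Q ?RX ?RY]
  let ?i = "inl Q ?RX ?RY" and ?j = "inr Q ?RX ?RY" and ?p = "prl Q ?RX ?RY" and ?q = "prr Q ?RX ?RY"
  have H: "fhom Q ?RX (dsum ?RX ?RY) ?i" "fhom Q (dsum ?RX ?RY) ?RX ?p"
    "fhom Q ?RY (dsum ?RX ?RY) ?j" "fhom Q (dsum ?RX ?RY) ?RY ?q"
    by (rule biproduct_fhom[OF wf is_rep_iv is_rep_iv])+
  \<comment> \<open>F is the diagonal map into the two summands and G the difference of the two
    projections, so that they compose to zero on the intersection.\<close>
  let ?F = "?i * ind (?B \<inter> ?X) + ?j * ind (?B \<inter> ?Y)" and ?G = "ind (?X \<inter> ?A) * ?p - ind (?Y \<inter> ?A) * ?q"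
  \<comment> \<open>At each vertex one summand has to be chosen: R reads a vector of B from Y where
    possible and else from X, and S lifts a vector of A to X where possible and else to Y. With
    these two choices \<open>F * R + S * G\<close> is the identity.\<close>
  let ?R = "ind (?B - ?Y) * ?p + ind (?B \<inter> ?Y) * ?q" and ?S = "?i * ind (?A \<inter> ?X) - ?j * ind (?A - ?X)"
  have idX: "idf Q ?RX = ind ?X" "idf Q ?RY = ind ?Y" using idf_iv_seg s by auto
  have as: "C * D * (I * J) = C * (D * I) * J" for C D I J :: "nat \<Rightarrow> 'k fmat"
    by (simp add: mult.assoc)
  have "fhom Q (iv Q (c, d)) (dsum ?RX ?RY) ?F"
    by (intro fhom_add fhom_mult[OF H(1) hom(1)] fhom_mult[OF H(3) hom(2)])
  moreover have "fhom Q (dsum ?RX ?RY) (iv Q (a, b)) ?G"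
    by (intro fhom_diff fhom_mult[OF hom(3) H(2)] fhom_mult[OF hom(4) H(4)])
  moreover have "fsup Q (dsum ?RX ?RY) (iv Q (c, d)) ?R"
    by (intro fsup_add fsup_mult[OF sub(1) fhom_fsup[OF H(2)]] fsup_mult[OF sub(2) fhom_fsup[OF H(4)]])
  moreover have "fsup Q (iv Q (a, b)) (dsum ?RX ?RY) ?S"
    by (intro fsup_diff fsup_mult[OF fhom_fsup[OF H(1)] sub(3)] fsup_mult[OF fhom_fsup[OF H(3)] sub(4)])
  moreover have "?R * ?F = idf Q (iv Q (c, d))"
  proof -
    have "?R * ?F = ind ((?B - ?Y) \<inter> ?X \<inter> (?B \<inter> ?X)) + ind (?B \<inter> ?Y \<inter> ?Y \<inter> (?B \<inter> ?Y))"
      by (simp add: distrib_left distrib_right as E idX)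
    also have "\<dots> = ind ?B" using sets by (subst ind_add) (auto intro!: arg_cong[of _ _ ind])
    finally show ?thesis by (simp add: idf_iv_seg[OF seg(2)])
  qed
  moreover have "?G * ?S = idf Q (iv Q (a, b))"
  proof -
    have "?G * ?S = ind (?X \<inter> ?A \<inter> ?X \<inter> (?A \<inter> ?X)) + ind (?Y \<inter> ?A \<inter> ?Y \<inter> (?A - ?X))"
      by (simp add: left_diff_distrib right_diff_distrib as E idX)
    also have "\<dots> = ind ?A" using sets by (subst ind_add) (auto intro!: arg_cong[of _ _ ind])
    finally show ?thesis by (simp add: idf_iv_seg[OF seg(1)])
  qed
  moreover have "?F * ?R + ?S * ?G = idf Q (dsum ?RX ?RY)"
  proof -
    let ?P1 = "ind (?B \<inter> ?X) * ind (?B - ?Y) + ind (?A \<inter> ?X) * ind (?X \<inter> ?A) :: nat \<Rightarrow> 'k fmat"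
    let ?P2 = "ind (?B \<inter> ?X) * ind (?B \<inter> ?Y) - ind (?A \<inter> ?X) * ind (?Y \<inter> ?A) :: nat \<Rightarrow> 'k fmat"
    let ?P3 = "ind (?B \<inter> ?Y) * ind (?B - ?Y) - ind (?A - ?X) * ind (?X \<inter> ?A) :: nat \<Rightarrow> 'k fmat"
    let ?P4 = "ind (?B \<inter> ?Y) * ind (?B \<inter> ?Y) + ind (?A - ?X) * ind (?Y \<inter> ?A) :: nat \<Rightarrow> 'k fmat"
    have "?F * ?R + ?S * ?G = ?i * ?P1 * ?p + ?i * ?P2 * ?q + ?j * ?P3 * ?p + ?j * ?P4 * ?q"
      by (simp add: distrib_left distrib_right left_diff_distrib right_diff_distrib mult.assoc del: ind_mult)
    also have "?P1 = ind ?X" unfolding ind_mult using sets by (subst ind_add) (auto intro!: arg_cong[of _ _ ind])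
    also have "?P2 = 0" unfolding ind_mult using sets by (auto intro!: arg_cong[of _ _ ind])
    also have "?P3 = 0" by (auto simp: ind_def fun_eq_iff)
    also have "?P4 = ind ?Y" unfolding ind_mult using sets by (subst ind_add) (auto intro!: arg_cong[of _ _ ind])
    also have "?i * ind ?X = ?i" using fhom_right[OF H(1)] by (simp only: idX)
    also have "?j * ind ?Y = ?j" using fhom_right[OF H(3)] by (simp only: idX)
    finally show ?thesis by (simp only: E mult_zero_left mult_zero_right add_0_right)
  qed
  ultimately show "\<exists>F G R S. fexact Q (iv Q (c, d)) (dsum ?RX ?RY) (iv Q (a, b)) F G R S"
    unfolding fexact_def by blast
qed

text \<open>A section would make the middle term isomorphic to the direct sum of its ends. Comparing
  supports would then force a common end point, which \<open>cross\<close> excludes.\<close>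

lemma cross_nonsplit:
  fixes F :: "nat \<Rightarrow> 'k::field fmat"
  assumes seg: "(a, b) \<in> segments n" "(c, d) \<in> segments n" and x: "cross (a, b) (c, d)"
    and ex: "fexact Q (iv Q (c, d)) (dsum (iv Q (a, d)) (iv Q (c, b))) (iv Q (a, b)) F G R S"
  shows "\<not> (\<exists>S'. fhom Q (iv Q (a, b)) (dsum (iv Q (a, d)) (iv Q (c, b))) S' \<and> G * S' = idf Q (iv Q (a, b)))"
proof
  assume "\<exists>S'. fhom Q (iv Q (a, b)) (dsum (iv Q (a, d)) (iv Q (c, b))) S' \<and> G * S' = idf Q (iv Q (a, b))"
  then obtain S' where S': "fhom Q (iv Q (a, b)) (dsum (iv Q (a, d)) (iv Q (c, b))) S'" "G * S' = idf Q (iv Q (a, b))"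
    by blast
  note s = cross_exact(1,2)[OF seg x]
  have "supp (dsum (iv Q (a, d)) (iv Q (c, b)) :: (nat, 'a, 'k) qrep) =
      supp (dsum (iv Q (c, d)) (iv Q (a, b)) :: (nat, 'a, 'k) qrep)"
    by (rule supp_fiso[OF split_exact_dsum[OF wf is_rep_iv is_rep_dsum[OF is_rep_iv is_rep_iv] is_rep_iv ex S']])
  then have "{(a, d), (c, b)} = {(c, d), (a, b)}"
    by (simp add: supp_dsum[OF is_rep_iv is_rep_iv] supp_iv seg s insert_commute)
  with x show False by (auto simp: doubleton_eq_iff cross_def)
qed

lemma cross_not_all_split:
  assumes s: "s \<in> segments n" and t: "t \<in> segments n" and x: "cross s t"
  shows "\<not> all_split Q (iv Q s :: (nat, 'a, 'k::field) qrep) (iv Q t)"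
proof -
  obtain a b c d where st: "s = (a, b)" "t = (c, d)" by fastforce
  obtain F G R S where "fexact Q (iv Q t) (dsum (iv Q (a, d)) (iv Q (c, b))) (iv Q s :: (nat, 'a, 'k) qrep) F G R S"
    using cross_exact(3)[of a b c d] s t x unfolding st by blast
  with cross_nonsplit[of a b c d F G R S] s t x is_rep_dsum[OF is_rep_iv is_rep_iv] show ?thesis
    unfolding st all_split_def by blast
qed

text \<open>Disjoint intervals joined by an arrow are adjacent, so their union is again an interval.
  All arrows between them lead from s to t, so t is a subrepresentation of the union with quotient
  s.\<close>

lemma linked_exact:
  assumes s: "s \<in> segments n" and t: "t \<in> segments n" and no: "\<not> overlap s t" and l: "linked s t"
  shows "\<exists>u\<in>segments n. \<exists>F G R S. fexact Q (iv Q t) (iv Q u) (iv Q s :: (nat, 'a, 'k::field) qrep) F G R S \<and>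
    (\<forall>e\<in>arcs Q. cocycle_of Q (iv Q u) R S e = (if tail Q e \<in> ivl s \<and> head Q e \<in> ivl t then idm 1 else 0))"
proof -
  obtain a b c d where st: "s = (a, b)" "t = (c, d)" by fastforce
  have dis: "ivl s \<inter> ivl t = {}" using no overlap_iff by blast
  obtain e where e: "e \<in> arcs Q" "tail Q e \<in> ivl s" "head Q e \<in> ivl t" using l by (auto simp: linked_def)
  have "\<exists>u\<in>segments n. ivl u = ivl s \<union> ivl t \<and> (\<forall>e\<in>arcs Q. \<not> (tail Q e \<in> ivl t \<and> head Q e \<in> ivl s))"
  proof (rule arc_cases[OF e(1)])
    fix i assume i: "up i" "tail Q e = i" "head Q e = i + 1"
    have "i \<notin> ivl t" "i + 1 \<notin> ivl s" using e i dis by auto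
    then have bc: "b = i" "c = i" using e i by (auto simp: st ivl_def)
    have "\<not> (tail Q e' \<in> ivl t \<and> head Q e' \<in> ivl s)" if "e' \<in> arcs Q" for e'
    proof (rule arc_cases[OF that])
      fix j assume j: "up j" "tail Q e' = j" "head Q e' = j + 1"
      show ?thesis
      proof
        assume "tail Q e' \<in> ivl t \<and> head Q e' \<in> ivl s"
        then have "False" using j bc by (auto simp: st ivl_def)
        then show False using i j by auto
      qed
    next
      fix j assume j: "\<not> up j" "tail Q e' = j + 1" "head Q e' = j"
      show ?thesis
      proof
        assume "tail Q e' \<in> ivl t \<and> head Q e' \<in> ivl s"
        then have "j = i" using j bc by (auto simp: st ivl_def)
        then show False using i j by auto
      qed
    qed
    moreover have "(a, d) \<in> segments n" "ivl (a, d) = ivl s \<union> ivl t"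
      using s t bc by (auto simp: st mem_segments ivl_def)
    ultimately show ?thesis by blast
  next
    fix i assume i: "\<not> up i" "tail Q e = i + 1" "head Q e = i"
    have "i + 1 \<notin> ivl t" "i \<notin> ivl s" using e i dis by auto
    then have bc: "a = i" "d = i" using e i by (auto simp: st ivl_def)
    have "\<not> (tail Q e' \<in> ivl t \<and> head Q e' \<in> ivl s)" if "e' \<in> arcs Q" for e'
    proof (rule arc_cases[OF that])
      fix j assume j: "up j" "tail Q e' = j" "head Q e' = j + 1"
      show ?thesis
      proof
        assume "tail Q e' \<in> ivl t \<and> head Q e' \<in> ivl s"
        then have "j = i" using j bc by (auto simp: st ivl_def)
        then show False using i j by auto
      qed
    next
      fix j assume j: "\<not> up j" "tail Q e' = j + 1" "head Q e' = j"
      show ?thesis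
      proof
        assume "tail Q e' \<in> ivl t \<and> head Q e' \<in> ivl s"
        then have "False" using j bc by (auto simp: st ivl_def)
        then show False using i j by auto
      qed
    qed
    moreover have "(c, b) \<in> segments n" "ivl (c, b) = ivl s \<union> ivl t"
      using s t bc by (auto simp: st mem_segments ivl_def)
    ultimately show ?thesis by blast
  qed
  then obtain u where u: "u \<in> segments n" "ivl u = ivl s \<union> ivl t"
    and nb: "\<And>e. e \<in> arcs Q \<Longrightarrow> \<not> (tail Q e \<in> ivl t \<and> head Q e \<in> ivl s)" by blast
  have "overlap_hom t u" "overlap_hom u s" using nb u(2) dis by (auto simp: overlap_hom_def)
  then have h: "fhom Q (iv Q t) (iv Q u) (ind (ivl t))" "fhom Q (iv Q u) (iv Q s) (ind (ivl s))"
    using fhom_ind[of t u] fhom_ind[of u s] u s t by (auto simp: mem_segments Int_absorb1 Int_absorb2)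
  have sup: "fsup Q (iv Q u) (iv Q t) (ind (ivl t))" "fsup Q (iv Q s) (iv Q u) (ind (ivl s))"
    by (rule fsup_iv; use u s t in \<open>auto simp: ind_def mem_segments fcar_idm[of 1, unfolded One_nat_def]\<close>)+
  have "ind (ivl t) + ind (ivl s) = ind (ivl u)" using ind_add[of "ivl t" "ivl s"] dis u(2) by (simp add: Int_commute Un_commute)
  then have "fexact Q (iv Q t) (iv Q u) (iv Q s :: (nat, 'a, 'k) qrep) (ind (ivl t)) (ind (ivl s)) (ind (ivl t)) (ind (ivl s))"
    using h sup s t u by (simp add: fexact_def idf_iv_seg)
  moreover have "cocycle_of Q (iv Q u) (ind (ivl t)) (ind (ivl s)) e =
      (if tail Q e \<in> ivl s \<and> head Q e \<in> ivl t then idm 1 else 0)" for e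
    by (auto simp: cocycle_of_def mm_iv ind_def u(2))
  ultimately show ?thesis using u(1) by blast
qed

text \<open>A single arrow leads from s into t, and both spaces there have dimension one, so
  cocycles form a line. The generator is the extension of intervals, carried over to A and B along
  the isomorphisms.\<close>

lemma linked_line:
  fixes A B :: "(nat, 'a, 'k::field) qrep"
  assumes A: "is_rep Q A" "fiso Q A (iv Q s)" and B: "is_rep Q B" "fiso Q B (iv Q t)"
    and s: "s \<in> segments n" and t: "t \<in> segments n" and no: "\<not> overlap s t" and l: "linked s t"
  shows "\<exists>E f g. indecomposable Q E \<and> Ext1_line_generated_by Q A B (E, f, g)"
proof -
  obtain \<alpha> \<alpha>' where \<alpha>: "fhom Q (iv Q s) A \<alpha>'" "fhom Q A (iv Q s) \<alpha>" "\<alpha> * \<alpha>' = idf Q (iv Q s)" "\<alpha>' * \<alpha> = idf Q A"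
    using A(2) by (auto simp: fiso_def)
  obtain \<beta> \<beta>' where \<beta>: "fhom Q B (iv Q t) \<beta>" "fhom Q (iv Q t) B \<beta>'" "\<beta>' * \<beta> = idf Q B" "\<beta> * \<beta>' = idf Q (iv Q t)"
    using B(2) by (auto simp: fiso_def)
  obtain u F G R S where u: "u \<in> segments n" and ex: "fexact Q (iv Q t) (iv Q u) (iv Q s :: (nat, 'a, 'k) qrep) F G R S"
    and z: "\<And>e. e \<in> arcs Q \<Longrightarrow> cocycle_of Q (iv Q u) R S e = (if tail Q e \<in> ivl s \<and> head Q e \<in> ivl t then idm 1 else 0)"
    using linked_exact[OF s t no l] by blast
  let ?E = "iv Q u :: (nat, 'a, 'k) qrep"
  note ex' = fexact_transport[OF ex \<beta> \<alpha>(1,2,3,4)]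
  let ?f = "unfam B ?E (F * \<beta>)" and ?g = "unfam ?E A (\<alpha>' * G)"
  have fam: "fam Q ?f = F * \<beta>" "fam Q ?g = \<alpha>' * G"
    using ex' by (auto intro!: fam_unfam fhom_fsup simp: fexact_def)
  define z0 where "z0 e = \<beta>' (head Q e) * (if tail Q e \<in> ivl s \<and> head Q e \<in> ivl t then idm 1 else 0) * \<alpha> (tail Q e)" for e
  have coc: "cocycle_of Q ?E (\<beta>' * R) (S * \<alpha>) e = z0 e" if "e \<in> arcs Q" for e
  proof -
    have "cocycle_of Q ?E (\<beta>' * R) (S * \<alpha>) e = \<beta>' (head Q e) * cocycle_of Q ?E R S e * \<alpha> (tail Q e)"
      by (simp add: cocycle_of_def mult.assoc)
    then show ?thesis unfolding z[OF that] z0_def .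
  qed
  have dA: "vdim A v = (if v \<in> ivl s then 1 else 0)" and dB: "vdim B v = (if v \<in> ivl t then 1 else 0)" if "v \<in> verts Q" for v
    using fiso_vdim[OF A(2) that] fiso_vdim[OF B(2) that] by (auto simp: vdim_iv)
  have dis: "ivl s \<inter> ivl t = {}" using no overlap_iff by blast
  have ds: "disjoint_supp Q A B" unfolding disjoint_supp_def using dA dB dis by auto
  have ce: "cocyc Q A B (?E, ?f, ?g) z0"
    using short_exact_unfam[OF wf B(1) is_rep_iv A(1) ex'] ex' coc fam is_rep_iv[of Q u]
    unfolding cocyc_def extensions_def prod.case by auto
  have ht: "head Q e \<in> verts Q" "tail Q e \<in> verts Q" if "e \<in> arcs Q" for e
    using wf that by (auto simp: wf_digraph_def)
  have inv: "\<beta> v * \<beta>' v = ind (ivl t) v" "\<alpha> v * \<alpha>' v = ind (ivl s) v" "\<beta>' v * \<beta> v = idf Q B v" "\<alpha>' v * \<alpha> v = idf Q A v" for v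
    using fun_cong[OF \<beta>(4), of v] fun_cong[OF \<alpha>(3), of v] fun_cong[OF \<beta>(3), of v] fun_cong[OF \<alpha>(4), of v]
    by (auto simp: idf_iv_seg[OF s] idf_iv_seg[OF t])
  have line: "\<exists>c. \<forall>e\<in>arcs Q. y e = sm c (z0 e)"
    if y: "\<And>e. e \<in> arcs Q \<Longrightarrow> fcar (vdim B (head Q e)) (vdim A (tail Q e)) (y e)" for y
  proof -
    obtain e0 where e0: "e0 \<in> arcs Q" "tail Q e0 \<in> ivl s" "head Q e0 \<in> ivl t" using l by (auto simp: linked_def)
    \<comment> \<open>The cocycle carried back to the intervals, where on the arrow from s to t it
      is a 1 by 1 matrix; its entry is the scalar sought.\<close>
    define x where "x e = \<beta> (head Q e) * y e * \<alpha>' (tail Q e)" for e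
    have "y e = sm (ent (x e0) 0 0) (z0 e)" if e: "e \<in> arcs Q" for e
    proof (cases "tail Q e \<in> ivl s \<and> head Q e \<in> ivl t")
      case True
      have "e = e0"
      proof -
        obtain a b c d where st: "s = (a, b)" "t = (c, d)" by fastforce
        have "tail Q e = tail Q e0 \<and> head Q e = head Q e0"
          by (rule arc_cases[OF e]; rule arc_cases[OF e0(1)]; use True e0 dis in \<open>auto simp: st ivl_def\<close>)
        then show ?thesis using arc_unique e e0(1) by blast
      qed
      have fx: "fcar 1 1 (x e0)"
      proof -
        have "fcar 1 1 (\<beta> (head Q e0))" "fcar 1 1 (\<alpha>' (tail Q e0))"
          using fhom_fsup[OF \<beta>(1), unfolded fsup_iff vdim_iv, rule_format, of "head Q e0"]
            fhom_fsup[OF \<alpha>(1), unfolded fsup_iff vdim_iv, rule_format, of "tail Q e0"] ht[OF e0(1)] e0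
          by (simp_all add: dA dB)
        moreover have "fcar 1 1 (y e0)" using y[OF e0(1)] ht[OF e0(1)] e0 by (simp add: dA dB)
        ultimately show ?thesis unfolding x_def by (meson fcar_mult)
      qed
      have yy: "idf Q B (head Q e0) * y e0 * idf Q A (tail Q e0) = y e0"
        using y[OF e0(1)] ht[OF e0(1)] by (simp add: idf_def fcar_def)
      have "\<beta>' (head Q e0) * x e0 * \<alpha> (tail Q e0) =
          (\<beta>' (head Q e0) * \<beta> (head Q e0)) * y e0 * (\<alpha>' (tail Q e0) * \<alpha> (tail Q e0))"
        by (simp only: x_def mult.assoc)
      also have "\<dots> = y e0" unfolding inv(3,4) by (rule yy)
      finally have "y e0 = \<beta>' (head Q e0) * sm (ent (x e0) 0 0) (idm 1) * \<alpha> (tail Q e0)"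
        using fcar_1_eq[OF fx] by simp
      also have "\<dots> = sm (ent (x e0) 0 0) (\<beta>' (head Q e0) * idm 1 * \<alpha> (tail Q e0))"
        by (simp only: sm_mult_left sm_mult_right)
      also have "\<beta>' (head Q e0) * idm 1 * \<alpha> (tail Q e0) = z0 e0" using e0 by (simp add: z0_def)
      finally show ?thesis using \<open>e = e0\<close> by simp
    next
      case False
      then have "y e = 0"
        using fcar_trivial[OF y[OF e]] ht[OF e] by (auto simp: dA dB)
      moreover have "z0 e = 0" unfolding z0_def if_not_P[OF False] by simp
      ultimately show ?thesis by simp
    qed
    then show ?thesis by blast
  qed
  have nz: "\<exists>e\<in>arcs Q. z0 e \<noteq> 0"
  proof -
    obtain e0 where e0: "e0 \<in> arcs Q" "tail Q e0 \<in> ivl s" "head Q e0 \<in> ivl t" using l by (auto simp: linked_def)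
    have z0e: "z0 e0 = \<beta>' (head Q e0) * idm 1 * \<alpha> (tail Q e0)" using e0 by (simp add: z0_def)
    have "\<beta> (head Q e0) * z0 e0 * \<alpha>' (tail Q e0) =
        (\<beta> (head Q e0) * \<beta>' (head Q e0)) * idm 1 * (\<alpha> (tail Q e0) * \<alpha>' (tail Q e0))"
      by (simp only: z0e mult.assoc)
    also have "\<dots> = idm 1" unfolding inv(1,2) using e0 by (simp add: ind_def)
    finally have "\<beta> (head Q e0) * z0 e0 * \<alpha>' (tail Q e0) = idm 1" .
    then have "z0 e0 \<noteq> 0" by auto
    then show ?thesis using e0(1) by blast
  qed
  from Ext1_line[OF wf A(1) B(1) ds ce line nz] indecomposable_iv[OF u] show ?thesis by blast
qed

text \<open>If the segments cross, some extension does not split, while the middle term of any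
  extension has dimension at least two at a common vertex; an indecomposable one has dimension at
  most one everywhere.\<close>

lemma ext_condition_iff:
  fixes A B :: "(nat, 'a, 'k::field) qrep"
  assumes A: "is_rep Q A" "fiso Q A (iv Q s)" and B: "is_rep Q B" "fiso Q B (iv Q t)"
    and s: "s \<in> segments n" and t: "t \<in> segments n"
  shows "is_singleton (Ext1 Q A B) \<or> (\<exists>E f g. indecomposable Q E \<and> Ext1_line_generated_by Q A B (E, f, g))
    \<longleftrightarrow> \<not> cross s t"
proof
  assume h: "is_singleton (Ext1 Q A B) \<or> (\<exists>E f g. indecomposable Q E \<and> Ext1_line_generated_by Q A B (E, f, g))"
  show "\<not> cross s t"
  proof
    assume x: "cross s t"
    have "\<not> all_split Q A B"
      using cross_not_all_split[OF s t x] all_split_transport[OF fiso_sym[OF A(2)] fiso_sym[OF B(2)]] by blast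
    then obtain E f g where E: "indecomposable Q E" and l: "Ext1_line_generated_by Q A B (E, f, g)"
      using h Ext1_singleton_iff[OF wf A(1) B(1)] by blast
    have rE: "is_rep Q E" and "short_exact Q B E A f g"
      using l by (auto simp: Ext1_line_generated_by_def extensions_def)
    then obtain R S where ex: "fexact Q B E A (fam Q f) (fam Q g) R S"
      using short_exactD[OF wf B(1) _ A(1)] by blast
    obtain v where v: "v \<in> ivl s" "v \<in> ivl t" using cross_overlap[OF x] overlap_iff by blast
    have vQ: "v \<in> verts Q" using v(1) ivl_verts[OF s] by blast
    obtain u where u: "fiso Q E (iv Q u)" using E indecomposable_iff by blast
    show False
      using fexact_vdim[OF ex vQ] fiso_vdim[OF u vQ] fiso_vdim[OF A(2) vQ] fiso_vdim[OF B(2) vQ] v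
      by (simp add: vdim_iv split: if_splits)
  qed
next
  assume nc: "\<not> cross s t"
  show "is_singleton (Ext1 Q A B) \<or> (\<exists>E f g. indecomposable Q E \<and> Ext1_line_generated_by Q A B (E, f, g))"
  proof (cases "\<not> linked s t \<or> overlap s t")
    case True
    then have "all_split Q (iv Q s :: (nat, 'a, 'k) qrep) (iv Q t)" using all_split_iv[OF s t] nc by blast
    then show ?thesis
      using all_split_transport[OF A(2) B(2)] Ext1_singleton_iff[OF wf A(1) B(1)] by blast
  next
    case False
    then show ?thesis using linked_line[OF A B s t] by blast
  qed
qed

end

section \<open>Crossing segments in the polygon\<close>

text \<open>Integers stand for points on a circle cut open at one place. All inequalities are
  strict, so chords with a common end never interleave.\<close>

definition separates :: "int \<Rightarrow> int \<Rightarrow> int \<Rightarrow> int \<Rightarrow> bool" where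
  "separates a b c d \<longleftrightarrow> min a b < c \<and> c < max a b \<and> (d < min a b \<or> max a b < d)"

definition interleave :: "int \<Rightarrow> int \<Rightarrow> int \<Rightarrow> int \<Rightarrow> bool" where
  "interleave a b c d \<longleftrightarrow> separates a b c d \<or> separates a b d c"

text \<open>The points a and d are joined by a path along the crossing chords ab and cd. A chord
  that separates a from d must meet this path.\<close>

lemma interleave_side_aux:
  assumes ab: "a < b" and 1: "interleave a b c d" "interleave e f a d"
  shows "interleave e f a b \<or> interleave e f c d"
proof (rule ccontr)
  assume n: "\<not> (interleave e f a b \<or> interleave e f c d)"
  define x y where "x = min e f" and "y = max e f"
  have n': "\<not> (x < a \<and> a < y \<and> (b < x \<or> y < b))" "\<not> (x < b \<and> b < y \<and> (a < x \<or> y < a))"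
    "\<not> (x < c \<and> c < y \<and> (d < x \<or> y < d))" "\<not> (x < d \<and> d < y \<and> (c < x \<or> y < c))"
    using n by (auto simp: interleave_def separates_def x_def y_def)
  have c': "x < a \<and> a < y \<and> (d < x \<or> y < d) \<or> x < d \<and> d < y \<and> (a < x \<or> y < a)"
    using 1(2) by (auto simp: interleave_def separates_def x_def y_def)
  have s': "a < c \<and> c < b \<and> (d < a \<or> b < d) \<or> a < d \<and> d < b \<and> (c < a \<or> b < c)"
    using 1(1) ab by (auto simp: interleave_def separates_def)
  from c' s' n' show False by linarith
qed

lemma interleave_uminus: "interleave (- a) (- b) (- c) (- d) \<longleftrightarrow> interleave a b c d"
  by (auto simp: interleave_def separates_def min_def max_def)

lemma interleave_side:
  assumes "interleave a b c d" "interleave e f a d"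
  shows "interleave e f a b \<or> interleave e f c d"
proof -
  consider "a < b" | "- a < - b" | "a = b" by linarith
  then show ?thesis
  proof cases
    case 1
    then show ?thesis using interleave_side_aux assms by blast
  next
    case 2
    then show ?thesis
      using interleave_side_aux[of "- a" "- b" "- c" "- d" "- e" "- f"] assms by (simp add: interleave_uminus)
  next
    case 3
    then have "\<not> interleave a b c d" by (simp add: interleave_def separates_def)
    then show ?thesis using assms(1) by contradiction
  qed
qed

text \<open>Going once around the polygon, the lower vertices are passed in increasing and then the upper
  ones in decreasing order; \<open>u\<^sub>v\<close> says whether \<open>v\<close> is an upper vertex.\<close>

lemma crossing_interleave:
  fixes a b c d N :: int
  assumes "a < b" "b \<le> N" "c < d" "d \<le> N" "0 \<le> a" "0 \<le> c"
    "ua \<Longrightarrow> 0 < a" "ub \<Longrightarrow> b < N" "uc \<Longrightarrow> 0 < c" "ud \<Longrightarrow> d < N"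
    "a = c \<Longrightarrow> ua = uc" "a = d \<Longrightarrow> ua = ud" "b = c \<Longrightarrow> ub = uc" "b = d \<Longrightarrow> ub = ud"
  shows "(max a c < min b d \<and> (a < c \<and> uc \<or> c < a \<and> \<not> ua) \<and> (d < b \<and> \<not> ud \<or> b < d \<and> ub)) \<or>
   (max c a < min d b \<and> (c < a \<and> ua \<or> a < c \<and> \<not> uc) \<and> (b < d \<and> \<not> ub \<or> d < b \<and> ud))
  \<longleftrightarrow> interleave (if ua then 2 * N - a else a) (if ub then 2 * N - b else b)
        (if uc then 2 * N - c else c) (if ud then 2 * N - d else d)"
proof -
  note d = interleave_def separates_def min_def max_def
  consider "a = c" | "b = d" "a \<noteq> c" | "b \<le> c" | "d \<le> a"
    | "a < c" "c < b" "b < d" | "a < c" "c < b" "d < b" | "c < a" "a < d" "b < d" | "c < a" "a < d" "d < b"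
    by linarith
  then show ?thesis
  proof cases
    case 1 then show ?thesis using assms(11) by (simp add: interleave_def separates_def)
  next
    case 2 then show ?thesis using assms(14) by (simp add: interleave_def separates_def)
  next
    case 3 then show ?thesis using assms by (cases ua; cases ub; cases uc; cases ud) (auto simp: d)
  next
    case 4 then show ?thesis using assms by (cases ua; cases ub; cases uc; cases ud) (auto simp: d)
  next
    case 5 then show ?thesis using assms by (cases ua; cases ub; cases uc; cases ud) (auto simp: d)
  next
    case 6 then show ?thesis using assms by (cases ua; cases ub; cases uc; cases ud) (auto simp: d)
  next
    case 7 then show ?thesis using assms by (cases ua; cases ub; cases uc; cases ud) (auto simp: d)
  next
    case 8 then show ?thesis using assms by (cases ua; cases ub; cases uc; cases ud) (auto simp: d)
  qed
qed

section \<open>Chords of convex sets and affine functions\<close>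

lemma convex_chord:
  fixes x1 x2 x y1 y2 :: real
  assumes C: "convex C" and "(x1, y1) \<in> C" "(x2, y2) \<in> C" and x: "x1 < x2" "x1 \<le> x" "x \<le> x2"
  shows "(x, y1 + (y2 - y1) / (x2 - x1) * (x - x1)) \<in> C"
proof -
  define v where "v = (x - x1) / (x2 - x1)"
  have v: "v * (x2 - x1) = x - x1" "0 \<le> v" "v \<le> 1" using x by (auto simp: v_def)
  have "(1 - v) *\<^sub>R (x1, y1) + v *\<^sub>R (x2, y2) \<in> C"
    by (intro convexD[OF C]) (use assms v in auto)
  moreover have "(1 - v) * x1 + v * x2 = x" using v(1) by (simp add: algebra_simps)
  moreover have "(y2 - y1) / (x2 - x1) * (x - x1) = (y2 - y1) * v" by (simp add: v_def)
  then have "(1 - v) * y1 + v * y2 = y1 + (y2 - y1) / (x2 - x1) * (x - x1)" by (simp add: algebra_simps)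
  ultimately show ?thesis by simp
qed

lemma convex_vertical:
  fixes x y y1 y2 :: real
  assumes C: "convex C" and "(x, y1) \<in> C" "(x, y2) \<in> C" and y: "y1 < y2" "y1 \<le> y" "y \<le> y2"
  shows "(x, y) \<in> C"
proof -
  define v where "v = (y - y1) / (y2 - y1)"
  have v: "v * (y2 - y1) = y - y1" "0 \<le> v" "v \<le> 1" using y by (auto simp: v_def)
  have "(1 - v) *\<^sub>R (x, y1) + v *\<^sub>R (x, y2) \<in> C"
    by (intro convexD[OF C]) (use assms v in auto)
  moreover have "(1 - v) * y1 + v * y2 = y" using v(1) by (simp add: algebra_simps)
  moreover have "(1 - v) * x + v * x = x" by (simp add: algebra_simps)
  ultimately show ?thesis by simp
qed

lemma mem_open_segment:
  fixes x1 x2 x y1 y2 y :: real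
  assumes "x1 < x2"
  shows "(x, y) \<in> open_segment (x1, y1) (x2, y2) \<longleftrightarrow>
    x1 < x \<and> x < x2 \<and> y = y1 + (y2 - y1) / (x2 - x1) * (x - x1)"
proof
  assume "(x, y) \<in> open_segment (x1, y1) (x2, y2)"
  then obtain u where u: "0 < u" "u < 1" "x = (1 - u) * x1 + u * x2" "y = (1 - u) * y1 + u * y2"
    by (auto simp: in_segment)
  have x: "x - x1 = u * (x2 - x1)" using u(3) by (simp add: algebra_simps)
  moreover have "0 < u * (x2 - x1)" "u * (x2 - x1) < x2 - x1" using u(1,2) assms by auto
  ultimately have "x1 < x" "x < x2" by linarith+
  moreover have "y = y1 + (y2 - y1) / (x2 - x1) * (x - x1)"
  proof -
    have "(y2 - y1) / (x2 - x1) * (x - x1) = (y2 - y1) * u" unfolding x using assms by simp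
    then show ?thesis unfolding u(4) by (simp add: algebra_simps)
  qed
  ultimately show "x1 < x \<and> x < x2 \<and> y = y1 + (y2 - y1) / (x2 - x1) * (x - x1)" by blast
next
  assume h: "x1 < x \<and> x < x2 \<and> y = y1 + (y2 - y1) / (x2 - x1) * (x - x1)"
  define u where "u = (x - x1) / (x2 - x1)"
  have u: "u * (x2 - x1) = x - x1" "0 < u" "u < 1" using h assms by (auto simp: u_def)
  have "x = (1 - u) * x1 + u * x2" using u(1) by (simp add: algebra_simps)
  moreover have "(y2 - y1) / (x2 - x1) * (x - x1) = (y2 - y1) * u" by (simp add: u_def)
  then have "y = (1 - u) * y1 + u * y2" using h by (simp add: algebra_simps)
  ultimately show "(x, y) \<in> open_segment (x1, y1) (x2, y2)"
    unfolding in_segment using u assms by (intro conjI exI[of _ u]) auto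
qed

text \<open>An affine function has a root strictly inside an interval if it changes sign between the
  ends or is identically zero; the latter is the third alternative. This reduces the crossing of
  segments to signs at two abscissas.\<close>

lemma affine_root:
  fixes A B x0 x1 :: real
  assumes "x0 < x1"
  shows "(\<exists>x. x0 < x \<and> x < x1 \<and> A + B * x = 0) \<longleftrightarrow>
    A + B * x0 < 0 \<and> 0 < A + B * x1 \<or> 0 < A + B * x0 \<and> A + B * x1 < 0 \<or> A + B * x0 = 0 \<and> A + B * x1 = 0"
    (is "?l \<longleftrightarrow> ?r")
proof
  assume ?l
  then obtain x where x: "x0 < x" "x < x1" "A + B * x = 0" by blast
  have e: "A + B * x0 = - (B * (x - x0))" "A + B * x1 = B * (x1 - x)" using x(3) by (simp_all add: algebra_simps)
  consider "B < 0" | "B = 0" | "0 < B" by linarith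
  then show ?r
  proof cases
    case 1
    then have "B * (x - x0) < 0" "B * (x1 - x) < 0" using x by (auto simp: mult_neg_pos)
    then show ?thesis unfolding e by simp
  next
    case 2 then show ?thesis unfolding e by simp
  next
    case 3
    then have "0 < B * (x - x0)" "0 < B * (x1 - x)" using x by auto
    then show ?thesis unfolding e by simp
  qed
next
  assume r: ?r
  consider "B < 0" | "B = 0" | "0 < B" by linarith
  then show ?l
  proof cases
    case 2
    then show ?thesis using r assms dense[OF assms] by auto
  next
    case 1
    have "B * x1 < B * x0" using 1 assms by simp
    then have "0 < A + B * x0" "A + B * x1 < 0" using r by auto
    then show ?thesis using 1 by (intro exI[of _ "- A / B"]) (auto simp: field_simps)
  next
    case 3
    have "B * x0 < B * x1" using 3 assms by simp
    then have "A + B * x0 < 0" "0 < A + B * x1" using r by auto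
    then show ?thesis using 3 by (intro exI[of _ "- A / B"]) (auto simp: field_simps)
  qed
qed

context type_A
begin

definition crossed :: "nat \<times> nat \<Rightarrow> nat \<times> nat \<Rightarrow> bool" where
  "crossed s t \<longleftrightarrow> cross s t \<or> cross t s"

lemma crossed_sym: "crossed s t \<longleftrightarrow> crossed t s"
  by (auto simp: crossed_def)

lemma crossed_irrefl: "\<not> crossed s s"
  by (simp add: crossed_def cross_def)

lemma up_bounds: "up i \<Longrightarrow> 1 \<le> i \<and> i \<le> n + 1"
proof -
  assume "up i"
  then obtain e where e: "e \<in> arcs Q" "tail Q e = i" "head Q e = i + 1" using up_arc by blast
  show ?thesis by (rule arc_cases[OF e(1)]) (use e in auto)
qed

definition circular :: "nat \<Rightarrow> int" where
  "circular v = (if up v then 2 * int (n + 2) - int v else int v)"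

lemma crossed_interleave:
  assumes "(a, b) \<in> segments n" "(c, d) \<in> segments n"
  shows "crossed (a, b) (c, d) \<longleftrightarrow> interleave (circular a) (circular b) (circular c) (circular d)"
proof -
  have "(max (int a) (int c) < min (int b) (int d) \<and> (int a < int c \<and> up c \<or> int c < int a \<and> \<not> up a) \<and>
      (int d < int b \<and> \<not> up d \<or> int b < int d \<and> up b)) \<or>
    (max (int c) (int a) < min (int d) (int b) \<and> (int c < int a \<and> up a \<or> int a < int c \<and> \<not> up c) \<and>
      (int b < int d \<and> \<not> up b \<or> int d < int b \<and> up d))
    \<longleftrightarrow> interleave (circular a) (circular b) (circular c) (circular d)"
    unfolding circular_def
    by (rule crossing_interleave) (use assms up_bounds in \<open>force simp: mem_segments\<close>)+
  then show ?thesis by (simp add: crossed_def cross_def)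
qed

text \<open>Read backwards: a segment that crosses neither diagonal of a quadrilateral does not
  cross its sides, so that the sides can be added to any set avoiding both diagonals.\<close>

lemma crossed_side:
  assumes s: "(a, b) \<in> segments n" and t: "(c, d) \<in> segments n" and x: "crossed (a, b) (c, d)"
    and ad: "(a, d) \<in> segments n" and e: "(e, f) \<in> segments n" and ex: "crossed (e, f) (a, d)"
  shows "crossed (e, f) (a, b) \<or> crossed (e, f) (c, d)"
  using interleave_side x ex unfolding crossed_interleave[OF s t] crossed_interleave[OF e s]
    crossed_interleave[OF e t] crossed_interleave[OF e ad] by blast

end

locale polygon = type_A +
  fixes p :: "nat \<Rightarrow> real \<times> real"
  assumes polygon: "is_polygon n Q p"
begin

definition height :: "nat \<times> nat \<Rightarrow> real \<Rightarrow> real" where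
  "height s x = snd (p (fst s)) + slope p s * (x - fst (p (fst s)))"

lemma abscissa_mono: "i < j \<Longrightarrow> j \<le> n + 2 \<Longrightarrow> fst (p i) < fst (p j)"
  using polygon by (auto simp: is_polygon_def)

lemma upper_vertex: "1 \<le> i \<Longrightarrow> i \<le> n + 1 \<Longrightarrow> up i \<Longrightarrow> snd (p 0) < snd (p i)"
  using polygon up_arc[of i] by (auto simp: is_polygon_def upper_set_def)

lemma lower_vertex: "1 \<le> i \<Longrightarrow> i \<le> n + 1 \<Longrightarrow> \<not> up i \<Longrightarrow> snd (p i) < snd (p 0)"
  using polygon down_arc[of i] by (auto simp: is_polygon_def lower_set_def)

lemma height_ends: "s \<in> segments n \<Longrightarrow> height s (fst (p (fst s))) = snd (p (fst s))"
  "s \<in> segments n \<Longrightarrow> height s (fst (p (snd s))) = snd (p (snd s))"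
  using abscissa_mono[of "fst s" "snd s"] by (auto simp: height_def slope_def mem_segments split: prod.splits)

lemma height_in_hull:
  assumes "convex C" "p i \<in> C" "p k \<in> C" "i < k" "k \<le> n + 2" "fst (p i) \<le> x" "x \<le> fst (p k)"
  shows "(x, height (i, k) x) \<in> C"
  using convex_chord[OF assms(1), of "fst (p i)" "snd (p i)" "fst (p k)" "snd (p k)" x] assms abscissa_mono[of i k]
  by (simp add: height_def slope_def)

text \<open>On the vertical line through vertex j, the convex hull of the other vertices contains a
  point of the base line and a point of the chord. An upper vertex lies above the base line; were it
  not above the chord too, it would lie between these two points, hence in the hull. Lower vertices
  are symmetric.\<close>

lemma vertex_vs_chord:
  assumes ij: "i < j" "j < k" "k \<le> n + 2"
  shows "up j \<Longrightarrow> height (i, k) (fst (p j)) < snd (p j)" "\<not> up j \<Longrightarrow> snd (p j) < height (i, k) (fst (p j))"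
proof -
  let ?C = "convex hull (p ` ({..n + 2} - {j}))"
  have C: "convex ?C" by simp
  have pC: "p l \<in> ?C" if "l \<le> n + 2" "l \<noteq> j" for l
    using that by (intro hull_inc) auto
  have h: "(fst (p j), height (i, k) (fst (p j))) \<in> ?C"
    using ij abscissa_mono[of i j] abscissa_mono[of j k] by (intro height_in_hull[OF C] pC) auto
  \<comment> \<open>The base line joins the first and the last vertex, both different from j, so its
    point on the vertical line belongs to the hull.\<close>
  have "height (0, n + 2) x = snd (p 0)" for x
    using polygon by (simp add: height_def slope_def is_polygon_def)
  then have h0: "(fst (p j), snd (p 0)) \<in> ?C"
    using height_in_hull[OF C, of 0 "n + 2" "fst (p j)"] pC[of 0] pC[of "n + 2"] ij
      abscissa_mono[of 0 j] abscissa_mono[of j "n + 2"] by auto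
  have nC: "(fst (p j), snd (p j)) \<notin> ?C"
    using polygon ij by (simp add: is_polygon_def)
  show "up j \<Longrightarrow> height (i, k) (fst (p j)) < snd (p j)"
  proof (rule ccontr)
    assume u: "up j" "\<not> height (i, k) (fst (p j)) < snd (p j)"
    have "snd (p 0) < snd (p j)" using upper_vertex[OF _ _ u(1)] ij by simp
    then show False using convex_vertical[OF C h0 h, of "snd (p j)"] u(2) nC by simp
  qed
  show "\<not> up j \<Longrightarrow> snd (p j) < height (i, k) (fst (p j))"
  proof (rule ccontr)
    assume u: "\<not> up j" "\<not> snd (p j) < height (i, k) (fst (p j))"
    have "snd (p j) < snd (p 0)" using lower_vertex[OF _ _ u(1)] ij by simp
    then show False using convex_vertical[OF C h h0, of "snd (p j)"] u(2) nC by simp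
  qed
qed

text \<open>At the larger of the left ends one segment begins. The other begins there too or passes
  the vertex on a side that \<open>vertex_vs_chord\<close> decides. \<open>height_right\<close> is
  the mirror image.\<close>

lemma height_left:
  assumes s: "(a, b) \<in> segments n" and t: "(c, d) \<in> segments n" and m: "max a c < min b d"
  shows "height (a, b) (fst (p (max a c))) < height (c, d) (fst (p (max a c))) \<longleftrightarrow> (a < c \<and> up c \<or> c < a \<and> \<not> up a)"
    "height (a, b) (fst (p (max a c))) = height (c, d) (fst (p (max a c))) \<longleftrightarrow> a = c"
proof -
  note hs = height_ends[OF s] and ht = height_ends[OF t]
  consider "a = c" | "a < c" | "c < a" by linarith
  then have "(height (a, b) (fst (p (max a c))) < height (c, d) (fst (p (max a c))) \<longleftrightarrow> (a < c \<and> up c \<or> c < a \<and> \<not> up a))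
    \<and> (height (a, b) (fst (p (max a c))) = height (c, d) (fst (p (max a c))) \<longleftrightarrow> a = c)"
  proof cases
    case 1 then show ?thesis using hs ht by simp
  next
    case 2
    then have "a < c" "c < b" "b \<le> n + 2" using m s by (auto simp: mem_segments)
    from vertex_vs_chord[OF this] 2 show ?thesis using ht by (cases "up c") (auto simp: max_def)
  next
    case 3
    then have "c < a" "a < d" "d \<le> n + 2" using m t by (auto simp: mem_segments)
    from vertex_vs_chord[OF this] 3 show ?thesis using hs by (cases "up a") (auto simp: max_def)
  qed
  then show "height (a, b) (fst (p (max a c))) < height (c, d) (fst (p (max a c))) \<longleftrightarrow> (a < c \<and> up c \<or> c < a \<and> \<not> up a)"
    "height (a, b) (fst (p (max a c))) = height (c, d) (fst (p (max a c))) \<longleftrightarrow> a = c" by blast+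
qed

lemma height_right:
  assumes s: "(a, b) \<in> segments n" and t: "(c, d) \<in> segments n" and m: "max a c < min b d"
  shows "height (c, d) (fst (p (min b d))) < height (a, b) (fst (p (min b d))) \<longleftrightarrow> (d < b \<and> \<not> up d \<or> b < d \<and> up b)"
    "height (a, b) (fst (p (min b d))) = height (c, d) (fst (p (min b d))) \<longleftrightarrow> b = d"
proof -
  note hs = height_ends[OF s] and ht = height_ends[OF t]
  consider "b = d" | "b < d" | "d < b" by linarith
  then have "(height (c, d) (fst (p (min b d))) < height (a, b) (fst (p (min b d))) \<longleftrightarrow> (d < b \<and> \<not> up d \<or> b < d \<and> up b))
    \<and> (height (a, b) (fst (p (min b d))) = height (c, d) (fst (p (min b d))) \<longleftrightarrow> b = d)"
  proof cases
    case 1 then show ?thesis using hs ht by simp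
  next
    case 2
    then have "c < b" "b < d" "d \<le> n + 2" using m t by (auto simp: mem_segments)
    from vertex_vs_chord[OF this] 2 show ?thesis using hs by (cases "up b") (auto simp: min_def)
  next
    case 3
    then have "a < d" "d < b" "b \<le> n + 2" using m s by (auto simp: mem_segments)
    from vertex_vs_chord[OF this] 3 show ?thesis using ht by (cases "up d") (auto simp: min_def)
  qed
  then show "height (c, d) (fst (p (min b d))) < height (a, b) (fst (p (min b d))) \<longleftrightarrow> (d < b \<and> \<not> up d \<or> b < d \<and> up b)"
    "height (a, b) (fst (p (min b d))) = height (c, d) (fst (p (min b d))) \<longleftrightarrow> b = d" by blast+
qed

text \<open>The difference of the heights of s and t is affine, negative at the left end of the
  common range and positive at the right end, so it increases.\<close>

lemma cross_slope:
  assumes s: "s \<in> segments n" and t: "t \<in> segments n" and x: "cross s t"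
  shows "slope p t < slope p s"
proof -
  obtain a b c d where st: "s = (a, b)" "t = (c, d)" by fastforce
  have m: "max a c < min b d" using x by (simp add: cross_def st)
  let ?m = "fst (p (max a c))" and ?M = "fst (p (min b d))"
  have "?m < ?M" using abscissa_mono[OF m] s by (auto simp: st mem_segments)
  moreover have "height s ?m < height t ?m" "height t ?M < height s ?M"
    using height_left(1)[of a b c d] height_right(1)[of a b c d] s t m x by (auto simp: st cross_def)
  moreover have "height s ?M - height s ?m = slope p s * (?M - ?m)" "height t ?M - height t ?m = slope p t * (?M - ?m)"
    by (simp_all add: height_def algebra_simps)
  ultimately have "slope p t * (?M - ?m) < slope p s * (?M - ?m)" by linarith
  then show ?thesis using \<open>?m < ?M\<close> by (simp add: mult_less_cancel_right)
qed

lemma mem_open_chord: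
  assumes "s \<in> segments n"
  shows "(x, y) \<in> open_segment (p (fst s)) (p (snd s)) \<longleftrightarrow>
    fst (p (fst s)) < x \<and> x < fst (p (snd s)) \<and> y = height s x"
proof -
  obtain i j where s: "s = (i, j)" by fastforce
  then have "fst (p i) < fst (p j)" using assms abscissa_mono[of i j] by (auto simp: mem_segments)
  from mem_open_segment[OF this, of x y "snd (p i)" "snd (p j)"] show ?thesis
    by (simp add: s height_def slope_def)
qed

text \<open>The open segments meet if and only if the difference of their heights vanishes strictly
  inside the common range of abscissas. If it is zero at both ends of the range, the end points
  agree and the segments are equal, which \<open>crossing\<close> excludes.\<close>

lemma crossing_iff:
  assumes s: "s \<in> segments n" and t: "t \<in> segments n"
  shows "crossing p s t \<longleftrightarrow> crossed s t"
proof -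
  obtain a b c d where st: "s = (a, b)" "t = (c, d)" by fastforce
  have ab: "a < b" "b \<le> n + 2" "c < d" "d \<le> n + 2" using s t by (auto simp: st mem_segments)
  let ?X = "\<lambda>i. fst (p i)"
  have lt: "?X i < ?X j \<longleftrightarrow> i < j" if "i \<le> n + 2" "j \<le> n + 2" for i j
    using abscissa_mono[of i j] abscissa_mono[of j i] that by (cases i j rule: linorder_cases) auto
  have "crossing p s t \<longleftrightarrow> s \<noteq> t \<and> (\<exists>x y. (x, y) \<in> open_segment (p a) (p b) \<and> (x, y) \<in> open_segment (p c) (p d))"
    by (auto simp: crossing_def st)
  also have "\<dots> \<longleftrightarrow> s \<noteq> t \<and> (\<exists>x. ?X a < x \<and> x < ?X b \<and> ?X c < x \<and> x < ?X d \<and> height s x = height t x)"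
    using mem_open_chord[OF s] mem_open_chord[OF t] by (auto simp: st)
  also have "\<dots> \<longleftrightarrow> s \<noteq> t \<and> (\<exists>x. ?X (max a c) < x \<and> x < ?X (min b d) \<and> height s x = height t x)"
  proof -
    have "?X a < x \<and> ?X c < x \<longleftrightarrow> ?X (max a c) < x" "x < ?X b \<and> x < ?X d \<longleftrightarrow> x < ?X (min b d)" for x
      using lt[of a c] lt[of c a] lt[of b d] lt[of d b] ab by (auto simp: max_def min_def not_le)
    then show ?thesis by metis
  qed
  also have "\<dots> \<longleftrightarrow> crossed s t"
  proof (cases "max a c < min b d")
    case False
    then have "?X (min b d) \<le> ?X (max a c)"
      using lt[of "max a c" "min b d"] ab by auto
    then have "\<not> (\<exists>x. ?X (max a c) < x \<and> x < ?X (min b d) \<and> height s x = height t x)" by auto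
    moreover have "\<not> crossed s t" using False by (auto simp: crossed_def cross_def st)
    ultimately show ?thesis by blast
  next
    case True
    let ?m = "?X (max a c)" and ?M = "?X (min b d)"
    have mM: "?m < ?M" using lt[of "max a c" "min b d"] True ab by auto
    define A B where "A = height s 0 - height t 0" and "B = slope p s - slope p t"
    have D: "height s x - height t x = A + B * x" for x by (simp add: A_def B_def height_def algebra_simps)
    have "(\<exists>x. ?m < x \<and> x < ?M \<and> height s x = height t x) \<longleftrightarrow> (\<exists>x. ?m < x \<and> x < ?M \<and> A + B * x = 0)"
      by (simp flip: D)
    also have "\<dots> \<longleftrightarrow> height s ?m < height t ?m \<and> height t ?M < height s ?M \<or>
        height t ?m < height s ?m \<and> height s ?M < height t ?M \<or>
        height s ?m = height t ?m \<and> height s ?M = height t ?M"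
      unfolding affine_root[OF mM] unfolding D[symmetric] by auto
    finally have e: "(\<exists>x. ?m < x \<and> x < ?M \<and> height s x = height t x) \<longleftrightarrow> \<dots>" .
    have L: "height s ?m < height t ?m \<longleftrightarrow> (a < c \<and> up c \<or> c < a \<and> \<not> up a)"
      "height t ?m < height s ?m \<longleftrightarrow> (c < a \<and> up a \<or> a < c \<and> \<not> up c)" "height s ?m = height t ?m \<longleftrightarrow> a = c"
      using height_left[of a b c d] height_left[of c d a b] s t True by (auto simp: st max.commute)
    have R: "height t ?M < height s ?M \<longleftrightarrow> (d < b \<and> \<not> up d \<or> b < d \<and> up b)"
      "height s ?M < height t ?M \<longleftrightarrow> (b < d \<and> \<not> up b \<or> d < b \<and> up d)" "height s ?M = height t ?M \<longleftrightarrow> b = d"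
      using height_right[of a b c d] height_right[of c d a b] s t True by (auto simp: st min.commute)
    show ?thesis
      unfolding e L R using True by (auto simp: crossed_def cross_def st)
  qed
  finally show ?thesis .
qed

end

section \<open>The isomorphism of posets\<close>

text \<open>A path of C starting at \<open>f x\<close> stays inside B, so it lifts step by step
  along the bijection; injectivity identifies the end of the lifted path.\<close>

lemma rtrancl_transfer:
  assumes f: "bij_betw f A B" and R: "R \<subseteq> A \<times> A" and C: "C \<subseteq> B \<times> B"
    and RC: "\<And>x y. x \<in> A \<Longrightarrow> y \<in> A \<Longrightarrow> (x, y) \<in> R \<longleftrightarrow> (f x, f y) \<in> C"
    and x: "x \<in> A" and y: "y \<in> A"
  shows "(x, y) \<in> R\<^sup>* \<longleftrightarrow> (f x, f y) \<in> C\<^sup>*"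
proof
  assume "(x, y) \<in> R\<^sup>*"
  then show "(f x, f y) \<in> C\<^sup>*"
  proof (induction rule: rtrancl_induct)
    case (step y z)
    then have "(f y, f z) \<in> C" using R RC by blast
    with step show ?case by (meson rtrancl.rtrancl_into_rtrancl)
  qed simp
next
  assume "(f x, f y) \<in> C\<^sup>*"
  moreover have "\<exists>z\<in>A. f z = w \<and> (x, z) \<in> R\<^sup>*" if "(f x, w) \<in> C\<^sup>*" for w
    using that
  proof (induction rule: rtrancl_induct)
    case base
    then show ?case using x by blast
  next
    case (step v w)
    then obtain z where z: "z \<in> A" "f z = v" "(x, z) \<in> R\<^sup>*" by blast
    have "w \<in> B" using step C by blast
    then obtain z' where z': "z' \<in> A" "f z' = w" using f by (auto simp: bij_betw_def)
    then have "(z, z') \<in> R" using RC z step by blast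
    with z(3) have "(x, z') \<in> R\<^sup>*" by (rule rtrancl_into_rtrancl)
    with z' show ?case by blast
  qed
  ultimately obtain z where "z \<in> A" "f z = f y" "(x, z) \<in> R\<^sup>*" by blast
  then show "(x, y) \<in> R\<^sup>*" using f y by (metis bij_betw_def inj_onD)
qed

lemma partial_order_rtrancl:
  fixes w :: "'b \<Rightarrow> real"
  assumes w: "\<And>x y. (x, y) \<in> R \<Longrightarrow> w x < w y"
  shows "partial_order_on A (R\<^sup>* \<inter> A \<times> A)"
proof -
  have "w x < w y" if "(x, y) \<in> R\<^sup>+" for x y
    using that by (induction rule: trancl_induct) (use w in force)+
  then have "x = y" if "(x, y) \<in> R\<^sup>*" "(y, x) \<in> R\<^sup>*" for x y
    using that by (metis rtranclD less_asym)
  then show ?thesis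
    by (auto simp: partial_order_on_def preorder_on_def refl_on_def intro!: antisymI transI)
qed

context polygon
begin

definition noncrossing :: "(nat \<times> nat) set \<Rightarrow> bool" where
  "noncrossing S \<longleftrightarrow> S \<subseteq> segments n \<and> (\<forall>s\<in>S. \<forall>t\<in>S. \<not> crossed s t)"

lemma noncrossing_set_iff: "noncrossing_set n p S \<longleftrightarrow> noncrossing S"
  unfolding noncrossing_set_def noncrossing_def using crossing_iff by blast

text \<open>Noncrossing is a condition on pairs, so maximality can be tested by adding a single
  segment.\<close>

lemma triangulation_iff:
  "S \<in> triangulations n p \<longleftrightarrow> noncrossing S \<and> (\<forall>e\<in>segments n. (\<forall>s\<in>S. \<not> crossed e s) \<longrightarrow> e \<in> S)"
proof
  assume "S \<in> triangulations n p"
  then have nc: "noncrossing S" and mx: "\<And>S'. noncrossing S' \<Longrightarrow> S \<subseteq> S' \<Longrightarrow> S' = S"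
    by (auto simp: triangulations_def noncrossing_set_iff)
  have "e \<in> S" if e: "e \<in> segments n" "\<forall>s\<in>S. \<not> crossed e s" for e
  proof -
    have "noncrossing (insert e S)"
      using nc e crossed_irrefl crossed_sym unfolding noncrossing_def by blast
    then show ?thesis using mx[of "insert e S"] by blast
  qed
  with nc show "noncrossing S \<and> (\<forall>e\<in>segments n. (\<forall>s\<in>S. \<not> crossed e s) \<longrightarrow> e \<in> S)" by blast
next
  assume h: "noncrossing S \<and> (\<forall>e\<in>segments n. (\<forall>s\<in>S. \<not> crossed e s) \<longrightarrow> e \<in> S)"
  have "S' = S" if S': "noncrossing S'" "S \<subseteq> S'" for S'
    using h S' unfolding noncrossing_def by blast
  then show "S \<in> triangulations n p"
    using h by (auto simp: triangulations_def noncrossing_set_iff)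
qed

text \<open>The condition ranges over ordered pairs of summands and thus excludes
  \<open>cross\<close> in both directions, which together is the symmetric relation
  \<open>crossed\<close>.\<close>

lemma almost_rigid_iff:
  fixes T :: "(nat, 'a, 'k::field) qrep"
  shows "almost_rigid Q T \<longleftrightarrow> is_rep Q T \<and> mfree T \<and> noncrossing (supp T)"
proof (cases "is_rep Q T")
  case T: True
  let ?ok = "\<lambda>A B. is_singleton (Ext1 Q A B) \<or> (\<exists>E f g. indecomposable Q E \<and> Ext1_line_generated_by Q A B (E, f, g))"
  have "(\<forall>A B. indec_summand Q T A \<longrightarrow> indec_summand Q T B \<longrightarrow> ?ok A B) \<longleftrightarrow> noncrossing (supp T)"
  proof
    assume ok: "\<forall>A B. indec_summand Q T A \<longrightarrow> indec_summand Q T B \<longrightarrow> ?ok A B"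
    have nc: "\<not> cross s t" if st: "s \<in> supp T" "t \<in> supp T" for s t
    proof -
      have seg: "s \<in> segments n" "t \<in> segments n" using st supp_segments by blast+
      let ?s = "iv Q s :: (nat, 'a, 'k) qrep" and ?t = "iv Q t :: (nat, 'a, 'k) qrep"
      have reps: "is_rep Q ?s" "is_rep Q ?t" "fiso Q ?s ?s" "fiso Q ?t ?t"
        by (rule is_rep_iv fiso_refl[OF wf is_rep_iv])+
      then have "indec_summand Q T ?s" "indec_summand Q T ?t"
        unfolding indec_summand_iff[OF T] using st by blast+
      then have "?ok ?s ?t" using ok by blast
      then show ?thesis
        using ext_condition_iff[OF reps(1,3,2,4) seg] by blast
    qed
    then show "noncrossing (supp T)"
      using supp_segments unfolding noncrossing_def crossed_def by blast
  next
    assume nc: "noncrossing (supp T)"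
    show "\<forall>A B. indec_summand Q T A \<longrightarrow> indec_summand Q T B \<longrightarrow> ?ok A B"
    proof (intro allI impI)
      fix A B assume AB: "indec_summand Q T A" "indec_summand Q T B"
      obtain s where A: "is_rep Q A" "fiso Q A (iv Q s)" and s: "s \<in> supp T"
        using AB(1) indec_summand_iff[OF T] by blast
      obtain t where B: "is_rep Q B" "fiso Q B (iv Q t)" and t: "t \<in> supp T"
        using AB(2) indec_summand_iff[OF T] by blast
      have "\<not> cross s t" using nc s t by (auto simp: noncrossing_def crossed_def)
      moreover have "s \<in> segments n" "t \<in> segments n" using s t supp_segments by blast+
      ultimately show "?ok A B" using ext_condition_iff[OF A B] by blast
    qed
  qed
  then show ?thesis
    unfolding almost_rigid_def repeated_summand_iff[OF T] using T by blast
qed (simp add: almost_rigid_def)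

text \<open>It is enough to enlarge by single intervals: every nonzero M contains one, and by
  maximality of the triangulation that interval already occurs in T, where it would be
  repeated.\<close>

lemma maximal_almost_rigid_iff:
  fixes T :: "(nat, 'a, 'k::field) qrep"
  shows "maximal_almost_rigid Q T \<longleftrightarrow> is_rep Q T \<and> mfree T \<and> supp T \<in> triangulations n p"
proof
  assume m: "maximal_almost_rigid Q T"
  then have T: "is_rep Q T" and mf: "mfree T" and nc: "noncrossing (supp T)"
    by (auto simp: maximal_almost_rigid_def almost_rigid_iff)
  have "e \<in> supp T" if e: "e \<in> segments n" "\<forall>s\<in>supp T. \<not> crossed e s" for e
  proof (rule ccontr)
    assume ne: "e \<notin> supp T"
    let ?M = "iv Q e :: (nat, 'a, 'k) qrep"
    have "noncrossing (supp T \<union> {e})"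
      using nc e crossed_irrefl crossed_sym unfolding noncrossing_def by blast
    then have "almost_rigid Q (dsum T ?M)"
      unfolding almost_rigid_iff using ne mf e(1)
      by (simp add: is_rep_dsum T is_rep_iv mfree_dsum mfree_iv supp_iv supp_dsum)
    moreover have "\<not> zero_rep Q ?M" by (simp add: zero_rep_iff[OF is_rep_iv] supp_iv[OF e(1)])
    moreover have "is_rep Q ?M" by (rule is_rep_iv)
    ultimately show False using m unfolding maximal_almost_rigid_def by blast
  qed
  then show "is_rep Q T \<and> mfree T \<and> supp T \<in> triangulations n p"
    using T mf nc triangulation_iff by blast
next
  assume h: "is_rep Q T \<and> mfree T \<and> supp T \<in> triangulations n p"
  then have T: "is_rep Q T" and mf: "mfree T" and nc: "noncrossing (supp T)"
    and mx: "\<And>e. e \<in> segments n \<Longrightarrow> (\<forall>s\<in>supp T. \<not> crossed e s) \<Longrightarrow> e \<in> supp T"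
    using triangulation_iff by blast+
  have "\<not> almost_rigid Q (dsum T M)" if M: "is_rep Q M" "\<not> zero_rep Q M" for M
  proof
    assume "almost_rigid Q (dsum T M)"
    then have "supp T \<inter> supp M = {}" "noncrossing (supp T \<union> supp M)"
      unfolding almost_rigid_iff supp_dsum[OF T M(1)] mfree_dsum[OF T M(1)] by blast+
    moreover obtain e where e: "e \<in> supp M" using M zero_rep_iff[OF M(1)] by blast
    ultimately have "e \<in> supp T" using mx[of e] supp_segments unfolding noncrossing_def by blast
    then show False using e \<open>supp T \<inter> supp M = {}\<close> by blast
  qed
  then show "maximal_almost_rigid Q T"
    unfolding maximal_almost_rigid_def almost_rigid_iff using T mf nc by blast
qed

text \<open>Apart from \<open>\<gamma>\<^sub>1\<close> the first triangulation lies in the second,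
  where nothing crosses \<open>\<gamma>\<^sub>2\<close>. If \<open>\<gamma>\<^sub>1\<close> did not
  cross it either, maximality would put \<open>\<gamma>\<^sub>2\<close> into the first
  triangulation.\<close>

lemma exchanged_crossed:
  assumes S: "S\<^sub>1 \<in> triangulations n p" "S\<^sub>2 \<in> triangulations n p"
    and g: "\<gamma>\<^sub>1 \<in> S\<^sub>1" "\<gamma>\<^sub>2 \<in> S\<^sub>2" "\<gamma>\<^sub>1 \<noteq> \<gamma>\<^sub>2" "S\<^sub>1 - {\<gamma>\<^sub>1} = S\<^sub>2 - {\<gamma>\<^sub>2}"
  shows "crossed \<gamma>\<^sub>2 \<gamma>\<^sub>1"
proof (rule ccontr)
  assume nc: "\<not> crossed \<gamma>\<^sub>2 \<gamma>\<^sub>1"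
  have "\<not> crossed \<gamma>\<^sub>2 s" if "s \<in> S\<^sub>1" for s
  proof (cases "s = \<gamma>\<^sub>1")
    case False
    then have "s \<in> S\<^sub>2" using that g(4) by blast
    then show ?thesis using S(2) g(2) unfolding triangulation_iff noncrossing_def by blast
  qed (use nc in simp)
  moreover have "\<gamma>\<^sub>2 \<in> segments n" using S(2) g(2) unfolding triangulation_iff noncrossing_def by blast
  ultimately have "\<gamma>\<^sub>2 \<in> S\<^sub>1" using S(1) unfolding triangulation_iff by blast
  then show False using g by blast
qed

lemma mar_covers_iff:
  fixes T\<^sub>1 T\<^sub>2 :: "(nat, 'a, 'k::field) qrep"
  assumes T1: "is_rep Q T\<^sub>1" "mfree T\<^sub>1" "supp T\<^sub>1 \<in> triangulations n p"
    and T2: "is_rep Q T\<^sub>2" "mfree T\<^sub>2" "supp T\<^sub>2 \<in> triangulations n p"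
  shows "mar_covers Q T\<^sub>1 T\<^sub>2 \<longleftrightarrow> (\<exists>\<gamma>\<^sub>1\<in>supp T\<^sub>1. \<exists>\<gamma>\<^sub>2\<in>supp T\<^sub>2. \<gamma>\<^sub>1 \<noteq> \<gamma>\<^sub>2 \<and>
    supp T\<^sub>1 - {\<gamma>\<^sub>1} = supp T\<^sub>2 - {\<gamma>\<^sub>2} \<and> slope p \<gamma>\<^sub>1 < slope p \<gamma>\<^sub>2)"
proof
  assume "mar_covers Q T\<^sub>1 T\<^sub>2"
  then obtain M\<^sub>1 M\<^sub>2 C\<^sub>1 C\<^sub>2 E E' f g where
    M1: "indecomposable Q M\<^sub>1" "complement Q T\<^sub>1 M\<^sub>1 C\<^sub>1" and
    M2: "indecomposable Q M\<^sub>2" "complement Q T\<^sub>2 M\<^sub>2 C\<^sub>2" and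
    CC: "rep_iso Q C\<^sub>1 C\<^sub>2" and E: "indec_summand Q C\<^sub>1 E" "indec_summand Q C\<^sub>1 E'" and
    ex: "short_exact Q M\<^sub>1 (dsum E E') M\<^sub>2 f g" "\<not> splits Q (dsum E E') M\<^sub>2 g"
    unfolding mar_covers_def by blast
  obtain \<gamma>\<^sub>1 where g1: "\<gamma>\<^sub>1 \<in> segments n" "fiso Q M\<^sub>1 (iv Q \<gamma>\<^sub>1)" and rM1: "is_rep Q M\<^sub>1"
    using M1(1) indecomposable_iff by blast
  obtain \<gamma>\<^sub>2 where g2: "\<gamma>\<^sub>2 \<in> segments n" "fiso Q M\<^sub>2 (iv Q \<gamma>\<^sub>2)" and rM2: "is_rep Q M\<^sub>2"
    using M2(1) indecomposable_iff by blast
  have C1: "is_rep Q C\<^sub>1" "fiso Q T\<^sub>1 (dsum M\<^sub>1 C\<^sub>1)" and C2: "is_rep Q C\<^sub>2" "fiso Q T\<^sub>2 (dsum M\<^sub>2 C\<^sub>2)"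
    using M1(2) M2(2) complement_iff[OF T1(1)] complement_iff[OF T2(1)] by auto
  have sM: "supp M\<^sub>1 = {\<gamma>\<^sub>1}" "supp M\<^sub>2 = {\<gamma>\<^sub>2}"
    using supp_fiso[OF g1(2)] supp_fiso[OF g2(2)] by (simp_all add: supp_iv g1(1) g2(1))
  have S1: "supp T\<^sub>1 = insert \<gamma>\<^sub>1 (supp C\<^sub>1)" "\<gamma>\<^sub>1 \<notin> supp C\<^sub>1"
    using supp_fiso[OF C1(2)] mfree_fiso[OF T1(1) C1(2)] T1(2)
    by (auto simp: supp_dsum[OF rM1 C1(1)] mfree_dsum[OF rM1 C1(1)] sM)
  have S2: "supp T\<^sub>2 = insert \<gamma>\<^sub>2 (supp C\<^sub>2)" "\<gamma>\<^sub>2 \<notin> supp C\<^sub>2"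
    using supp_fiso[OF C2(2)] mfree_fiso[OF T2(1) C2(2)] T2(2)
    by (auto simp: supp_dsum[OF rM2 C2(1)] mfree_dsum[OF rM2 C2(1)] sM)
  have "supp C\<^sub>1 = supp C\<^sub>2" using supp_fiso CC rep_iso_fiso[OF C1(1) C2(1)] by blast
  then have eq: "supp T\<^sub>1 - {\<gamma>\<^sub>1} = supp T\<^sub>2 - {\<gamma>\<^sub>2}" using S1 S2 by auto
  have rE: "is_rep Q (dsum E E')"
    using E by (intro is_rep_dsum) (auto simp: indec_summand_def indecomposable_def)
  obtain R S where fex: "fexact Q M\<^sub>1 (dsum E E') M\<^sub>2 (fam Q f) (fam Q g) R S"
    using short_exactD[OF wf rM1 rE rM2 ex(1)] by blast
  have "rep_hom Q (dsum E E') M\<^sub>2 g" using ex(1) by (simp add: short_exact_def)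
  then have "\<not> all_split Q M\<^sub>2 M\<^sub>1"
    using ex(2) splits_iff[OF wf rE rM2] rE fex unfolding all_split_def by blast
  then have ns: "\<not> all_split Q (iv Q \<gamma>\<^sub>2 :: (nat, 'a, 'k) qrep) (iv Q \<gamma>\<^sub>1)"
    using all_split_transport[OF g2(2) g1(2)] by blast
  \<comment> \<open>A nonsplit extension forces this orientation once the intervals overlap.
    Intervals without a common vertex can have nonsplit extensions too; they are ruled out below
    because exchanged segments cross.\<close>
  have nov: "cross \<gamma>\<^sub>2 \<gamma>\<^sub>1" if "overlap \<gamma>\<^sub>2 \<gamma>\<^sub>1"
    using ns all_split_iv[OF g2(1) g1(1)] that by blast
  have ne: "\<gamma>\<^sub>1 \<noteq> \<gamma>\<^sub>2"
  proof
    assume "\<gamma>\<^sub>1 = \<gamma>\<^sub>2"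
    moreover have "overlap \<gamma>\<^sub>1 \<gamma>\<^sub>1" using g1(1) by (simp add: overlap_def mem_segments)
    ultimately show False using nov by (simp add: cross_def)
  qed
  have gS: "\<gamma>\<^sub>1 \<in> supp T\<^sub>1" "\<gamma>\<^sub>2 \<in> supp T\<^sub>2" using S1 S2 by auto
  have "crossed \<gamma>\<^sub>2 \<gamma>\<^sub>1" by (rule exchanged_crossed[OF T1(3) T2(3) gS ne eq])
  then have "overlap \<gamma>\<^sub>2 \<gamma>\<^sub>1" by (auto simp: crossed_def cross_def overlap_def)
  then have "slope p \<gamma>\<^sub>1 < slope p \<gamma>\<^sub>2" using cross_slope[OF g2(1) g1(1)] nov by blast
  with gS ne eq show "\<exists>\<gamma>\<^sub>1\<in>supp T\<^sub>1. \<exists>\<gamma>\<^sub>2\<in>supp T\<^sub>2. \<gamma>\<^sub>1 \<noteq> \<gamma>\<^sub>2 \<and>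
    supp T\<^sub>1 - {\<gamma>\<^sub>1} = supp T\<^sub>2 - {\<gamma>\<^sub>2} \<and> slope p \<gamma>\<^sub>1 < slope p \<gamma>\<^sub>2" by blast
next
  assume "\<exists>\<gamma>\<^sub>1\<in>supp T\<^sub>1. \<exists>\<gamma>\<^sub>2\<in>supp T\<^sub>2. \<gamma>\<^sub>1 \<noteq> \<gamma>\<^sub>2 \<and>
    supp T\<^sub>1 - {\<gamma>\<^sub>1} = supp T\<^sub>2 - {\<gamma>\<^sub>2} \<and> slope p \<gamma>\<^sub>1 < slope p \<gamma>\<^sub>2"
  then obtain \<gamma>\<^sub>1 \<gamma>\<^sub>2 where gS: "\<gamma>\<^sub>1 \<in> supp T\<^sub>1" "\<gamma>\<^sub>2 \<in> supp T\<^sub>2" and ne: "\<gamma>\<^sub>1 \<noteq> \<gamma>\<^sub>2"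
    and eq: "supp T\<^sub>1 - {\<gamma>\<^sub>1} = supp T\<^sub>2 - {\<gamma>\<^sub>2}" and sl: "slope p \<gamma>\<^sub>1 < slope p \<gamma>\<^sub>2" by blast
  obtain a b c d where ab: "\<gamma>\<^sub>2 = (a, b)" and cd: "\<gamma>\<^sub>1 = (c, d)" by fastforce
  have seg1: "(c, d) \<in> segments n" and seg2: "(a, b) \<in> segments n" using gS supp_segments ab cd by blast+
  have "crossed \<gamma>\<^sub>2 \<gamma>\<^sub>1" by (rule exchanged_crossed[OF T1(3) T2(3) gS ne eq])
  then have x: "cross (a, b) (c, d)"
    using cross_slope[OF seg1 seg2] sl by (auto simp: crossed_def ab cd)
  note s = cross_exact(1,2)[OF seg2 seg1 x]
  have nc1: "\<not> crossed f (c, d)" if "f \<in> supp T\<^sub>1" for f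
    using T1(3) gS(1) that unfolding triangulation_iff noncrossing_def cd by blast
  have nc2: "\<not> crossed f (a, b)" if "f \<in> supp T\<^sub>1" "f \<noteq> (c, d)" for f
  proof -
    have "f \<in> supp T\<^sub>2" using that eq cd by blast
    then show ?thesis using T2(3) gS(2) unfolding triangulation_iff noncrossing_def ab by blast
  qed
  have x': "crossed (a, b) (c, d)" "crossed (c, d) (a, b)" using x by (auto simp: crossed_def)
  \<comment> \<open>A member of \<open>supp T\<^sub>1\<close> other than
    \<open>\<gamma>\<^sub>1\<close> belongs to both triangulations and crosses neither diagonal, so
    by \<open>crossed_side\<close> it crosses no side; \<open>\<gamma>\<^sub>1\<close> shares an end
    with each of the two sides.\<close>
  have side: "e \<in> supp T\<^sub>1 - {\<gamma>\<^sub>1}" if e: "e \<in> {(a, d), (c, b)}" for e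
  proof -
    have es: "e \<in> segments n" using e s by blast
    have "\<not> crossed e f" if f: "f \<in> supp T\<^sub>1" for f
    proof (cases "f = (c, d)")
      case True
      then show ?thesis using e by (auto simp: crossed_def cross_def)
    next
      case False
      obtain f1 f2 where ff: "f = (f1, f2)" by fastforce
      have fs: "(f1, f2) \<in> segments n" using f supp_segments ff by blast
      have "\<not> crossed f e"
        using crossed_side[OF seg2 seg1 x'(1) s(1) fs] crossed_side[OF seg1 seg2 x'(2) s(2) fs]
          nc1[OF f] nc2[OF f False] e by (auto simp: ff)
      then show ?thesis using crossed_sym by blast
    qed
    then have "e \<in> supp T\<^sub>1" using T1(3) es unfolding triangulation_iff by blast
    moreover have "e \<noteq> \<gamma>\<^sub>1" using e x cd by (auto simp: cross_def)
    ultimately show ?thesis by blast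
  qed
  obtain C\<^sub>1 where C1: "is_rep Q C\<^sub>1" "fiso Q T\<^sub>1 (dsum (iv Q \<gamma>\<^sub>1) C\<^sub>1)" using split_supp[OF T1(1) gS(1)] by blast
  obtain C\<^sub>2 where C2: "is_rep Q C\<^sub>2" "fiso Q T\<^sub>2 (dsum (iv Q \<gamma>\<^sub>2) C\<^sub>2)" using split_supp[OF T2(1) gS(2)] by blast
  have S1: "supp T\<^sub>1 = insert \<gamma>\<^sub>1 (supp C\<^sub>1)" "\<gamma>\<^sub>1 \<notin> supp C\<^sub>1" "mfree C\<^sub>1"
    using supp_fiso[OF C1(2)] mfree_fiso[OF T1(1) C1(2)] T1(2) seg1
    by (auto simp: supp_dsum[OF is_rep_iv C1(1)] mfree_dsum[OF is_rep_iv C1(1)] supp_iv cd)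
  have S2: "supp T\<^sub>2 = insert \<gamma>\<^sub>2 (supp C\<^sub>2)" "\<gamma>\<^sub>2 \<notin> supp C\<^sub>2" "mfree C\<^sub>2"
    using supp_fiso[OF C2(2)] mfree_fiso[OF T2(1) C2(2)] T2(2) seg2
    by (auto simp: supp_dsum[OF is_rep_iv C2(1)] mfree_dsum[OF is_rep_iv C2(1)] supp_iv ab)
  have sC: "supp C\<^sub>1 = supp T\<^sub>1 - {\<gamma>\<^sub>1}" "supp C\<^sub>2 = supp C\<^sub>1" using S1 S2 eq by auto
  have CC: "rep_iso Q C\<^sub>1 C\<^sub>2"
    using mfree_determined[OF C1(1) C2(1) S1(3) S2(3)] sC rep_iso_fiso[OF C1(1) C2(1)] by simp
  let ?E = "iv Q (a, d) :: (nat, 'a, 'k) qrep" and ?E' = "iv Q (c, b) :: (nat, 'a, 'k) qrep"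
  have E: "indec_summand Q C\<^sub>1 ?E" "indec_summand Q C\<^sub>1 ?E'"
    unfolding indec_summand_iff[OF C1(1)] sC(1) using side is_rep_iv fiso_refl[OF wf is_rep_iv] by blast+
  have rE: "is_rep Q (dsum ?E ?E')" by (intro is_rep_dsum is_rep_iv)
  obtain F G R S where ex: "fexact Q (iv Q (c, d)) (dsum ?E ?E') (iv Q (a, b) :: (nat, 'a, 'k) qrep) F G R S"
    using cross_exact(3)[OF seg2 seg1 x] by blast
  let ?f = "unfam (iv Q (c, d)) (dsum ?E ?E') F" and ?g = "unfam (dsum ?E ?E') (iv Q (a, b)) G"
  have se: "short_exact Q (iv Q (c, d)) (dsum ?E ?E') (iv Q (a, b)) ?f ?g"
    by (rule short_exact_unfam[OF wf is_rep_iv rE is_rep_iv ex])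
  have fg: "fam Q ?g = G" using ex by (auto intro!: fam_unfam fhom_fsup simp: fexact_def)
  have hg: "rep_hom Q (dsum ?E ?E') (iv Q (a, b)) ?g" using se by (simp add: short_exact_def)
  have nsp: "\<not> splits Q (dsum ?E ?E') (iv Q (a, b)) ?g"
    unfolding splits_iff[OF wf rE is_rep_iv hg] fg by (rule cross_nonsplit[OF seg2 seg1 x ex])
  have M: "indecomposable Q (iv Q (c, d) :: (nat, 'a, 'k) qrep)" "indecomposable Q (iv Q (a, b) :: (nat, 'a, 'k) qrep)"
    using indecomposable_iv seg1 seg2 by blast+
  have K: "complement Q T\<^sub>1 (iv Q (c, d)) C\<^sub>1" "complement Q T\<^sub>2 (iv Q (a, b)) C\<^sub>2"
    unfolding complement_iff[OF T1(1)] complement_iff[OF T2(1)] using C1 C2 is_rep_iv ab cd by blast+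
  show "mar_covers Q T\<^sub>1 T\<^sub>2"
    unfolding mar_covers_def using M(1) K(1) M(2) K(2) CC E se nsp by blast
qed

text \<open>Isomorphic representations have equal supports, so the union over a class selects the
  common support without choosing a representative. Boundary edges are included, as in
  triangulations.\<close>

definition diagonals :: "(nat, 'a, 'k::field) qrep set \<Rightarrow> (nat \<times> nat) set" where
  "diagonals X = (\<Union>T\<in>X. supp T)"

lemma mar_class:
  fixes X :: "(nat, 'a, 'k::field) qrep set"
  assumes "X \<in> mar Q"
  obtains T where "T \<in> X" "is_rep Q T" "mfree T" "supp T \<in> triangulations n p"
    "X = {T'. is_rep Q T' \<and> fiso Q T T'}"
proof -
  obtain T where T: "maximal_almost_rigid Q T" "X = {(T, T'). is_rep Q T \<and> is_rep Q T' \<and> rep_iso Q T T'} `` {T}"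
    using assms unfolding mar_def by (auto elim!: quotientE)
  have r: "is_rep Q T" "mfree T" "supp T \<in> triangulations n p" using T(1) maximal_almost_rigid_iff by blast+
  have "X = {T'. is_rep Q T' \<and> fiso Q T T'}" using T(2) r(1) rep_iso_fiso by auto
  then show thesis using that r fiso_refl[OF wf r(1)] by blast
qed

lemma mar_member:
  fixes X :: "(nat, 'a, 'k::field) qrep set"
  assumes "X \<in> mar Q" "T \<in> X"
  shows "is_rep Q T" "mfree T" "supp T = diagonals X" "diagonals X \<in> triangulations n p"
proof -
  obtain T' where T': "T' \<in> X" "is_rep Q T'" "mfree T'" "supp T' \<in> triangulations n p"
    "X = {T. is_rep Q T \<and> fiso Q T' T}" using mar_class[OF assms(1)] by blast
  have sup: "supp U = supp T'" if "U \<in> X" for U using that T'(5) supp_fiso by blast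
  then have "diagonals X = supp T'" unfolding diagonals_def using T'(1) by blast
  then show "is_rep Q T" "mfree T" "supp T = diagonals X" "diagonals X \<in> triangulations n p"
    using assms(2) T' sup[OF assms(2)] mfree_fiso[OF T'(2), of T] by auto
qed

lemma diagonals_bij:
  "bij_betw diagonals (mar Q :: (nat, 'a, 'k::field) qrep set set) (triangulations n p)"
  unfolding bij_betw_def
proof
  show "inj_on diagonals (mar Q :: (nat, 'a, 'k) qrep set set)"
  proof (rule inj_onI)
    fix X Y :: "(nat, 'a, 'k) qrep set"
    assume XY: "X \<in> mar Q" "Y \<in> mar Q" "diagonals X = diagonals Y"
    obtain T where T: "T \<in> X" "X = {T'. is_rep Q T' \<and> fiso Q T T'}" using mar_class[OF XY(1)] by blast
    obtain U where U: "U \<in> Y" "Y = {T'. is_rep Q T' \<and> fiso Q U T'}" using mar_class[OF XY(2)] by blast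
    have "fiso Q T U"
      using mfree_determined mar_member(1-3)[OF XY(1) T(1)] mar_member(1-3)[OF XY(2) U(1)] XY(3) by metis
    then show "X = Y" unfolding T(2) U(2) using fiso_trans fiso_sym by blast
  qed
  show "diagonals ` (mar Q :: (nat, 'a, 'k) qrep set set) = triangulations n p"
  proof (intro subset_antisym subsetI)
    fix S assume "S \<in> diagonals ` (mar Q :: (nat, 'a, 'k) qrep set set)"
    then obtain X :: "(nat, 'a, 'k) qrep set" where X: "X \<in> mar Q" "S = diagonals X" by blast
    then show "S \<in> triangulations n p" using mar_class[OF X(1)] mar_member(4)[OF X(1)] by blast
  next
    fix S assume S: "S \<in> triangulations n p"
    then have "S \<subseteq> segments n" unfolding triangulation_iff noncrossing_def by blast
    then obtain T :: "(nat, 'a, 'k) qrep" where T: "is_rep Q T" "mfree T" "supp T = S"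
      using mfree_exists by blast
    let ?r = "{(T :: (nat, 'a, 'k) qrep, T'). is_rep Q T \<and> is_rep Q T' \<and> rep_iso Q T T'}"
    have X: "?r `` {T} \<in> mar Q"
      unfolding mar_def using T S maximal_almost_rigid_iff by (intro quotientI) auto
    have "T \<in> ?r `` {T}" using T(1) rep_iso_fiso[OF T(1) T(1)] fiso_refl[OF wf T(1)] by auto
    from mar_member(3)[OF X this] have "S = diagonals (?r `` {T})" using T(3) by simp
    then show "S \<in> diagonals ` (mar Q :: (nat, 'a, 'k) qrep set set)" using X by blast
  qed
qed

lemma cover_rel_iff:
  fixes X Y :: "(nat, 'a, 'k::field) qrep set"
  assumes X: "X \<in> mar Q" and Y: "Y \<in> mar Q"
  shows "(X, Y) \<in> mar_cover_rel Q \<longleftrightarrow> (diagonals X, diagonals Y) \<in> cambrian_cover_rel n p"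
proof -
  have c: "mar_covers Q T U \<longleftrightarrow> (diagonals X, diagonals Y) \<in> cambrian_cover_rel n p" if "T \<in> X" "U \<in> Y" for T U
    using mar_covers_iff[of T U] mar_member[OF X that(1)] mar_member[OF Y that(2)]
    by (simp add: cambrian_cover_rel_def)
  obtain T U where "T \<in> X" "U \<in> Y" using mar_class[OF X] mar_class[OF Y] by metis
  then show ?thesis using c X Y unfolding mar_cover_rel_def by auto
qed

lemma cover_slope_sum:
  assumes "(S\<^sub>1, S\<^sub>2) \<in> cambrian_cover_rel n p"
  shows "(\<Sum>s\<in>S\<^sub>1. slope p s) < (\<Sum>s\<in>S\<^sub>2. slope p s)"
proof -
  obtain \<gamma>\<^sub>1 \<gamma>\<^sub>2 where S: "S\<^sub>1 \<in> triangulations n p" "S\<^sub>2 \<in> triangulations n p" "\<gamma>\<^sub>1 \<in> S\<^sub>1" "\<gamma>\<^sub>2 \<in> S\<^sub>2"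
    and eq: "S\<^sub>1 - {\<gamma>\<^sub>1} = S\<^sub>2 - {\<gamma>\<^sub>2}" and sl: "slope p \<gamma>\<^sub>1 < slope p \<gamma>\<^sub>2"
    using assms by (auto simp: cambrian_cover_rel_def)
  have "finite S\<^sub>1" "finite S\<^sub>2"
    using S(1,2) finite_subset[OF _ finite_segments] unfolding triangulation_iff noncrossing_def by blast+
  then show ?thesis
    using S(3,4) eq sl by (simp add: sum.remove[of S\<^sub>1 \<gamma>\<^sub>1] sum.remove[of S\<^sub>2 \<gamma>\<^sub>2])
qed

end

theorem theorem5:
  fixes n :: nat
    and Q :: "(nat, 'a) pre_digraph"
    and p :: "nat \<Rightarrow> real \<times> real"
  assumes "dynkin_A (n + 2) Q"
    and "is_polygon n Q p"
  shows "partial_order_on (mar Q :: (nat, 'a, 'k::alg_closed_field) qrep set set) (mar_order Q)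
    \<and> partial_order_on (triangulations n p) (cambrian_order n p)
    \<and> (\<exists>\<Phi>. bij_betw \<Phi> (mar Q :: (nat, 'a, 'k) qrep set set) (triangulations n p) \<and>
          (\<forall>X\<in>mar Q. \<forall>Y\<in>mar Q.
             (X, Y) \<in> mar_order Q \<longleftrightarrow> (\<Phi> X, \<Phi> Y) \<in> cambrian_order n p))"
proof -
  interpret polygon n Q p
    using assms by unfold_locales
  let ?R = "mar_cover_rel Q :: ((nat, 'a, 'k) qrep set \<times> (nat, 'a, 'k) qrep set) set"
  let ?C = "cambrian_cover_rel n p"
  let ?w = "\<lambda>S. \<Sum>s\<in>S. slope p s"
  have R: "?R \<subseteq> mar Q \<times> mar Q" and C: "?C \<subseteq> triangulations n p \<times> triangulations n p"
    by (auto simp: mar_cover_rel_def cambrian_cover_rel_def)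
  have RC: "(X, Y) \<in> ?R \<longleftrightarrow> (diagonals X, diagonals Y) \<in> ?C" if "X \<in> mar Q" "Y \<in> mar Q" for X Y
    by (rule cover_rel_iff[OF that])
  have "partial_order_on (triangulations n p) (cambrian_order n p)"
    unfolding cambrian_order_def by (rule partial_order_rtrancl[of _ ?w]) (rule cover_slope_sum)
  moreover have "partial_order_on (mar Q :: (nat, 'a, 'k) qrep set set) (mar_order Q)"
    unfolding mar_order_def
  proof (rule partial_order_rtrancl[of _ "\<lambda>X. ?w (diagonals X)"])
    fix X Y :: "(nat, 'a, 'k) qrep set" assume "(X, Y) \<in> ?R"
    then show "?w (diagonals X) < ?w (diagonals Y)" using R RC cover_slope_sum by blast
  qed
  moreover have "(X, Y) \<in> mar_order Q \<longleftrightarrow> (diagonals X, diagonals Y) \<in> cambrian_order n p"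
    if XY: "X \<in> mar Q" "Y \<in> mar Q" for X Y :: "(nat, 'a, 'k) qrep set"
    using rtrancl_transfer[OF diagonals_bij R C RC XY] XY bij_betwE[OF diagonals_bij]
    by (auto simp: mar_order_def cambrian_order_def)
  ultimately show ?thesis using diagonals_bij by blast
qed

end
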